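(* Let $R\subseteq S$ be an étale ring extension, where $R$ is a FMIR. (1) $S$ is a FMIR, and for $Q\in\mathrm{Spec}(S)$ and $P:=Q\cap R$, $S_Q$ is a field (respectively, a finite ring, an infinite SPIR) if and only if $R_P$ is a field (respectively, a finite ring, an infinite SPIR). (2) If in addition $\mathrm{rk}_{R_P}(S_P)\le 2$ for each prime ideal $P\in\mathrm{Supp}_R(S/R)$ such that $R_P$ is an infinite SPIR, then $R\subseteq S$ has FIP.
   Context: Rings are commutative with identity. Étale: flat, of finite presentation and unramified. A FMIR is a ring with only finitely many ideals (equivalently a finite product of finite local rings, infinite SPIRs and fields). A SPIR is a local ring, not a field, whose maximal ideal is principal and nilpotent. $\mathrm{rk}_{R_P}(S_P)$ is the rank of $S_P$ as a free $R_P$-module. $\mathrm{Supp}_R(S/R)$ is the set of primes $P$ of $R$ with $(S/R)_P\neq0$. FIP: finitely many $R$-subalgebras of $S$. *)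

theory Defs
  imports "HOL-Algebra.Ideal" "HOL-Algebra.Subrings" "HOL-Library.Poly_Mapping"
begin

text \<open>The ambient ring S is a type 'a of class comm_ring_1 (S = UNIV);
  a subring R of S is a set. ring_of A views a subset A as a ring structure.\<close>

definition ring_of :: "'a::comm_ring_1 set \<Rightarrow> 'a ring" where
  "ring_of A = \<lparr>carrier = A, mult = (*), one = 1, zero = 0, add = (+)\<rparr>"

definition FMIR :: "('b, 'm) ring_scheme \<Rightarrow> bool" where
  "FMIR L \<longleftrightarrow> cring L \<and> finite {I. ideal I L}"

definition nilpotent_ideal :: "('b, 'm) ring_scheme \<Rightarrow> 'b set \<Rightarrow> bool" where
  "nilpotent_ideal L M \<longleftrightarrow>
     (\<exists>n. \<forall>xs. length xs = n \<and> set xs \<subseteq> M \<longrightarrow> foldr (\<otimes>\<^bsub>L\<^esub>) xs \<one>\<^bsub>L\<^esub> = \<zero>\<^bsub>L\<^esub>)"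

definition local_ring :: "('b, 'm) ring_scheme \<Rightarrow> bool" where
  "local_ring L \<longleftrightarrow> cring L \<and> (\<exists>!M. maximalideal M L)"

definition SPIR :: "('b, 'm) ring_scheme \<Rightarrow> bool" where
  "SPIR L \<longleftrightarrow> local_ring L \<and> \<not> field L \<and>
     (\<forall>M. maximalideal M L \<longrightarrow> principalideal M L \<and> nilpotent_ideal L M)"

definition inf_SPIR :: "('b, 'm) ring_scheme \<Rightarrow> bool" where
  "inf_SPIR L \<longleftrightarrow> SPIR L \<and> infinite (carrier L)"

definition loc_rel :: "'a::comm_ring_1 set \<Rightarrow> 'a set \<Rightarrow> (('a \<times> 'a) \<times> ('a \<times> 'a)) set" where
  "loc_rel A T = {((a, t), (b, u)). a \<in> A \<and> t \<in> T \<and> b \<in> A \<and> u \<in> T \<and>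
                     (\<exists>v\<in>T. v * (a * u - b * t) = 0)}"

definition loc_mult :: "'a::comm_ring_1 set \<Rightarrow> 'a set \<Rightarrow> ('a \<times> 'a) set \<Rightarrow> ('a \<times> 'a) set \<Rightarrow> ('a \<times> 'a) set" where
  "loc_mult A T X Y = (\<Union>p\<in>X. \<Union>q\<in>Y. loc_rel A T `` {(fst p * fst q, snd p * snd q)})"

definition loc_add :: "'a::comm_ring_1 set \<Rightarrow> 'a set \<Rightarrow> ('a \<times> 'a) set \<Rightarrow> ('a \<times> 'a) set \<Rightarrow> ('a \<times> 'a) set" where
  "loc_add A T X Y =
     (\<Union>p\<in>X. \<Union>q\<in>Y. loc_rel A T `` {(fst p * snd q + fst q * snd p, snd p * snd q)})"

definition localization :: "'a::comm_ring_1 set \<Rightarrow> 'a set \<Rightarrow> ('a \<times> 'a) set ring" where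
  "localization A T =
     \<lparr>carrier = (A \<times> T) // loc_rel A T,
      mult = loc_mult A T,
      one = loc_rel A T `` {(1, 1)},
      zero = loc_rel A T `` {(0, 1)},
      add = loc_add A T\<rparr>"

text \<open>R_P = localization R (R - P);  S_Q = localization UNIV (UNIV - Q);
  S_P = localization UNIV (R - P), an R_P-module via the scalar action below.\<close>

definition loc_scal :: "'a::comm_ring_1 set \<Rightarrow> ('a \<times> 'a) set \<Rightarrow> ('a \<times> 'a) set \<Rightarrow> ('a \<times> 'a) set" where
  "loc_scal T X Y = (\<Union>p\<in>X. \<Union>q\<in>Y. loc_rel UNIV T `` {(fst p * fst q, snd p * snd q)})"

definition loc_lincomb :: "'a::comm_ring_1 set \<Rightarrow> ('a \<times> 'a) set list \<Rightarrow> ('a \<times> 'a) set list \<Rightarrow> ('a \<times> 'a) set" where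
  "loc_lincomb T cs bs =
     foldr (\<lambda>(c, b) acc. loc_add UNIV T (loc_scal T c b) acc) (zip cs bs) (loc_rel UNIV T `` {(0, 1)})"

definition free_rank_le :: "'a::comm_ring_1 set \<Rightarrow> 'a set \<Rightarrow> nat \<Rightarrow> bool" where
  "free_rank_le R P k \<longleftrightarrow>
     (\<exists>bs. length bs \<le> k \<and> set bs \<subseteq> carrier (localization UNIV (R - P)) \<and>
        (\<forall>y\<in>carrier (localization UNIV (R - P)).
           \<exists>!cs. length cs = length bs \<and> set cs \<subseteq> carrier (localization R (R - P)) \<and>
                 y = loc_lincomb (R - P) cs bs))"

text \<open>Supp_R(S/R): primes P of R with (S/R)_P \<noteq> 0, i.e. some class s + R of S/R is not
  annihilated by any t \<in> R - P.\<close>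
definition Supp :: "'a::comm_ring_1 set \<Rightarrow> 'a set set" where
  "Supp R = {P. primeideal P (ring_of R) \<and> (\<exists>s. \<forall>t\<in>R - P. t * s \<notin> R)}"

text \<open>Flatness of S over R, via the equational criterion of flatness.\<close>
definition flat_ext :: "'a::comm_ring_1 set \<Rightarrow> bool" where
  "flat_ext R \<longleftrightarrow>
     (\<forall>n (r :: nat \<Rightarrow> 'a) (x :: nat \<Rightarrow> 'a).
        (\<forall>i<n. r i \<in> R) \<and> (\<Sum>i<n. r i * x i) = 0 \<longrightarrow>
        (\<exists>m (a :: nat \<Rightarrow> nat \<Rightarrow> 'a) (y :: nat \<Rightarrow> 'a).
           (\<forall>i<n. \<forall>j<m. a i j \<in> R) \<and>
           (\<forall>i<n. x i = (\<Sum>j<m. a i j * y j)) \<and>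
           (\<forall>j<m. (\<Sum>i<n. r i * a i j) = 0)))"

definition mpoly_eval :: "(nat \<Rightarrow> 'a::comm_ring_1) \<Rightarrow> ((nat \<Rightarrow>\<^sub>0 nat) \<Rightarrow>\<^sub>0 'a) \<Rightarrow> 'a" where
  "mpoly_eval x p =
     (\<Sum>m\<in>Poly_Mapping.keys p. Poly_Mapping.lookup p m * (\<Prod>i\<in>Poly_Mapping.keys m. x i ^ Poly_Mapping.lookup m i))"

definition mpoly_over :: "'a::comm_ring_1 set \<Rightarrow> nat \<Rightarrow> ((nat \<Rightarrow>\<^sub>0 nat) \<Rightarrow>\<^sub>0 'a) \<Rightarrow> bool" where
  "mpoly_over R n p \<longleftrightarrow> (\<forall>m\<in>Poly_Mapping.keys p. Poly_Mapping.lookup p m \<in> R \<and> Poly_Mapping.keys m \<subseteq> {..<n})"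

definition fin_pres :: "'a::comm_ring_1 set \<Rightarrow> bool" where
  "fin_pres R \<longleftrightarrow>
     (\<exists>n (x :: nat \<Rightarrow> 'a) fs.
        (\<forall>s. \<exists>p. mpoly_over R n p \<and> mpoly_eval x p = s) \<and>
        (\<forall>f\<in>set fs. mpoly_over R n f \<and> mpoly_eval x f = 0) \<and>
        (\<forall>p. mpoly_over R n p \<and> mpoly_eval x p = 0 \<longrightarrow>
           (\<exists>hs. length hs = length fs \<and> (\<forall>h\<in>set hs. mpoly_over R n h) \<and>
                 p = (\<Sum>i<length fs. hs ! i * fs ! i))))"

text \<open>The S-submodule of the free S-module on symbols ds (s in S) generated by the
  relations defining the module of Kaehler differentials Omega_{S/R}.\<close>
inductive_set omega_rels :: "'a::comm_ring_1 set \<Rightarrow> ('a \<Rightarrow>\<^sub>0 'a) set" for R where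
  zero: "0 \<in> omega_rels R"
| add: "a \<in> omega_rels R \<Longrightarrow> b \<in> omega_rels R \<Longrightarrow> a + b \<in> omega_rels R"
| rel_add: "Poly_Mapping.single (x + y) c - Poly_Mapping.single x c - Poly_Mapping.single y c
              \<in> omega_rels R"
| rel_mult: "Poly_Mapping.single (x * y) c - Poly_Mapping.single y (c * x)
               - Poly_Mapping.single x (c * y) \<in> omega_rels R"
| rel_const: "r \<in> R \<Longrightarrow> Poly_Mapping.single r c \<in> omega_rels R"

text \<open>Unramified: Omega_{S/R} = 0, i.e. every generator ds lies in the relation submodule
  (finite type is part of finite presentation).\<close>
definition unramified :: "'a::comm_ring_1 set \<Rightarrow> bool" where
  "unramified R \<longleftrightarrow> (\<forall>s. Poly_Mapping.single s 1 \<in> omega_rels R)"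

definition etale :: "'a::comm_ring_1 set \<Rightarrow> bool" where
  "etale R \<longleftrightarrow> flat_ext R \<and> fin_pres R \<and> unramified R"

definition FIP :: "'a::comm_ring_1 set \<Rightarrow> bool" where
  "FIP R \<longleftrightarrow> finite {T. subring T (ring_of (UNIV :: 'a set)) \<and> R \<subseteq> T}"

end

theory Submission
  imports Defs
begin

text \<open>
  The hypothesis \<open>\<Omega> = 0\<close> says that the kernel \<open>I\<close> of \<open>S \<otimes>\<^sub>R S \<rightarrow> S\<close> is idempotent; it is finitely generated,
  so Nakayama's lemma yields a separability element \<open>\<Sum>i. a\<^sub>i \<otimes> b\<^sub>i\<close> with product \<open>1\<close> that is annihilated by
  \<open>I\<close>.  Modulo a prime \<open>P\<close> of \<open>R\<close>, averaging linear maps against this element shows that \<open>S / P S\<close> is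
  finite-dimensional over \<open>R / P\<close> and that each of its ideals is generated by an idempotent, so it
  has finitely many ideals.

  A ring \<open>R\<close> with finitely many ideals has, for each prime \<open>P\<close>, an idempotent \<open>e\<close> with \<open>R\<^sub>P = e R\<close>, and
  \<open>e R\<close> is finite or has a principal nilpotent maximal ideal \<open>q e R\<close>.  In the first case \<open>e S\<close> is finite; in
  the second an ideal of \<open>e S\<close> is determined by the finitely many possible ideals \<open>(I : q\<^sup>a) + P S\<close>.
  Since a module is determined by its factors \<open>e M\<close>, the ring \<open>S\<close> has finitely many ideals.

  For intermediate rings \<open>T\<close> it likewise suffices to bound the factors \<open>e T\<close>.  If \<open>e R\<close> is a field, \<open>T\<close> is
  determined by the kernel of \<open>S \<otimes>\<^sub>R S \<rightarrow> S \<otimes>\<^sub>T S\<close>, and \<open>S \<otimes>\<^sub>R S\<close> is again separable, hence has finitely many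
  ideals.  If \<open>e R\<close> is an infinite SPIR, rank at most two makes \<open>e S / e R\<close> cyclic over \<open>e R\<close>, so its
  submodules correspond to ideals of \<open>R\<close>.
\<close>

section \<open>Rings with finitely many ideals\<close>

text \<open>Quotient rings and tensor products are never formed. Statements about
  \<open>S / J\<close> are congruences modulo an ideal \<open>J\<close> of the ambient type, a map
  on \<open>S / J\<close> is a function that is linear modulo \<open>J\<close>, and
  \<open>S \<otimes>\<^sub>R S\<close> is a monoid algebra together with an ideal. The results on
  separability are therefore stated for an arbitrary type, subring and ideal, and apply both to
  \<open>S\<close> with \<open>J = P S\<close> and to the tensor square. Separability is tested
  against linear maps because complements of submodules supply exactly such maps. Dimension is
  replaced by a set of leading indices, so no basis has to be chosen. Flatness carries information
  from the localization of \<open>S\<close> at \<open>Q\<close> back to that of \<open>R\<close> at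
  \<open>P\<close>: it makes the map from \<open>e R\<close> to the factor of \<open>S\<close> at
  \<open>Q\<close> injective. The opposite direction rests on separability. The equivalence for
  infinite SPIRs needs no argument of its own: for a ring with finitely many ideals, a localization
  at a prime is an infinite SPIR exactly when it is infinite and not a field, and \<open>S\<close>
  is known to be such a ring by then.\<close>

definition subr :: "'a::comm_ring_1 set \<Rightarrow> bool" where
  "subr R \<longleftrightarrow> 1 \<in> R \<and> (\<forall>x\<in>R. \<forall>y\<in>R. x - y \<in> R \<and> x * y \<in> R)"

definition submod :: "'a::comm_ring_1 set \<Rightarrow> 'a set \<Rightarrow> bool" where
  "submod R M \<longleftrightarrow> 0 \<in> M \<and> (\<forall>x\<in>M. \<forall>y\<in>M. x + y \<in> M) \<and> (\<forall>r\<in>R. \<forall>x\<in>M. r * x \<in> M)"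

definition ideals_of :: "'a::comm_ring_1 set \<Rightarrow> 'a set set" where
  "ideals_of R = {I. I \<subseteq> R \<and> submod R I}"

definition prime_in :: "'a::comm_ring_1 set \<Rightarrow> 'a set \<Rightarrow> bool" where
  "prime_in R P \<longleftrightarrow> P \<in> ideals_of R \<and> 1 \<notin> P \<and> (\<forall>x\<in>R. \<forall>y\<in>R. x * y \<in> P \<longrightarrow> x \<in> P \<or> y \<in> P)"

definition prin :: "'a::comm_ring_1 set \<Rightarrow> 'a \<Rightarrow> 'a set" where
  "prin R x = {x * r |r. r \<in> R}"

lemma subr_1: "subr R \<Longrightarrow> 1 \<in> R"
  and subr_diff: "subr R \<Longrightarrow> x \<in> R \<Longrightarrow> y \<in> R \<Longrightarrow> x - y \<in> R"
  and subr_mult: "subr R \<Longrightarrow> x \<in> R \<Longrightarrow> y \<in> R \<Longrightarrow> x * y \<in> R"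
  by (auto simp: subr_def)

lemma subr_0: "subr R \<Longrightarrow> 0 \<in> R"
  using subr_diff[of R 1 1] subr_1[of R] by simp

lemma subr_uminus: "subr R \<Longrightarrow> x \<in> R \<Longrightarrow> - x \<in> R"
  using subr_diff[of R 0 x] subr_0[of R] by simp

lemma subr_add: "subr R \<Longrightarrow> x \<in> R \<Longrightarrow> y \<in> R \<Longrightarrow> x + y \<in> R"
  using subr_diff[of R x "- y"] subr_uminus[of R y] by simp

lemma subr_power: "subr R \<Longrightarrow> x \<in> R \<Longrightarrow> x ^ n \<in> R"
  by (induction n) (auto simp: subr_1 subr_mult)

lemma subr_sum: "subr R \<Longrightarrow> (\<And>i. i \<in> A \<Longrightarrow> f i \<in> R) \<Longrightarrow> sum f A \<in> R"
  by (induction A rule: infinite_finite_induct) (auto simp: subr_0 subr_add)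

lemma subr_prod: "subr R \<Longrightarrow> (\<And>i. i \<in> A \<Longrightarrow> f i \<in> R) \<Longrightarrow> prod f A \<in> R"
  by (induction A rule: infinite_finite_induct) (auto simp: subr_1 subr_mult)

lemmas subr_rules = subr_0 subr_1 subr_diff subr_mult subr_uminus subr_add subr_power

lemma subr_UNIV: "subr UNIV"
  by (simp add: subr_def)

lemma submod_0: "submod R M \<Longrightarrow> 0 \<in> M"
  and submod_add: "submod R M \<Longrightarrow> x \<in> M \<Longrightarrow> y \<in> M \<Longrightarrow> x + y \<in> M"
  and submod_mult: "submod R M \<Longrightarrow> r \<in> R \<Longrightarrow> x \<in> M \<Longrightarrow> r * x \<in> M"
  and submod_mult': "submod R M \<Longrightarrow> r \<in> R \<Longrightarrow> x \<in> M \<Longrightarrow> x * r \<in> M"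
  by (auto simp: submod_def mult.commute)

lemma submod_uminus: "subr R \<Longrightarrow> submod R M \<Longrightarrow> x \<in> M \<Longrightarrow> - x \<in> M"
  using submod_mult[of R M "-1" x] by (simp add: subr_uminus subr_1)

lemma submod_diff: "subr R \<Longrightarrow> submod R M \<Longrightarrow> x \<in> M \<Longrightarrow> y \<in> M \<Longrightarrow> x - y \<in> M"
  using submod_add[of R M x "- y"] submod_uminus[of R M y] by simp

lemma submod_sum: "submod R M \<Longrightarrow> (\<And>i. i \<in> A \<Longrightarrow> f i \<in> M) \<Longrightarrow> sum f A \<in> M"
  by (induction A rule: infinite_finite_induct) (auto simp: submod_0 submod_add)

lemma submod_mono: "submod R M \<Longrightarrow> R' \<subseteq> R \<Longrightarrow> submod R' M"
  by (auto simp: submod_def)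

lemma submod_self: "subr R \<Longrightarrow> submod R R"
  by (auto simp: submod_def subr_rules)

lemma submod_inter: "submod R M \<Longrightarrow> submod R N \<Longrightarrow> submod R (M \<inter> N)"
  by (auto simp: submod_def)

lemma idl_diff: "submod UNIV M \<Longrightarrow> x \<in> M \<Longrightarrow> y \<in> M \<Longrightarrow> x - y \<in> M"
  using submod_diff[OF subr_UNIV] .

lemma idl_uminus: "submod UNIV M \<Longrightarrow> x \<in> M \<Longrightarrow> - x \<in> M"
  using submod_uminus[OF subr_UNIV] .

lemma idl_mult: "submod UNIV M \<Longrightarrow> x \<in> M \<Longrightarrow> r * x \<in> M"
  and idl_mult': "submod UNIV M \<Longrightarrow> x \<in> M \<Longrightarrow> x * r \<in> M"
  by (auto simp: submod_def mult.commute)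

lemmas idl_rules = submod_0 submod_add idl_diff idl_uminus idl_mult idl_mult'

lemma submod_plus:
  assumes "submod R M" "submod R N"
  shows "submod R {x + y |x y. x \<in> M \<and> y \<in> N}"
  unfolding submod_def
proof (intro conjI ballI)
  show "0 \<in> {x + y |x y. x \<in> M \<and> y \<in> N}"
    using submod_0[OF assms(1)] submod_0[OF assms(2)] by force
next
  fix a b assume "a \<in> {x + y |x y. x \<in> M \<and> y \<in> N}" "b \<in> {x + y |x y. x \<in> M \<and> y \<in> N}"
  then obtain x y x' y' where h: "a = x + y" "b = x' + y'" "x \<in> M" "x' \<in> M" "y \<in> N" "y' \<in> N" by blast
  have "a + b = (x + x') + (y + y')" by (simp add: h algebra_simps)
  with h assms show "a + b \<in> {x + y |x y. x \<in> M \<and> y \<in> N}"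
    by (blast intro: submod_add)
next
  fix r a assume "r \<in> R" "a \<in> {x + y |x y. x \<in> M \<and> y \<in> N}"
  then obtain x y where h: "a = x + y" "x \<in> M" "y \<in> N" by blast
  have "r * a = r * x + r * y" by (simp add: h algebra_simps)
  with h assms \<open>r \<in> R\<close> show "r * a \<in> {x + y |x y. x \<in> M \<and> y \<in> N}"
    by (blast intro: submod_mult)
qed

lemma prinI: "r \<in> R \<Longrightarrow> x * r \<in> prin R x"
  and prinE: "y \<in> prin R x \<Longrightarrow> (\<And>r. r \<in> R \<Longrightarrow> y = x * r \<Longrightarrow> thesis) \<Longrightarrow> thesis"
  by (auto simp: prin_def)

lemma prin_self: "subr R \<Longrightarrow> x \<in> prin R x"
  using prinI[of 1 R x] subr_1[of R] by simp

lemma submod_prin: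
  assumes R: "subr R" shows "submod R (prin R x)"
  unfolding submod_def
proof (intro conjI ballI)
  show "0 \<in> prin R x" using prinI[OF subr_0[OF R], of x] by simp
  show "a + b \<in> prin R x" if "a \<in> prin R x" "b \<in> prin R x" for a b
    using that by (auto elim!: prinE intro!: prinI subr_add[OF R] simp: distrib_left[symmetric])
  show "r * a \<in> prin R x" if "r \<in> R" "a \<in> prin R x" for r a
    using that prinI[OF subr_mult[OF R], of r _ x] by (auto elim!: prinE simp: mult.left_commute)
qed

lemma prin_subset: "submod R M \<Longrightarrow> x \<in> M \<Longrightarrow> prin R x \<subseteq> M"
  by (auto elim!: prinE intro: submod_mult')

lemma prin_in_ideals_of: "subr R \<Longrightarrow> x \<in> R \<Longrightarrow> prin R x \<in> ideals_of R"
  by (simp add: ideals_of_def submod_prin prin_subset submod_self)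

section \<open>Idempotents that split off the local factors\<close>

lemma idem_nilpotent_eq_0: "x * x = x \<Longrightarrow> x ^ n = 0 \<Longrightarrow> x = (0::'a::comm_ring_1)"
proof (induction n)
  case (Suc n)
  have "x ^ Suc n = x ^ n" if "n > 0"
    using that Suc.prems(1) by (cases n) (auto simp: mult.assoc[symmetric])
  with Suc show ?case by (cases "n = 0") auto
qed simp

text \<open>The ideals \<open>r ^ n R\<close> take finitely many values, so
  \<open>r ^ i = r ^ j * x\<close> for some \<open>i < j\<close>. The resulting idempotent
  \<open>f\<close> is a multiple of \<open>r\<close>: on the factor \<open>f R\<close> the element
  \<open>r\<close> is a unit, on the complementary factor it is nilpotent.\<close>

lemma pi_regular:
  assumes R: "subr R" and fin: "finite (ideals_of R)" and r: "r \<in> R"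
  obtains f t n where "t \<in> R" "f = r * t" "f * f = f" "(r * (1 - f)) ^ n = 0"
proof -
  let ?I = "\<lambda>n::nat. prin R (r ^ n)"
  have "range ?I \<subseteq> ideals_of R"
    using prin_in_ideals_of[OF R] subr_power[OF R r] by blast
  then have "finite (range ?I)" using fin finite_subset by blast
  then have "\<not> inj ?I" using finite_imageD[of ?I UNIV] infinite_UNIV_nat by blast
  then obtain i' j' where ij': "i' \<noteq> j'" "?I i' = ?I j'" unfolding inj_def by blast
  define i j where "i = min i' j'" and "j = max i' j'"
  have ij: "i < j" using ij'(1) by (auto simp: i_def j_def)
  have ij2: "?I i = ?I j" using ij'(2) by (simp only: i_def j_def min_def max_def split: if_split) simp
  have "r ^ i \<in> ?I i" by (rule prin_self[OF R])
  then obtain x where x: "x \<in> R" "r ^ i = r ^ j * x" using ij2 by (auto elim: prinE)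
  define d where "d = j - i - 1"
  have step: "r ^ i = r ^ i * (r ^ d * r * x)"
  proof -
    have "j = i + Suc d" using ij by (simp add: d_def)
    then have "r ^ j = r ^ i * (r ^ d * r)" by (simp add: power_add mult_ac)
    with x(2) show ?thesis by (simp add: mult_ac)
  qed
  have pw: "r ^ i = r ^ i * (r ^ d * r * x) ^ m" for m
  proof (induction m)
    case (Suc m)
    have "r ^ i * (r ^ d * r * x) ^ Suc m = (r ^ i * (r ^ d * r * x)) * (r ^ d * r * x) ^ m"
      by (simp add: mult_ac)
    also have "\<dots> = r ^ i * (r ^ d * r * x) ^ m" using step by simp
    finally show ?case using Suc by simp
  qed simp
  \<comment> \<open>Iterating \<open>step\<close> exactly \<open>Suc i\<close> times splits off
    \<open>r ^ Suc i\<close>. Then \<open>f = r ^ Suc i * w\<close> satisfies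
    \<open>r ^ i * f = r ^ i\<close> and itself contains the factor \<open>r ^ i\<close>, whence
    \<open>f * f = f\<close>.\<close>
  define w where "w = (r ^ d * x) ^ Suc i"
  have w: "w \<in> R" by (simp add: w_def subr_rules R r x(1) del: power_Suc)
  have key: "r ^ i = r ^ i * (r ^ Suc i * w)"
  proof -
    have "(r ^ d * r * x) ^ Suc i = r ^ Suc i * w"
      unfolding w_def by (simp add: power_mult_distrib mult_ac)
    with pw[of "Suc i"] show ?thesis by simp
  qed
  define f where "f = r * (r ^ i * w)"
  have fi: "r ^ i * f = r ^ i" using key by (simp add: f_def mult_ac)
  have "f * f = r * w * (r ^ i * f)" by (simp add: f_def mult_ac)
  also have "\<dots> = f" by (simp add: fi) (simp add: f_def mult_ac)
  finally have ff: "f * f = f" .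
  have "(r * (1 - f)) ^ Suc i = r * (1 - f) ^ i * (r ^ i * (1 - f))"
    by (simp add: power_mult_distrib mult_ac)
  also have "r ^ i * (1 - f) = 0" using fi by (simp add: algebra_simps)
  finally have "(r * (1 - f)) ^ Suc i = 0" by simp
  then show thesis using that[of "r ^ i * w" f "Suc i"] w ff f_def
    by (auto simp: subr_rules R r)
qed

lemma nilpotent_in_prime:
  assumes "subr R" "prime_in R P" "x \<in> R" "x ^ n = 0" shows "x \<in> P"
proof -
  have "x ^ n \<in> P" using assms by (auto simp: prime_in_def ideals_of_def submod_0)
  then show ?thesis
  proof (induction n)
    case 0 then show ?case using assms by (auto simp: prime_in_def)
  next
    case (Suc n) then show ?case using assms subr_power[of R x n] by (auto simp: prime_in_def)
  qed
qed

text \<open>\<open>R\<^sub>P\<close> is the factor \<open>e R\<close> of \<open>R\<close>, with nil maximal ideal \<open>e P\<close>.\<close>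

definition local_idem :: "'a::comm_ring_1 set \<Rightarrow> 'a set \<Rightarrow> 'a \<Rightarrow> bool" where
  "local_idem R P e \<longleftrightarrow> e \<in> R \<and> e * e = e \<and> 1 - e \<in> P \<and> (\<forall>p\<in>P. \<exists>n. (e * p) ^ n = 0) \<and>
     (\<forall>r\<in>R - P. \<exists>t\<in>R. r * t = e)"

text \<open>Take an idempotent \<open>f\<close> in \<open>P\<close> with \<open>f R\<close> maximal
  and put \<open>e = 1 - f\<close>. By maximality (\<open>mx\<close>) no nonzero idempotent of
  \<open>P\<close> is orthogonal to \<open>f\<close>. For the idempotent that
  \<open>pi_regular\<close> attaches to \<open>e * p\<close> with \<open>p\<close> in
  \<open>P\<close>, this forces \<open>e * p\<close> to be nilpotent; for
  \<open>e * (1 - g)\<close>, where \<open>g\<close> is attached to some \<open>r\<close> outside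
  \<open>P\<close>, it makes \<open>r\<close> a unit on the factor \<open>e R\<close>.\<close>

lemma local_idem_exists:
  assumes R: "subr R" and fin: "finite (ideals_of R)" and P: "prime_in R P"
  shows "\<exists>e. local_idem R P e"
proof -
  have PR: "P \<subseteq> R" and Ps: "submod R P" and P1: "1 \<notin> P" using P by (auto simp: prime_in_def ideals_of_def)
  let ?I = "\<lambda>f. prin R f"
  let ?S = "{?I f |f. f \<in> P \<and> f * f = f}"
  have "?S \<subseteq> ideals_of R" using prin_in_ideals_of[OF R] PR by blast
  then have "finite ?S" using fin finite_subset by blast
  moreover have "?I 0 \<in> ?S" using submod_0[OF Ps] by force
  ultimately obtain M where M: "M \<in> ?S" "\<And>N. N \<in> ?S \<Longrightarrow> M \<subseteq> N \<Longrightarrow> N = M"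
    by (metis (no_types, lifting) empty_iff finite_has_maximal)
  then obtain f where f: "f \<in> P" "f * f = f" "M = ?I f" by blast
  have fR: "f \<in> R" using f PR by blast
  have mx: "g = 0" if g: "g \<in> P" "g * g = g" "g * f = 0" for g
  proof -
    have "(f + g) * (f + g) = f + g" using f(2) g(2,3) by (simp add: algebra_simps)
    moreover have "f + g \<in> P" using f g Ps submod_add by blast
    ultimately have "?I (f + g) \<in> ?S" by blast
    moreover have "M \<subseteq> ?I (f + g)"
    proof -
      have "f = (f + g) * f" using f(2) g(3) by (simp add: algebra_simps)
      then have "f * x = (f + g) * (f * x)" for x by (metis mult.assoc)
      then have "f \<in> ?I (f + g)" using prinI[OF fR, of "f + g"] by (metis mult.right_neutral)
      then show ?thesis unfolding f(3) by (rule prin_subset[OF submod_prin[OF R]])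
    qed
    ultimately have "?I (f + g) = ?I f" using M(2) f(3) by blast
    moreover have "f + g \<in> ?I (f + g)" by (rule prin_self[OF R])
    ultimately obtain x where x: "f + g = f * x" by (auto elim: prinE)
    have "g = g * (f + g)" using g by (simp add: algebra_simps)
    also have "\<dots> = g * f * x" by (simp add: x mult.assoc)
    finally show "g = 0" using g(3) by simp
  qed
  define e where "e = 1 - f"
  have eR: "e \<in> R" by (simp add: e_def subr_rules R fR)
  have ee: "e * e = e" and ef: "e * f = 0" using f(2) by (simp_all add: e_def algebra_simps)
  have nil: "\<exists>n. (e * p) ^ n = 0" if p: "p \<in> P" for p
  proof -
    have epR: "e * p \<in> R" and epP: "e * p \<in> P" using p PR eR Ps by (auto simp: subr_rules R submod_mult)
    obtain g t n where g: "t \<in> R" "g = e * p * t" "g * g = g" "(e * p * (1 - g)) ^ n = 0"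
      by (rule pi_regular[OF R fin epR]) blast
    have "g \<in> P" using g epP Ps by (simp add: submod_mult')
    moreover have "g * f = e * f * (p * t)" using g(2) by (simp add: mult_ac)
    ultimately have "g = 0" using mx g(3) ef by simp
    then show ?thesis using g(4) by auto
  qed
  have inv: "\<exists>t\<in>R. r * t = e" if r: "r \<in> R - P" for r
  proof -
    obtain g t n where g: "t \<in> R" "g = r * t" "g * g = g" "(r * (1 - g)) ^ n = 0"
      by (rule pi_regular[OF R fin]) (use r in blast)+
    have gR: "g \<in> R" using g r by (simp add: subr_rules R)
    have "r * (1 - g) \<in> P" using nilpotent_in_prime[OF R P _ g(4)] r gR by (simp add: subr_rules R)
    then have g1: "1 - g \<in> P" using P r subr_diff[OF R subr_1[OF R] gR] unfolding prime_in_def by blast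
    have "e * (1 - g) = 0"
    proof (rule mx)
      show "e * (1 - g) \<in> P" using g1 Ps eR by (simp add: submod_mult)
      have "e * (1 - g) * (e * (1 - g)) = (e * e) * (1 - g - g + g * g)" by (simp add: algebra_simps)
      then show "e * (1 - g) * (e * (1 - g)) = e * (1 - g)" using ee g(3) by simp
      have "e * (1 - g) * f = e * f * (1 - g)" by (simp add: mult_ac)
      then show "e * (1 - g) * f = 0" using ef by simp
    qed
    then have "e = r * (t * e)" using g(2) by (simp add: algebra_simps)
    then show ?thesis using g(1) eR by (metis R subr_mult)
  qed
  have "1 - e \<in> P" using f by (simp add: e_def)
  then show ?thesis using eR ee nil inv unfolding local_idem_def by blast
qed

lemma ex_prime_above:
  assumes R: "subr R" and fin: "finite (ideals_of R)" and A: "A \<in> ideals_of R" "1 \<notin> A"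
  obtains P where "prime_in R P" "A \<subseteq> P"
proof -
  let ?S = "{I\<in>ideals_of R. A \<subseteq> I \<and> 1 \<notin> I}"
  have "finite ?S" "A \<in> ?S" using fin A by auto
  then obtain P where P: "P \<in> ?S" "\<And>N. N \<in> ?S \<Longrightarrow> P \<subseteq> N \<Longrightarrow> N = P"
    by (metis (no_types, lifting) empty_iff finite_has_maximal)
  have Ps: "submod R P" and PR: "P \<subseteq> R" and P1: "1 \<notin> P" using P(1) by (auto simp: ideals_of_def)
  have unit: "\<exists>p\<in>P. \<exists>r\<in>R. p + x * r = 1" if x: "x \<in> R" "x \<notin> P" for x
  proof -
    define N where "N = {p + y |p y. p \<in> P \<and> y \<in> prin R x}"
    have s: "submod R N" unfolding N_def by (rule submod_plus[OF Ps submod_prin[OF R]])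
    have sub: "P \<subseteq> N" using submod_0[OF submod_prin[OF R]] by (force simp: N_def)
    have xN: "x \<in> N" using submod_0[OF Ps] prin_self[OF R] by (force simp: N_def)
    have NR: "N \<subseteq> R" using PR x by (auto simp: N_def subr_rules R subsetD elim!: prinE)
    have "1 \<in> N"
    proof (rule ccontr)
      assume "1 \<notin> N"
      then have "N \<in> ?S" using s NR sub P(1) unfolding ideals_of_def by blast
      then show False using P(2) sub xN x by blast
    qed
    then obtain p r where "p \<in> P" "r \<in> R" "1 = p + x * r" by (auto simp: N_def elim!: prinE)
    then show ?thesis by metis
  qed
  have "x \<in> P \<or> y \<in> P" if h: "x \<in> R" "y \<in> R" "x * y \<in> P" for x y
  proof (rule ccontr)
    assume "\<not> (x \<in> P \<or> y \<in> P)"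
    then obtain p r where u: "p \<in> P" "r \<in> R" "p + x * r = 1" and y: "y \<notin> P" using unit h by blast
    have "y * (p + x * r) = y * p + r * (x * y)" by (simp add: algebra_simps)
    then have "y = y * p + r * (x * y)" using u by simp
    then have "y \<in> P" using u h Ps by (metis submod_add submod_mult)
    with y show False by blast
  qed
  then have "prime_in R P" using P(1) P1 by (auto simp: prime_in_def)
  with P(1) that show thesis by blast
qed

text \<open>The elements of \<open>R\<close> that multiply \<open>x\<close> into \<open>M\<close>
  form an ideal. If it were proper, it would lie in a prime \<open>P\<close>. It contains a local
  idempotent \<open>e\<close> of \<open>P\<close>, and \<open>1 - e\<close> is in \<open>P\<close>
  as well, so \<open>1\<close> would be in \<open>P\<close>.\<close>

lemma mem_if_mem_local:
  assumes R: "subr R" and fin: "finite (ideals_of R)" and M: "submod R M"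
    and loc: "\<And>P. prime_in R P \<Longrightarrow> \<exists>e. local_idem R P e \<and> e * x \<in> M"
  shows "x \<in> M"
proof (rule ccontr)
  assume x: "x \<notin> M"
  let ?A = "{r\<in>R. r * x \<in> M}"
  have "?A \<in> ideals_of R"
    unfolding ideals_of_def submod_def
    using submod_0[OF M] submod_add[OF M] submod_mult[OF M]
    by (auto simp: subr_rules R distrib_right mult.assoc)
  moreover have "1 \<notin> ?A" using x by simp
  ultimately obtain P where P: "prime_in R P" "?A \<subseteq> P" by (rule ex_prime_above[OF R fin])
  then obtain e where e: "local_idem R P e" "e * x \<in> M" using loc by blast
  then have "e \<in> P" "1 - e \<in> P" using P by (auto simp: local_idem_def)
  then have "(1 - e) + e \<in> P" using P(1) submod_add unfolding prime_in_def ideals_of_def by blast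
  then show False using P(1) by (simp add: prime_in_def)
qed

section \<open>The dichotomy for a local factor: finite, or with principal maximal ideal\<close>

lemma one_minus_nilpotent_unit:
  assumes R: "subr R" and x: "x \<in> R" "x ^ n = 0"
  obtains u where "u \<in> R" "(1 - x) * u = 1"
proof
  show "(\<Sum>i<n. x ^ i) \<in> R" by (intro subr_sum R subr_power x)
  show "(1 - x) * (\<Sum>i<n. x ^ i) = 1"
    using x(2) by (simp add: one_diff_power_eq[of x n, symmetric])
qed

text \<open>Induction along a composition series of \<open>I\<close>: each factor is a quotient of the residue field.\<close>

lemma finite_if_finite_residue:
  assumes R: "subr R" and fin: "finite (ideals_of R)" and P: "prime_in R P" and e: "local_idem R P e"
    and U: "finite U" "U \<subseteq> R" "\<And>r. r \<in> R \<Longrightarrow> \<exists>u\<in>U. r - u \<in> P"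
    and I: "I \<in> ideals_of R" "I \<subseteq> prin R e"
  shows "finite I"
  using I
proof (induction "card {K\<in>ideals_of R. K \<subseteq> I}" arbitrary: I rule: less_induct)
  case less
  have Is: "submod R I" and IR: "I \<subseteq> R" using less.prems by (auto simp: ideals_of_def)
  have PR: "P \<subseteq> R" and Ps: "submod R P" using P by (auto simp: prime_in_def ideals_of_def)
  show ?case
  proof (cases "I = {0}")
    case False
    let ?S = "{K\<in>ideals_of R. K \<subset> I}"
    have "finite ?S" using fin by auto
    moreover have "{0} \<in> ?S"
      using False submod_0[OF Is] subr_0[OF R] by (auto simp: ideals_of_def submod_def)
    ultimately obtain K where K: "K \<in> ?S" "\<And>N. N \<in> ?S \<Longrightarrow> K \<subseteq> N \<Longrightarrow> N = K"
      by (metis (no_types, lifting) empty_iff finite_has_maximal)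
    have Ks: "submod R K" using K by (auto simp: ideals_of_def)
    have "{L\<in>ideals_of R. L \<subseteq> K} \<subset> {L\<in>ideals_of R. L \<subseteq> I}" using K(1) less.prems(1) by auto
    then have "card {L\<in>ideals_of R. L \<subseteq> K} < card {L\<in>ideals_of R. L \<subseteq> I}"
      using fin by (intro psubset_card_mono) auto
    then have finK: "finite K" using less.hyps[of K] K(1) less.prems(2) by auto
    obtain x where x: "x \<in> I" "x \<notin> K" using K(1) by auto
    have xR: "x \<in> R" using x IR by blast
    have ex: "e * x = x" using x less.prems(2) e by (auto simp: local_idem_def mult.assoc[symmetric] elim!: prinE dest!: subsetD)
    \<comment> \<open>\<open>K\<close> is maximal among the ideals strictly inside \<open>I\<close>,
      so a submodule of \<open>I\<close> that is not contained in \<open>K\<close> fills up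
      \<open>I\<close> together with \<open>K\<close>.\<close>
    have absorb: "I = {k + y |k y. k \<in> K \<and> y \<in> Y}" if Y: "submod R Y" "Y \<subseteq> I" "\<not> Y \<subseteq> K" for Y
    proof -
      define N where "N = {k + y |k y. k \<in> K \<and> y \<in> Y}"
      have N: "submod R N" unfolding N_def by (rule submod_plus[OF Ks Y(1)])
      have NI: "N \<subseteq> I" using K(1) Y(2) Is by (auto simp: N_def intro: submod_add)
      have KN: "K \<subseteq> N" using submod_0[OF Y(1)] by (force simp: N_def)
      have YN: "Y \<subseteq> N" using submod_0[OF Ks] by (force simp: N_def)
      have "N = I"
      proof (rule ccontr)
        assume "N \<noteq> I"
        then have "N \<in> ?S" using N NI IR by (auto simp: ideals_of_def)
        from K(2)[OF this KN] show False using YN Y(3) by simp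
      qed
      then show ?thesis by (simp add: N_def)
    qed
    \<comment> \<open>Otherwise \<open>absorb\<close> gives \<open>x * (1 - e * (p * r)) = k\<close>
      with \<open>k\<close> in \<open>K\<close>. Here \<open>e * (p * r)\<close> is nilpotent, so
      the second factor is a unit and \<open>x\<close> would lie in \<open>K\<close>.\<close>
    have xP: "x * p \<in> K" if p: "p \<in> P" for p
    proof (rule ccontr)
      assume n: "x * p \<notin> K"
      let ?Y = "prin R (x * p)"
      have "submod R ?Y" by (rule submod_prin[OF R])
      moreover have "?Y \<subseteq> I" using prin_subset[OF Is submod_mult'[OF Is]] p PR x by blast
      moreover have "x * p \<in> ?Y" by (rule prin_self[OF R])
      ultimately have "I = {k + y |k y. k \<in> K \<and> y \<in> ?Y}" using absorb n by blast
      from subsetD[OF equalityD1[OF this] x(1)]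
      obtain k y r where ky: "x = k + y" "k \<in> K" "y = x * p * r" "r \<in> R" by (elim CollectE exE conjE prinE)
      then have kr: "k \<in> K" "r \<in> R" "x = k + x * p * r" by simp_all
      have prP: "p * r \<in> P" using p kr Ps by (simp add: submod_mult')
      then obtain n where "(e * (p * r)) ^ n = 0" using e by (auto simp: local_idem_def)
      then obtain u where u: "u \<in> R" "(1 - e * (p * r)) * u = 1"
        using one_minus_nilpotent_unit[OF R] prP PR e by (metis R local_idem_def subr_mult subsetD)
      have xk: "x * (1 - e * (p * r)) = k"
      proof -
        have "x * (1 - e * (p * r)) = x - (e * x) * (p * r)" by (simp add: algebra_simps)
        also have "\<dots> = x - x * p * r" by (simp add: ex mult.assoc)
        finally show ?thesis using kr(3) by (simp add: algebra_simps)
      qed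
      have "x = x * ((1 - e * (p * r)) * u)" using u by simp
      also have "\<dots> = k * u" by (metis xk mult.assoc)
      finally show False using x(2) kr(1) u(1) Ks by (metis submod_mult')
    qed
    have Iabs: "I = {k + y |k y. k \<in> K \<and> y \<in> prin R x}"
    proof (rule absorb[OF submod_prin[OF R]])
      show "prin R x \<subseteq> I" by (rule prin_subset[OF Is x(1)])
      show "\<not> prin R x \<subseteq> K" using x(2) prin_self[OF R] by auto
    qed
    \<comment> \<open>Since \<open>x * P\<close> lies in \<open>K\<close>, the coefficient of
      \<open>x\<close> matters only modulo \<open>P\<close> and can be taken from
      \<open>U\<close>.\<close>
    have "I \<subseteq> (\<lambda>(k, u). k + x * u) ` (K \<times> U)"
    proof
      fix i assume "i \<in> I"
      from subsetD[OF equalityD1[OF Iabs] this]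
      obtain k r where kr: "k \<in> K" "r \<in> R" "i = k + x * r" by (auto elim: prinE)
      then obtain u where u: "u \<in> U" "r - u \<in> P" using U(3) by blast
      have "k + x * (r - u) \<in> K" using kr u xP Ks by (auto intro: submod_add)
      moreover have "i = (k + x * (r - u)) + x * u" by (simp add: kr algebra_simps)
      ultimately show "i \<in> (\<lambda>(k, u). k + x * u) ` (K \<times> U)" using u(1) by force
    qed
    then show ?thesis using finK U(1) finite_subset by blast
  qed simp
qed

text \<open>If the residue field is infinite, the ideals generated by \<open>q + u * p\<close> with
  \<open>u\<close> in \<open>R\<close> take only finitely many values, so two parameters whose
  difference is a unit of the factor yield the same ideal. That ideal contains both \<open>p\<close>
  and \<open>q\<close>. Hence a maximal principal ideal inside \<open>e P\<close> is all of
  \<open>e P\<close>.\<close>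

lemma local_finite_or_principal:
  assumes R: "subr R" and fin: "finite (ideals_of R)" and P: "prime_in R P" and e: "local_idem R P e"
  shows "finite (prin R e) \<or> (\<exists>q n. q \<in> P \<and> e * q = q \<and> q ^ n = 0 \<and> (\<forall>p\<in>P. \<exists>r\<in>R. e * p = q * r))"
proof (cases "\<exists>U. finite U \<and> U \<subseteq> R \<and> (\<forall>r\<in>R. \<exists>u\<in>U. r - u \<in> P)")
  case True
  then obtain U where "finite U" "U \<subseteq> R" "\<And>r. r \<in> R \<Longrightarrow> \<exists>u\<in>U. r - u \<in> P" by blast
  moreover have "prin R e \<in> ideals_of R"
    using prin_in_ideals_of[OF R] e by (auto simp: local_idem_def)
  ultimately show ?thesis using finite_if_finite_residue[OF R fin P e] by blast
next
  case False
  then have inf: "\<exists>r\<in>R. \<forall>u\<in>U. r - u \<notin> P" if "finite U" "U \<subseteq> R" for U using that by auto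
  have PR: "P \<subseteq> R" and Ps: "submod R P" using P by (auto simp: prime_in_def ideals_of_def)
  have eR: "e \<in> R" and ee: "e * e = e" using e by (auto simp: local_idem_def)
  let ?I = "\<lambda>q. prin R q"
  let ?S = "{?I q |q. q \<in> P \<and> e * q = q}"
  have "?S \<subseteq> ideals_of R" using prin_in_ideals_of[OF R] PR by blast
  then have "finite ?S" using fin finite_subset by blast
  moreover have "?I 0 \<in> ?S" using submod_0[OF Ps] by force
  ultimately obtain M where M: "M \<in> ?S" "\<And>N. N \<in> ?S \<Longrightarrow> M \<subseteq> N \<Longrightarrow> N = M"
    by (metis (no_types, lifting) empty_iff finite_has_maximal)
  then obtain q where q: "q \<in> P" "e * q = q" "M = ?I q" by blast
  have gen: "\<exists>r\<in>R. p = q * r" if p: "p \<in> P" "e * p = p" for p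
  proof -
    let ?f = "\<lambda>u. ?I (q + u * p)"
    have pR: "p \<in> R" "q \<in> R" using p q PR by auto
    have img: "?f ` R \<subseteq> ideals_of R"
      using prin_in_ideals_of[OF R] pR by (auto simp: subr_rules R)
    have "finite (?f ` R)" using finite_subset[OF img fin] .
    from finite_subset_image[OF this order_refl]
    \<comment> \<open>\<open>U\<close> represents every value of \<open>?f\<close>. By
      \<open>inf\<close> some \<open>r\<close> is incongruent modulo \<open>P\<close> to all of
      \<open>U\<close>, yet its ideal is that of some \<open>u\<close> in \<open>U\<close>.\<close>
    obtain U where U: "U \<subseteq> R" "finite U" "?f ` R = ?f ` U" by (elim exE conjE)
    from inf[OF U(2,1)] obtain r where r: "r \<in> R" "\<forall>u\<in>U. r - u \<notin> P" by (elim bexE)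
    have "?f r \<in> ?f ` U" using imageI[OF r(1), of ?f] unfolding U(3) .
    then obtain u where u: "u \<in> U" "?f r = ?f u" by (rule imageE)
    have uR: "u \<in> R" using u U by blast
    have i1: "q + u * p \<in> ?f u" by (rule prin_self[OF R])
    have "q + r * p \<in> ?f r" by (rule prin_self[OF R])
    then have i2: "q + r * p \<in> ?f u" using u by simp
    have s: "submod R (?f u)" by (rule submod_prin[OF R])
    have "(q + r * p) - (q + u * p) \<in> ?f u" by (rule submod_diff[OF R s i2 i1])
    then have i3: "(r - u) * p \<in> ?f u" by (simp add: algebra_simps)
    obtain t where t: "t \<in> R" "(r - u) * t = e" using r u uR e unfolding local_idem_def
      by (metis DiffI R subr_diff)
    have "t * ((r - u) * p) \<in> ?f u" using submod_mult[OF s t(1) i3] .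
    moreover have "t * ((r - u) * p) = p" using t(2) p(2) by (metis mult.assoc mult.commute)
    ultimately have pin: "p \<in> ?f u" by simp
    have "(q + u * p) - u * p \<in> ?f u" by (rule submod_diff[OF R s i1 submod_mult[OF s uR pin]])
    then have "q \<in> ?f u" by simp
    then have "?I q \<subseteq> ?f u" by (rule prin_subset[OF s])
    moreover have "?f u \<in> ?S"
    proof -
      have "q + u * p \<in> P" using q p Ps uR by (auto intro: submod_add submod_mult)
      moreover have "e * (q + u * p) = q + u * p"
        using q(2) p(2) by (metis distrib_left mult.left_commute)
      ultimately show ?thesis by blast
    qed
    ultimately have "?f u = ?I q" using M(2) q(3) by blast
    with pin show ?thesis by (auto elim: prinE)
  qed
  obtain n where "(e * q) ^ n = 0" using e q by (auto simp: local_idem_def)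
  then have "q ^ n = 0" using q by simp
  moreover have "\<exists>r\<in>R. e * p = q * r" if "p \<in> P" for p
  proof (rule gen)
    show "e * p \<in> P" using that Ps eR by (simp add: submod_mult)
    show "e * (e * p) = e * p" using ee by (metis mult.assoc)
  qed
  ultimately show ?thesis using q by blast
qed

section \<open>Semisimplicity from separability\<close>

definition msum :: "'a::comm_ring_1 set \<Rightarrow> 'a set \<Rightarrow> 'a set" where
  "msum M N = {x + y |x y. x \<in> M \<and> y \<in> N}"

lemma msumI: "x \<in> M \<Longrightarrow> y \<in> N \<Longrightarrow> x + y \<in> msum M N"
  and msumE: "z \<in> msum M N \<Longrightarrow> (\<And>x y. x \<in> M \<Longrightarrow> y \<in> N \<Longrightarrow> z = x + y \<Longrightarrow> thesis) \<Longrightarrow> thesis"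
  by (auto simp: msum_def)

lemma submod_msum: "submod R M \<Longrightarrow> submod R N \<Longrightarrow> submod R (msum M N)"
  unfolding msum_def by (rule submod_plus)

lemma msum_left: "submod R N \<Longrightarrow> M \<subseteq> msum M N"
  using msumI[of _ M 0 N] by (auto simp: submod_0)

lemma msum_right: "submod R M \<Longrightarrow> N \<subseteq> msum M N"
  using msumI[of 0 M _ N] by (auto simp: submod_0)

text \<open>\<open>R / (R \<inter> J)\<close> is a field, or zero if \<open>J\<close> contains
  \<open>R\<close>.\<close>

definition field_mod :: "'a::comm_ring_1 set \<Rightarrow> 'a set \<Rightarrow> bool" where
  "field_mod R J \<longleftrightarrow> (\<forall>r\<in>R. r \<in> J \<or> (\<exists>t\<in>R. 1 - t * r \<in> J))"

text \<open>Taking \<open>t = h\<close> shows that \<open>h\<close> is idempotent modulo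
  \<open>J\<close>: every ideal is generated modulo \<open>J\<close> by an idempotent. This form of
  semisimplicity mentions elements only.\<close>

definition semisimple_mod :: "'a::comm_ring_1 set \<Rightarrow> 'a set \<Rightarrow> bool" where
  "semisimple_mod R J \<longleftrightarrow> (\<forall>A\<in>ideals_of R. \<exists>h\<in>A. \<forall>t\<in>A. t - t * h \<in> J)"

definition linear_mod :: "'a::comm_ring_1 set \<Rightarrow> 'a set \<Rightarrow> ('a \<Rightarrow> 'a) \<Rightarrow> bool" where
  "linear_mod R J \<phi> \<longleftrightarrow> (\<forall>s t. \<phi> (s + t) - \<phi> s - \<phi> t \<in> J) \<and>
     (\<forall>r\<in>R. \<forall>s. \<phi> (r * s) - r * \<phi> s \<in> J) \<and> (\<forall>s\<in>J. \<phi> s \<in> J)"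

definition span_mod :: "'a::comm_ring_1 set \<Rightarrow> 'a set \<Rightarrow> nat \<Rightarrow> (nat \<Rightarrow> 'a) \<Rightarrow> bool" where
  "span_mod R J n x \<longleftrightarrow> (\<forall>s. \<exists>c. (\<forall>i. c i \<in> R) \<and> s - (\<Sum>i<n. c i * x i) \<in> J)"

lemma field_mod_semisimple:
  assumes J: "submod UNIV J" and F: "field_mod R J"
  shows "semisimple_mod R J"
  unfolding semisimple_mod_def
proof
  fix A assume "A \<in> ideals_of R"
  then have A: "A \<subseteq> R" "submod R A" by (auto simp: ideals_of_def)
  show "\<exists>h\<in>A. \<forall>t\<in>A. t - t * h \<in> J"
  proof (cases "A \<subseteq> J")
    case True
    then show ?thesis using submod_0[OF A(2)] by force
  next
    case False
    then obtain r where r: "r \<in> A" "r \<notin> J" by blast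
    then obtain t where t: "t \<in> R" "1 - t * r \<in> J" using F A by (auto simp: field_mod_def)
    have "s - s * (t * r) \<in> J" for s
      using idl_mult[OF J t(2), of s] by (simp add: algebra_simps)
    then show ?thesis using submod_mult[OF A(2) t(1) r(1)] by blast
  qed
qed

text \<open>Gaussian elimination: the indices at which elements of a submodule can lead determine
  its size.\<close>

definition lead :: "'a::comm_ring_1 set \<Rightarrow> 'a set \<Rightarrow> nat \<Rightarrow> (nat \<Rightarrow> 'a) \<Rightarrow> 'a set \<Rightarrow> nat set" where
  "lead R J n x M =
     {i. i < n \<and> (\<exists>m\<in>M. \<exists>c. (\<forall>j. c j \<in> R) \<and> m - (x i + (\<Sum>j<i. c j * x j)) \<in> J)}"

text \<open>Let \<open>s\<close> in \<open>M'\<close> be congruent to a combination of the first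
  \<open>i + 1\<close> of the \<open>x j\<close>. If its top coefficient is nonzero modulo
  \<open>J\<close>, normalizing it shows that \<open>i\<close> is a leading index of
  \<open>M'\<close>, hence of \<open>M\<close>. Subtracting a multiple of an element of
  \<open>M\<close> that leads at \<open>i\<close> shortens the combination.\<close>

lemma subset_if_lead_subset:
  assumes R: "subr R" and J: "submod UNIV J" and F: "field_mod R J" and sp: "span_mod R J n x"
    and M: "submod R M" "J \<subseteq> M" and M': "submod R M'" "M \<subseteq> M'" and le: "lead R J n x M' \<subseteq> lead R J n x M"
  shows "M' \<subseteq> M"
proof -
  have claim: "i \<le> n \<Longrightarrow> s \<in> M' \<Longrightarrow> (\<forall>j. c j \<in> R) \<Longrightarrow> s - (\<Sum>j<i. c j * x j) \<in> J \<Longrightarrow> s \<in> M" for i s c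
  proof (induction i arbitrary: s c)
    case 0 then show ?case using M by auto
  next
    case (Suc i)
    have ci: "c i \<in> R" using Suc.prems by blast
    show ?case
    proof (cases "c i \<in> J")
      case True
      have "s - (\<Sum>j<i. c j * x j) = (s - (\<Sum>j<Suc i. c j * x j)) + c i * x i" by simp
      also have "\<dots> \<in> J" by (intro submod_add[OF J] Suc.prems idl_mult'[OF J] True)
      finally show ?thesis using Suc.IH Suc.prems by simp
    next
      case False
      then obtain t where t: "t \<in> R" "1 - t * c i \<in> J" using F ci by (auto simp: field_mod_def)
      have "t * s - (x i + (\<Sum>j<i. (t * c j) * x j))
          = t * (s - (\<Sum>j<Suc i. c j * x j)) - (1 - t * c i) * x i"
        by (simp add: algebra_simps sum_distrib_left)
      also have "\<dots> \<in> J" by (intro idl_diff[OF J] idl_mult[OF J] idl_mult'[OF J] Suc.prems t)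
      finally have e1: "t * s - (x i + (\<Sum>j<i. (t * c j) * x j)) \<in> J" .
      have "\<exists>m\<in>M'. \<exists>c. (\<forall>j. c j \<in> R) \<and> m - (x i + (\<Sum>j<i. c j * x j)) \<in> J"
      proof (intro bexI exI conjI allI)
        show "t * s - (x i + (\<Sum>j<i. (t * c j) * x j)) \<in> J" by (rule e1)
        show "t * c j \<in> R" for j using Suc.prems t R by (simp add: subr_mult)
        show "t * s \<in> M'" using Suc.prems t M' by (simp add: submod_mult)
      qed
      then have "i \<in> lead R J n x M'" using Suc.prems(1) by (simp add: lead_def)
      then have "i \<in> lead R J n x M" using le by blast
      then obtain m d where m: "m \<in> M" "\<forall>j. d j \<in> R" "m - (x i + (\<Sum>j<i. d j * x j)) \<in> J"
        unfolding lead_def by blast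
      have "s - c i * m - (\<Sum>j<i. (c j - c i * d j) * x j)
          = (s - (\<Sum>j<Suc i. c j * x j)) - c i * (m - (x i + (\<Sum>j<i. d j * x j)))"
        by (simp add: algebra_simps sum_distrib_left sum_subtractf)
      also have "\<dots> \<in> J" by (intro idl_diff[OF J] idl_mult[OF J] Suc.prems m)
      finally have e2: "s - c i * m - (\<Sum>j<i. (c j - c i * d j) * x j) \<in> J" .
      have cm: "c i * m \<in> M" using m ci M by (simp add: submod_mult)
      have "s - c i * m \<in> M'" using Suc.prems cm M' by (intro submod_diff[OF R M'(1)]) auto
      then have "s - c i * m \<in> M"
        using Suc.IH[OF _ _ _ e2] Suc.prems m(2) R by (auto simp: subr_rules)
      then have "(s - c i * m) + c i * m \<in> M" using cm by (rule submod_add[OF M(1)])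
      then show ?thesis by simp
    qed
  qed
  show ?thesis
  proof
    fix s assume s: "s \<in> M'"
    obtain c where "\<forall>i. c i \<in> R" "s - (\<Sum>i<n. c i * x i) \<in> J" using sp unfolding span_mod_def by blast
    then show "s \<in> M" using claim[OF order_refl s] by blast
  qed
qed

lemma card_lead_less:
  assumes R: "subr R" and J: "submod UNIV J" and F: "field_mod R J" and sp: "span_mod R J n x"
    and M: "submod R M" "J \<subseteq> M" and M': "submod R M'" "M \<subset> M'"
  shows "card (lead R J n x M) < card (lead R J n x M')"
proof (rule psubset_card_mono)
  show "finite (lead R J n x M')" unfolding lead_def by simp
  have "lead R J n x M \<subseteq> lead R J n x M'" using M'(2) unfolding lead_def by blast
  moreover have "\<not> lead R J n x M' \<subseteq> lead R J n x M"
    using subset_if_lead_subset[OF R J F sp M M'(1)] M'(2) by blast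
  ultimately show "lead R J n x M \<subset> lead R J n x M'" by blast
qed

text \<open>Zorn's lemma gives a submodule \<open>C\<close> that is maximal subject to meeting
  \<open>W\<close> inside \<open>J\<close>; semisimplicity forces \<open>C + W\<close> to be
  everything. No finiteness of the ambient ring over \<open>R\<close> is at hand here: this lemma is
  used to prove it. It serves for fields and for intermediate rings \<open>T\<close> alike.\<close>

lemma complement_projection:
  assumes R: "subr R" and J: "submod UNIV J" and ss: "semisimple_mod R J" and W: "submod R W" "J \<subseteq> W"
  obtains \<phi> where "linear_mod R J \<phi>" "\<And>s. \<phi> s - s \<in> W" "\<And>w. w \<in> W \<Longrightarrow> \<phi> w \<in> J"
proof -
  have JR: "submod R J" using submod_mono[OF J] by simp
  define CC where "CC = {C. submod R C \<and> J \<subseteq> C \<and> C \<inter> W \<subseteq> J}"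
  have "\<exists>M\<in>CC. \<forall>X\<in>CC. M \<subseteq> X \<longrightarrow> X = M"
  proof (rule subset_Zorn_nonempty)
    show "CC \<noteq> {}" using JR by (auto simp: CC_def)
    fix D assume D: "D \<noteq> {}" "subset.chain CC D"
    then have DC: "D \<subseteq> CC" and tot: "\<And>X Y. X \<in> D \<Longrightarrow> Y \<in> D \<Longrightarrow> X \<subseteq> Y \<or> Y \<subseteq> X"
      by (auto simp: subset_chain_def)
    have "submod R (\<Union>D)"
      unfolding submod_def
    proof (intro conjI ballI)
      obtain X where "X \<in> D" using D(1) by blast
      moreover from this have "submod R X" using DC by (auto simp: CC_def)
      ultimately show "0 \<in> \<Union>D" using submod_0 by blast
      fix x y assume "x \<in> \<Union>D" "y \<in> \<Union>D"
      then obtain X Y where XY: "X \<in> D" "x \<in> X" "Y \<in> D" "y \<in> Y" by blast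
      then have "\<exists>Z\<in>D. x \<in> Z \<and> y \<in> Z" using tot[of X Y] by blast
      then obtain Z where "Z \<in> D" "x \<in> Z" "y \<in> Z" by blast
      moreover from this have "submod R Z" using DC by (auto simp: CC_def)
      ultimately show "x + y \<in> \<Union>D" using submod_add by blast
    next
      fix r x assume "r \<in> R" "x \<in> \<Union>D"
      then obtain X where "X \<in> D" "x \<in> X" by blast
      moreover from this have "submod R X" using DC by (auto simp: CC_def)
      ultimately show "r * x \<in> \<Union>D" using submod_mult \<open>r \<in> R\<close> by blast
    qed
    moreover have "J \<subseteq> \<Union>D" using D(1) DC unfolding CC_def by blast
    moreover have "\<Union>D \<inter> W \<subseteq> J" using DC unfolding CC_def by blast
    ultimately show "\<Union>D \<in> CC" by (simp add: CC_def)
  qed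
  then obtain C where C: "C \<in> CC" "\<And>X. X \<in> CC \<Longrightarrow> C \<subseteq> X \<Longrightarrow> X = C" by blast
  have Cs: "submod R C" "J \<subseteq> C" "C \<inter> W \<subseteq> J" using C(1) by (auto simp: CC_def)
  have CW: "submod R (msum C W)" by (rule submod_msum[OF Cs(1) W(1)])
  have all: "s \<in> msum C W" for s
  proof -
    define A where "A = {t\<in>R. t * s \<in> msum C W}"
    have "A \<in> ideals_of R"
      unfolding ideals_of_def submod_def A_def
      using submod_0[OF CW] submod_add[OF CW] submod_mult[OF CW]
      by (auto simp: subr_rules R distrib_right mult.assoc)
    then obtain h where h: "h \<in> A" "\<And>t. t \<in> A \<Longrightarrow> t - t * h \<in> J"
      using ss unfolding semisimple_mod_def by blast
    have hR: "h \<in> R" and hs: "h * s \<in> msum C W" using h(1) by (auto simp: A_def)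
    \<comment> \<open>If \<open>c + y * t\<close> lies in \<open>W\<close> with \<open>c\<close> in
      \<open>C\<close>, then \<open>t * (1 - h)\<close> lies in \<open>A\<close>, so
      \<open>t * (1 - h) * (1 - h)\<close> is in \<open>J\<close>, and then
      \<open>t * (1 - h)\<close> too because \<open>h\<close> is idempotent modulo \<open>J\<close>.
      Adjoining \<open>y\<close> to \<open>C\<close> thus creates no new intersection with
      \<open>W\<close>, and maximality puts \<open>y\<close> into \<open>C\<close>.\<close>
    define y where "y = (1 - h) * s"
    define C' where "C' = msum C (prin R y)"
    have C's: "submod R C'" unfolding C'_def by (rule submod_msum[OF Cs(1) submod_prin[OF R]])
    have CC': "C \<subseteq> C'" unfolding C'_def by (rule msum_left[OF submod_prin[OF R]])
    have "C' \<inter> W \<subseteq> J"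
    proof
      fix z assume z: "z \<in> C' \<inter> W"
      then obtain c t where ct: "c \<in> C" "t \<in> R" "z = c + y * t"
        unfolding C'_def by (auto elim!: msumE prinE)
      have "t * (1 - h) * s = - c + z" using ct(3) by (simp add: y_def mult_ac)
      also have "\<dots> \<in> msum C W" using z ct by (intro msumI submod_uminus[OF R Cs(1)]) auto
      finally have "t * (1 - h) \<in> A" using ct(2) hR by (simp add: A_def subr_rules R)
      from h(2)[OF this] have 1: "t * (1 - h) * (1 - h) \<in> J" by (simp add: algebra_simps)
      have "h - h * h \<in> J" by (rule h(2)[OF h(1)])
      then have "t * (h - h * h) \<in> J" by (rule idl_mult[OF J])
      with 1 have "t * (1 - h) * (1 - h) + t * (h - h * h) \<in> J" by (rule submod_add[OF J])
      then have "t * (1 - h) \<in> J" by (simp add: algebra_simps)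
      then have "t * (1 - h) * s \<in> J" by (rule idl_mult'[OF J])
      then have yt: "y * t \<in> J" by (simp add: y_def mult_ac)
      then have "z \<in> C" using ct Cs by (auto intro: submod_add)
      then show "z \<in> J" using z Cs(3) by blast
    qed
    then have "C' \<in> CC" using C's CC' Cs(2) by (simp add: CC_def)
    then have "C' = C" using C(2) CC' by blast
    then have "y \<in> C" using msum_right[OF Cs(1), of "prin R y"] prin_self[OF R, of y] by (auto simp: C'_def)
    then have "y \<in> msum C W" using msum_left[OF W(1)] by blast
    then have "y + h * s \<in> msum C W" using hs by (rule submod_add[OF CW])
    then show ?thesis by (simp add: y_def algebra_simps)
  qed
  have ex: "\<exists>c. c \<in> C \<and> s - c \<in> W" for s
    using all[of s] by (auto elim!: msumE)
  \<comment> \<open>The component of \<open>s\<close> in \<open>C\<close> is unique only modulo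
    \<open>J\<close>, so an arbitrary choice of it is linear modulo \<open>J\<close>.\<close>
  define \<phi> where "\<phi> s = (SOME c. c \<in> C \<and> s - c \<in> W)" for s
  have phi: "\<phi> s \<in> C" "s - \<phi> s \<in> W" for s
    using someI_ex[OF ex[of s]] by (auto simp: \<phi>_def)
  have wJ: "\<phi> w \<in> J" if w: "w \<in> W" for w
  proof -
    have "w - (w - \<phi> w) \<in> W" by (rule submod_diff[OF R W(1) w phi(2)])
    then show ?thesis using phi(1)[of w] Cs(3) by auto
  qed
  have "linear_mod R J \<phi>"
    unfolding linear_mod_def
  proof (intro conjI allI ballI)
    fix s t
    have "\<phi> (s + t) - \<phi> s - \<phi> t \<in> C" by (intro submod_diff[OF R Cs(1)] phi)
    moreover have "(s - \<phi> s) + (t - \<phi> t) - (s + t - \<phi> (s + t)) \<in> W"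
      by (intro submod_diff[OF R W(1)] submod_add[OF W(1)] phi)
    then have "\<phi> (s + t) - \<phi> s - \<phi> t \<in> W" by (simp add: algebra_simps)
    ultimately show "\<phi> (s + t) - \<phi> s - \<phi> t \<in> J" using Cs(3) by blast
  next
    fix r s assume r: "r \<in> R"
    have "\<phi> (r * s) - r * \<phi> s \<in> C" by (intro submod_diff[OF R Cs(1)] submod_mult[OF Cs(1)] phi r)
    moreover have "r * (s - \<phi> s) - (r * s - \<phi> (r * s)) \<in> W"
      by (intro submod_diff[OF R W(1)] submod_mult[OF W(1)] phi r)
    then have "\<phi> (r * s) - r * \<phi> s \<in> W" by (simp add: algebra_simps)
    ultimately show "\<phi> (r * s) - r * \<phi> s \<in> J" using Cs(3) by blast
  next
    fix s assume "s \<in> J" then show "\<phi> s \<in> J" using wJ W(2) by blast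
  qed
  moreover have "\<phi> s - s \<in> W" for s
    using submod_uminus[OF R W(1) phi(2)[of s]] by simp
  ultimately show thesis using that wJ by blast
qed

text \<open>A separability element \<open>\<Sum>i. a i \<otimes> b i\<close> modulo \<open>J\<close>, tested against linear maps.\<close>

definition separable_mod :: "'a::comm_ring_1 set \<Rightarrow> 'a set \<Rightarrow> 'i set \<Rightarrow> ('i \<Rightarrow> 'a) \<Rightarrow> ('i \<Rightarrow> 'a) \<Rightarrow> bool" where
  "separable_mod R J I a b \<longleftrightarrow> finite I \<and> (\<Sum>i\<in>I. a i * b i) - 1 \<in> J \<and>
     (\<forall>\<phi> s. linear_mod R J \<phi> \<longrightarrow> (\<Sum>i\<in>I. a i * \<phi> (b i * s)) - s * (\<Sum>i\<in>I. a i * \<phi> (b i)) \<in> J)"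

lemma span_mod_of_finite:
  assumes K: "finite K" and sp: "\<And>s. \<exists>c. (\<forall>k. c k \<in> R) \<and> s - (\<Sum>k\<in>K. c k * y k) \<in> J"
  shows "\<exists>n x. span_mod R J n x"
proof -
  obtain h where h: "bij_betw h {0..<card K} K" using ex_bij_betw_nat_finite[OF K] by blast
  have "span_mod R J (card K) (y \<circ> h)"
    unfolding span_mod_def
  proof
    fix s
    obtain c where c: "\<forall>k. c k \<in> R" "s - (\<Sum>k\<in>K. c k * y k) \<in> J" using sp by blast
    have "(\<Sum>k\<in>K. c k * y k) = (\<Sum>i<card K. (c \<circ> h) i * (y \<circ> h) i)"
      using sum.reindex_bij_betw[OF h, of "\<lambda>k. c k * y k"] by (simp add: atLeast0LessThan)
    with c show "\<exists>c. (\<forall>i. c i \<in> R) \<and> s - (\<Sum>i<card K. c i * (y \<circ> h) i) \<in> J"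
      by (intro exI[of _ "c \<circ> h"]) auto
  qed
  then show ?thesis by blast
qed

lemma submod_span:
  assumes R: "subr R" and J: "submod UNIV J"
  shows "submod R {w. \<exists>c. (\<forall>i. c i \<in> R) \<and> w - (\<Sum>i\<in>I. c i * b i) \<in> J}" (is "submod R ?W")
  unfolding submod_def
proof (intro conjI ballI)
  show "0 \<in> ?W" using subr_0[OF R] submod_0[OF J] by (auto intro!: exI[of _ "\<lambda>_. 0"])
  fix x y assume "x \<in> ?W" "y \<in> ?W"
  then obtain c d where h: "\<forall>i. c i \<in> R" "x - (\<Sum>i\<in>I. c i * b i) \<in> J" "\<forall>i. d i \<in> R" "y - (\<Sum>i\<in>I. d i * b i) \<in> J"
    by blast
  have "x + y - (\<Sum>i\<in>I. (c i + d i) * b i) = (x - (\<Sum>i\<in>I. c i * b i)) + (y - (\<Sum>i\<in>I. d i * b i))"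
    by (simp add: algebra_simps sum.distrib)
  also have "\<dots> \<in> J" using h by (intro submod_add[OF J])
  finally show "x + y \<in> ?W" using h by (auto simp: subr_add R intro!: exI[of _ "\<lambda>i. c i + d i"])
next
  fix r x assume r: "r \<in> R" and "x \<in> ?W"
  then obtain c where h: "\<forall>i. c i \<in> R" "x - (\<Sum>i\<in>I. c i * b i) \<in> J" by blast
  have "r * x - (\<Sum>i\<in>I. (r * c i) * b i) = r * (x - (\<Sum>i\<in>I. c i * b i))"
    by (simp add: algebra_simps sum_distrib_left)
  also have "\<dots> \<in> J" using h by (intro idl_mult[OF J])
  finally show "r * x \<in> ?W" using h r by (auto simp: subr_mult R intro!: exI[of _ "\<lambda>i. r * c i"])
qed

text \<open>Project along the span \<open>W\<close> of the \<open>b i\<close>: the averaged projection kills \<open>1\<close>, hence everything,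
  so \<open>s = \<Sum>i. a i * (b i * s)\<close> lies in the span of the products \<open>a i * w\<close>, \<open>w \<in> W\<close>.\<close>

lemma separable_finite_span:
  assumes R: "subr R" and J: "submod UNIV J" and F: "field_mod R J" and sep: "separable_mod R J I a b"
  shows "\<exists>n x. span_mod R J n x"
proof (rule span_mod_of_finite)
  have I: "finite I" and one: "(\<Sum>i\<in>I. a i * b i) - 1 \<in> J"
    and av: "\<And>\<phi> s. linear_mod R J \<phi> \<Longrightarrow> (\<Sum>i\<in>I. a i * \<phi> (b i * s)) - s * (\<Sum>i\<in>I. a i * \<phi> (b i)) \<in> J"
    using sep by (auto simp: separable_mod_def)
  show "finite (I \<times> I)" using I by simp
  define W where "W = {w. \<exists>c. (\<forall>i. c i \<in> R) \<and> w - (\<Sum>i\<in>I. c i * b i) \<in> J}"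
  have W: "submod R W" unfolding W_def by (rule submod_span[OF R J])
  have JW: "J \<subseteq> W" using subr_0[OF R] by (auto simp: W_def intro!: exI[of _ "\<lambda>_. 0"])
  have bW: "b i \<in> W" if "i \<in> I" for i
  proof -
    have "(\<Sum>j\<in>I. (if j = i then 1 else 0) * b j) = b i"
      using that I by (simp add: if_distrib[of "\<lambda>u. u * _"] cong: if_cong)
    then show ?thesis unfolding W_def using subr_0[OF R] subr_1[OF R] submod_0[OF J]
      by (auto intro!: exI[of _ "\<lambda>j. if j = i then 1 else 0"])
  qed
  obtain \<phi> where phi: "linear_mod R J \<phi>" "\<And>s. \<phi> s - s \<in> W" "\<And>w. w \<in> W \<Longrightarrow> \<phi> w \<in> J"
    using complement_projection[OF R J field_mod_semisimple[OF J F] W JW] by blast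
  fix s
  have "s * (\<Sum>i\<in>I. a i * \<phi> (b i)) \<in> J"
    by (intro idl_mult[OF J] submod_sum[OF J] phi bW)
  from submod_add[OF J av[OF phi(1), of s] this]
  have 1: "(\<Sum>i\<in>I. a i * \<phi> (b i * s)) \<in> J" by simp
  have "\<forall>i. \<exists>c. (\<forall>j. c j \<in> R) \<and> (b i * s - \<phi> (b i * s)) - (\<Sum>j\<in>I. c j * b j) \<in> J"
  proof
    fix i
    have "b i * s - \<phi> (b i * s) \<in> W" using submod_uminus[OF R W phi(2)[of "b i * s"]] by simp
    then show "\<exists>c. (\<forall>j. c j \<in> R) \<and> (b i * s - \<phi> (b i * s)) - (\<Sum>j\<in>I. c j * b j) \<in> J"
      unfolding W_def by blast
  qed
  then obtain c where c: "\<And>i j. c i j \<in> R" "\<And>i. (b i * s - \<phi> (b i * s)) - (\<Sum>j\<in>I. c i j * b j) \<in> J"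
    by metis
  have "s - (\<Sum>k\<in>I \<times> I. c (fst k) (snd k) * (a (fst k) * b (snd k)))
      = (\<Sum>i\<in>I. a i * ((b i * s - \<phi> (b i * s)) - (\<Sum>j\<in>I. c i j * b j)))
        + (\<Sum>i\<in>I. a i * \<phi> (b i * s)) - s * ((\<Sum>i\<in>I. a i * b i) - 1)"
  proof -
    have "(\<Sum>k\<in>I \<times> I. c (fst k) (snd k) * (a (fst k) * b (snd k))) = (\<Sum>i\<in>I. a i * (\<Sum>j\<in>I. c i j * b j))"
      unfolding sum_distrib_left sum.cartesian_product by (rule sum.cong) (auto simp: mult_ac)
    then show ?thesis
      by (simp add: right_diff_distrib sum_subtractf sum_distrib_left mult_ac)
  qed
  also have "\<dots> \<in> J"
    by (intro idl_diff[OF J] submod_add[OF J] submod_sum[OF J] idl_mult[OF J] 1 c one)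
  finally show "\<exists>d. (\<forall>k. d k \<in> R) \<and> s - (\<Sum>k\<in>I \<times> I. d k * (a (fst k) * b (snd k))) \<in> J"
    using c(1) by (intro exI[of _ "\<lambda>k. c (fst k) (snd k)"]) auto
qed

text \<open>Averaging a linear projection onto an ideal makes it multiplicative, as in Maschke's theorem.\<close>

lemma separable_semisimple:
  assumes R: "subr R" and J: "submod UNIV J" and F: "field_mod R J" and sep: "separable_mod R J I a b"
  shows "semisimple_mod UNIV J"
  unfolding semisimple_mod_def
proof
  fix A :: "'a set" assume "A \<in> ideals_of UNIV"
  then have A: "submod UNIV A" by (simp add: ideals_of_def)
  have I: "finite I" and one: "(\<Sum>i\<in>I. a i * b i) - 1 \<in> J"
    and av: "\<And>\<phi> s. linear_mod R J \<phi> \<Longrightarrow> (\<Sum>i\<in>I. a i * \<phi> (b i * s)) - s * (\<Sum>i\<in>I. a i * \<phi> (b i)) \<in> J"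
    using sep by (auto simp: separable_mod_def)
  define K where "K = msum A J"
  have K: "submod UNIV K" "J \<subseteq> K" "A \<subseteq> K"
    unfolding K_def by (auto intro: submod_msum[OF A J] subsetD[OF msum_right[OF A]] subsetD[OF msum_left[OF J]])
  obtain \<phi> where phi: "linear_mod R J \<phi>" "\<And>s. \<phi> s - s \<in> K" "\<And>w. w \<in> K \<Longrightarrow> \<phi> w \<in> J"
    using complement_projection[OF R J field_mod_semisimple[OF J F] submod_mono[OF K(1)] K(2)] by blast
  \<comment> \<open>This is the value at \<open>1\<close> of the average of the map that sends
    \<open>s\<close> to \<open>s - \<phi> s\<close>. Averaging turns that map into multiplication by
    \<open>g\<close> modulo \<open>J\<close>; on \<open>A\<close> it is the identity modulo
    \<open>J\<close>.\<close>
  define g where "g = (\<Sum>i\<in>I. a i * (b i - \<phi> (b i)))"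
  have "b i - \<phi> (b i) \<in> K" for i using idl_uminus[OF K(1) phi(2)[of "b i"]] by simp
  then have "g \<in> K" unfolding g_def by (intro submod_sum[OF K(1)] idl_mult[OF K(1)])
  then obtain h j where hj: "h \<in> A" "j \<in> J" "g = h + j" unfolding K_def by (auto elim!: msumE)
  have "t - t * h \<in> J" if t: "t \<in> A" for t
  proof -
    have "\<phi> (b i * t) \<in> J" for i using phi(3) idl_mult[OF K(1)] K(3) t by blast
    then have 1: "(\<Sum>i\<in>I. a i * \<phi> (b i * t)) \<in> J" by (intro submod_sum[OF J] idl_mult[OF J])
    have g: "g = (\<Sum>i\<in>I. a i * b i) - (\<Sum>i\<in>I. a i * \<phi> (b i))"
      by (simp add: g_def right_diff_distrib sum_subtractf)
    have "t - t * h = t * j - t * ((\<Sum>i\<in>I. a i * b i) - 1)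
        + (\<Sum>i\<in>I. a i * \<phi> (b i * t)) - ((\<Sum>i\<in>I. a i * \<phi> (b i * t)) - t * (\<Sum>i\<in>I. a i * \<phi> (b i)))"
    proof -
      have h: "h = (\<Sum>i\<in>I. a i * b i) - (\<Sum>i\<in>I. a i * \<phi> (b i)) - j" using hj(3) g by simp
      show ?thesis unfolding h by (simp add: algebra_simps)
    qed
    also have "\<dots> \<in> J"
      by (intro idl_diff[OF J] submod_add[OF J] idl_mult[OF J] hj one 1 av phi)
    finally show ?thesis .
  qed
  then show "\<exists>h\<in>A. \<forall>t\<in>A. t - t * h \<in> J" using hj(1) by blast
qed

section \<open>Finiteness of the lattice of ideals above \<open>J\<close>\<close>

definition ideals_above :: "'a::comm_ring_1 set \<Rightarrow> 'a set set" where
  "ideals_above J = {K. submod UNIV K \<and> J \<subseteq> K}"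

text \<open>Induction on the number of leading indices of \<open>K\<close>. An ideal
  \<open>L\<close> strictly between \<open>J\<close> and \<open>K\<close> has an idempotent
  generator \<open>g\<close> modulo \<open>J\<close>, which splits \<open>K\<close> into
  \<open>L\<close> and the part \<open>L'\<close> killed by \<open>g\<close>. An ideal
  \<open>N\<close> inside \<open>K\<close> is determined by its intersections with these two smaller
  ideals, since \<open>y = g * y + (y - g * y)\<close>.\<close>

lemma finite_ideals_between:
  assumes R: "subr R" and J: "submod UNIV J" and F: "field_mod R J" and sp: "span_mod R J n x"
    and ss: "semisimple_mod UNIV J" and K: "K \<in> ideals_above J"
  shows "finite {L \<in> ideals_above J. L \<subseteq> K}"
  using K
proof (induction "card (lead R J n x K)" arbitrary: K rule: less_induct)
  case (less K)
  have K: "submod UNIV K" "J \<subseteq> K" using less.prems by (auto simp: ideals_above_def)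
  have dec: "card (lead R J n x L) < card (lead R J n x K)" if "L \<in> ideals_above J" "L \<subset> K" for L
    using that K by (intro card_lead_less[OF R J F sp]) (auto simp: ideals_above_def intro: submod_mono)
  show ?case
  proof (cases "\<exists>L. L \<in> ideals_above J \<and> L \<subset> K \<and> L \<noteq> J")
    case False
    then have "{L \<in> ideals_above J. L \<subseteq> K} \<subseteq> {J, K}" by blast
    then show ?thesis by (rule finite_subset) simp
  next
    case True
    then obtain L where L: "L \<in> ideals_above J" "L \<subset> K" "L \<noteq> J" by blast
    then have Ls: "submod UNIV L" "J \<subseteq> L" by (auto simp: ideals_above_def)
    then have "L \<in> ideals_of UNIV" by (simp add: ideals_of_def)
    then obtain g where g: "g \<in> L" "\<And>t. t \<in> L \<Longrightarrow> t - t * g \<in> J"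
      using ss unfolding semisimple_mod_def by blast
    define L' where "L' = {x\<in>K. g * x \<in> J}"
    have L's: "submod UNIV L'" unfolding submod_def L'_def
      using K(1) J by (auto simp: distrib_left mult.left_commute[of g] intro: idl_rules)
    then have L'a: "L' \<in> ideals_above J"
      using K(2) idl_mult[OF J] by (auto simp: ideals_above_def L'_def)
    have "g \<notin> L'"
    proof
      assume "g \<in> L'"
      then have gg: "g * g \<in> J" by (simp add: L'_def)
      then have gJ: "g \<in> J" using submod_add[OF J g(2)[OF g(1)] gg] by simp
      have "L \<subseteq> J"
      proof
        fix t assume "t \<in> L"
        from submod_add[OF J g(2)[OF this] idl_mult[OF J gJ, of t]] show "t \<in> J" by simp
      qed
      then show False using L(3) Ls by blast
    qed
    then have L'K: "L' \<subset> K" using g(1) L(2) by (auto simp: L'_def)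
    have f1: "finite {N \<in> ideals_above J. N \<subseteq> L}" using less.hyps[OF dec L(1)] L by blast
    have f2: "finite {N \<in> ideals_above J. N \<subseteq> L'}" using less.hyps[OF dec L'a] L'a L'K by blast
    define f where "f N = (N \<inter> L, N \<inter> L')" for N
    have "f ` {N \<in> ideals_above J. N \<subseteq> K} \<subseteq> {N \<in> ideals_above J. N \<subseteq> L} \<times> {N \<in> ideals_above J. N \<subseteq> L'}"
      using L(1) L'a by (auto simp: f_def ideals_above_def submod_inter)
    then have "finite (f ` {N \<in> ideals_above J. N \<subseteq> K})"
      by (rule finite_subset) (use f1 f2 in simp)
    moreover have sub: "N \<subseteq> N'" if N: "N \<in> ideals_above J" "N \<subseteq> K" and N': "N' \<in> ideals_above J" and eq: "f N = f N'" for N N'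
    proof
      fix y assume y: "y \<in> N"
      have Ns: "submod UNIV N" "submod UNIV N'" using N N' by (auto simp: ideals_above_def)
      have "g * y \<in> N \<inter> L" using idl_mult[OF Ns(1) y] idl_mult'[OF Ls(1) g(1)] by blast
      then have a: "g * y \<in> N'" using eq by (auto simp: f_def)
      have "y - g * y \<in> N" by (intro idl_diff[OF Ns(1)] idl_mult[OF Ns(1)] y)
      moreover have "g * (y - g * y) \<in> J"
        using idl_mult'[OF J g(2)[OF g(1)], of y] by (simp add: algebra_simps)
      ultimately have "y - g * y \<in> N \<inter> L'" using N(2) by (auto simp: L'_def)
      then have "y - g * y \<in> N'" using eq by (auto simp: f_def)
      from submod_add[OF Ns(2) this a] show "y \<in> N'" by simp
    qed
    then have "inj_on f {N \<in> ideals_above J. N \<subseteq> K}"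
      by (intro inj_onI equalityI) (auto intro: sub[THEN subsetD])
    ultimately show ?thesis by (rule finite_imageD)
  qed
qed

lemma separable_finite_ideals_above:
  assumes R: "subr R" and J: "submod UNIV J" and F: "field_mod R J" and sep: "separable_mod R J I a b"
  shows "finite (ideals_above J)"
proof -
  obtain n x where sp: "span_mod R J n x" using separable_finite_span[OF R J F sep] by blast
  have "UNIV \<in> ideals_above J" by (simp add: ideals_above_def submod_def)
  from finite_ideals_between[OF R J F sp separable_semisimple[OF R J F sep] this] show ?thesis by simp
qed

section \<open>Separability elements from vanishing differentials\<close>

definition gen :: "'a::comm_ring_1 set \<Rightarrow> 'a set" where
  "gen X = \<Inter>{K. submod UNIV K \<and> X \<subseteq> K}"

lemma gen_least: "submod UNIV K \<Longrightarrow> X \<subseteq> K \<Longrightarrow> gen X \<subseteq> K"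
  by (auto simp: gen_def)

lemma gen_incl: "x \<in> X \<Longrightarrow> x \<in> gen X"
  by (auto simp: gen_def)

lemma submod_gen: "submod UNIV (gen X)"
  unfolding gen_def submod_def by auto

lemma gen_mono: "X \<subseteq> Y \<Longrightarrow> gen X \<subseteq> gen Y"
  by (rule gen_least[OF submod_gen]) (auto intro: gen_incl)

lemma gen_insert_decomp:
  assumes "y \<in> gen (insert d X)" obtains u c where "u \<in> gen X" "y = u + c * d"
proof -
  let ?K = "{y. \<exists>u c. u \<in> gen X \<and> y = u + c * d}"
  have "submod UNIV ?K"
    unfolding submod_def
  proof (intro conjI ballI)
    show "0 \<in> ?K" using submod_0[OF submod_gen] by (auto intro!: exI[of _ 0])
    fix x y assume "x \<in> ?K" "y \<in> ?K"
    then obtain u c v b where h: "u \<in> gen X" "x = u + c * d" "v \<in> gen X" "y = v + b * d" by blast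
    have "x + y = (u + v) + (c + b) * d" by (simp add: h algebra_simps)
    then show "x + y \<in> ?K" using submod_add[OF submod_gen h(1,3)] by blast
  next
    fix r x assume "x \<in> ?K"
    then obtain u c where h: "u \<in> gen X" "x = u + c * d" by blast
    have "r * x = r * u + (r * c) * d" by (simp add: h algebra_simps)
    then show "r * x \<in> ?K" using idl_mult[OF submod_gen h(1)] by blast
  qed
  moreover have "insert d X \<subseteq> ?K"
  proof
    fix x assume x: "x \<in> insert d X"
    show "x \<in> ?K"
    proof (cases "x = d")
      case True
      then have "x = 0 + 1 * d" by simp
      then show ?thesis using submod_0[OF submod_gen] by blast
    next
      case False
      with x have "x \<in> gen X" by (auto intro: gen_incl)
      moreover have "x = x + 0 * d" by simp
      ultimately show ?thesis by blast
    qed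
  qed
  ultimately have "gen (insert d X) \<subseteq> ?K" by (rule gen_least)
  then show thesis using assms that by blast
qed

text \<open>The generators are eliminated one at a time, which avoids determinants.\<close>

lemma nakayama_idempotent:
  fixes d :: "nat \<Rightarrow> 'a::comm_ring_1"
  assumes K: "submod UNIV K"
    and I: "I = gen (K \<union> d ` {..<n})"
    and sq: "\<And>i. i < n \<Longrightarrow> d i \<in> gen (K \<union> {y * y' |y y'. y \<in> I \<and> y' \<in> I})"
  shows "\<exists>z. z - 1 \<in> I \<and> (\<forall>y\<in>I. z * y \<in> K)"
proof -
  have Is: "submod UNIV I" unfolding I by (rule submod_gen)
  have claim: "k \<le> n \<Longrightarrow> \<exists>z. z - 1 \<in> I \<and> (\<forall>y\<in>I. z * y \<in> gen (K \<union> d ` {k..<n}))" for k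
  proof (induction k)
    case 0
    show ?case
    proof (intro exI conjI ballI)
      show "1 - 1 \<in> I" using submod_0[OF Is] by simp
      show "1 * y \<in> gen (K \<union> d ` {0..<n})" if "y \<in> I" for y
        using that unfolding I by (simp add: atLeast0LessThan)
    qed
  next
    case (Suc k)
    then obtain z where z: "z - 1 \<in> I" "\<And>y. y \<in> I \<Longrightarrow> z * y \<in> gen (K \<union> d ` {k..<n})" by auto
    define G where "G = gen (K \<union> d ` {Suc k..<n})"
    have Gs: "submod UNIV G" unfolding G_def by (rule submod_gen)
    have "K \<union> d ` {k..<n} = insert (d k) (K \<union> d ` {Suc k..<n})"
      using Suc.prems by (auto simp: Suc_le_eq less_le)
    then have zdec: "\<exists>u c. u \<in> G \<and> z * y = u + c * d k" if "y \<in> I" for y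
      using z(2)[OF that] gen_insert_decomp unfolding G_def by metis
    \<comment> \<open>\<open>N\<close> is the ideal of all \<open>w\<close> for which
      \<open>z * w\<close> lies in \<open>I * d k\<close> modulo \<open>G\<close>. It contains
      \<open>K\<close> and all products from \<open>I\<close>, hence \<open>d k\<close> by
      \<open>sq\<close>. This yields \<open>g\<close> in \<open>I\<close> such that
      \<open>z - g\<close> kills \<open>d k\<close> modulo \<open>G\<close>, and
      \<open>z * (z - g)\<close> is the next multiplier.\<close>
    define N where "N = {w. \<exists>g\<in>I. z * w - g * d k \<in> G}"
    have "submod UNIV N"
      unfolding submod_def
    proof (intro conjI ballI)
      show "0 \<in> N" using submod_0[OF Is] submod_0[OF Gs] by (auto simp: N_def intro!: bexI[of _ 0])
      fix x y assume "x \<in> N" "y \<in> N"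
      then obtain g h where gh: "g \<in> I" "z * x - g * d k \<in> G" "h \<in> I" "z * y - h * d k \<in> G"
        unfolding N_def by blast
      have "z * (x + y) - (g + h) * d k = (z * x - g * d k) + (z * y - h * d k)" by (simp add: algebra_simps)
      also have "\<dots> \<in> G" using gh by (intro submod_add[OF Gs])
      finally show "x + y \<in> N" using submod_add[OF Is gh(1,3)] unfolding N_def by blast
    next
      fix r x assume "x \<in> N"
      then obtain g where g: "g \<in> I" "z * x - g * d k \<in> G" unfolding N_def by blast
      have "z * (r * x) - (r * g) * d k = r * (z * x - g * d k)" by (simp add: algebra_simps)
      also have "\<dots> \<in> G" using g by (intro idl_mult[OF Gs])
      finally show "r * x \<in> N" using idl_mult[OF Is g(1)] unfolding N_def by blast
    qed
    moreover have "K \<union> {y * y' |y y'. y \<in> I \<and> y' \<in> I} \<subseteq> N"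
    proof
      fix w assume "w \<in> K \<union> {y * y' |y y'. y \<in> I \<and> y' \<in> I}"
      then consider "w \<in> K" | y y' where "y \<in> I" "y' \<in> I" "w = y * y'" by blast
      then show "w \<in> N"
      proof cases
        case 1
        then have "w \<in> G" unfolding G_def by (auto intro: gen_incl)
        then have "z * w - 0 * d k \<in> G" using idl_mult[OF Gs] by simp
        then show ?thesis using submod_0[OF Is] unfolding N_def by blast
      next
        case 2
        obtain u c where u: "u \<in> G" "z * y' = u + c * d k" using zdec[OF 2(2)] by blast
        have "z * w - (y * c) * d k = y * (z * y' - c * d k)" by (simp add: 2 algebra_simps)
        also have "\<dots> = y * u" by (simp add: u)
        also have "\<dots> \<in> G" by (intro idl_mult[OF Gs] u)
        finally show ?thesis using idl_mult'[OF Is 2(1)] unfolding N_def by blast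
      qed
    qed
    ultimately have "gen (K \<union> {y * y' |y y'. y \<in> I \<and> y' \<in> I}) \<subseteq> N" by (rule gen_least)
    then have "d k \<in> N" using sq[of k] Suc.prems by auto
    then obtain g where g: "g \<in> I" "z * d k - g * d k \<in> G" unfolding N_def by blast
    have "z * (z - g) - 1 = (z - 1) * (z - g) + (z - 1) - g" by (simp add: algebra_simps)
    also have "\<dots> \<in> I" by (intro idl_diff[OF Is] submod_add[OF Is] idl_mult'[OF Is] z g)
    finally have z': "z * (z - g) - 1 \<in> I" .
    have "z * (z - g) * y \<in> G" if y: "y \<in> I" for y
    proof -
      obtain u c where u: "u \<in> G" "z * y = u + c * d k" using zdec[OF y] by blast
      have "z * (z - g) * y = (z - g) * (z * y)" by (simp add: mult_ac)
      also have "\<dots> = (z - g) * u + c * (z * d k - g * d k)"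
        unfolding u(2) by (simp add: algebra_simps)
      also have "\<dots> \<in> G" by (intro submod_add[OF Gs] idl_mult[OF Gs] u g)
      finally show ?thesis .
    qed
    then show ?case using z' unfolding G_def by blast
  qed
  have "gen (K \<union> d ` {n..<n}) = K" using gen_least[OF K order_refl] gen_incl[of _ K] by auto
  then show ?thesis using claim[of n] by auto
qed

text \<open>The monoid algebra \<open>S[(S, \<cdot>)]\<close>, of which \<open>S \<otimes>\<^sub>R S\<close> is a quotient.  The wrapper turns the
  multiplicative monoid of \<open>S\<close> into an additive one, so that polynomial mappings over it carry
  the convolution product.\<close>

datatype 'a mon = Mon (unMon: 'a)

instantiation mon :: (comm_monoid_mult) comm_monoid_add
begin
definition "0 = Mon 1"
definition "x + y = Mon (unMon x * unMon y)"
instance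
  by standard (auto simp: zero_mon_def plus_mon_def mult_ac)
end

type_synonym 'a tens = "'a mon \<Rightarrow>\<^sub>0 'a"

text \<open>The left factor is the coefficient, so additivity in it holds exactly. Additivity in the
  right factor, and moving elements of \<open>R\<close> from one factor to the other, hold only
  modulo \<open>tens_rels\<close>.\<close>

definition ten :: "'a::comm_ring_1 \<Rightarrow> 'a \<Rightarrow> 'a tens" where
  "ten a b = Poly_Mapping.single (Mon b) a"

lemma ten_mult [simp]: "ten a b * ten c d = ten (a * c) (b * d)"
  by (simp add: ten_def mult_single plus_mon_def)

lemma ten_add: "ten (a + a') b = ten a b + ten a' b"
  and ten_diff: "ten (a - a') b = ten a b - ten a' b"
  by (simp_all add: ten_def single_add single_diff)

lemma ten_0 [simp]: "ten 0 b = 0"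
  by (simp add: ten_def)

lemma ten_1: "ten 1 1 = 1"
  unfolding ten_def zero_mon_def[symmetric] by simp

lemma tens_expand: "g = (\<Sum>k\<in>Poly_Mapping.keys g. ten (Poly_Mapping.lookup g k) (unMon k))"
  by (rule poly_mapping_eqI)
    (simp add: ten_def lookup_sum lookup_single when_def in_keys_iff if_distrib cong: if_cong)

lemma tens_induct [case_names ten zero add]:
  assumes "\<And>a b. Q (ten a b)" "Q 0" "\<And>g h. Q g \<Longrightarrow> Q h \<Longrightarrow> Q (g + h)"
  shows "Q g"
proof -
  have "Q (\<Sum>k\<in>A. ten (Poly_Mapping.lookup g k) (unMon k))" if "finite A" for A
    using that by (induction A rule: finite_induct) (auto intro: assms)
  then show ?thesis using tens_expand[of g] by (metis finite_keys)
qed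

section \<open>Evaluating tensors under maps that are balanced modulo \<open>J\<close>\<close>

definition eval_ten :: "('a::comm_ring_1 \<Rightarrow> 'b) \<Rightarrow> ('a \<Rightarrow> 'b) \<Rightarrow> 'a tens \<Rightarrow> 'b::comm_ring_1" where
  "eval_ten \<alpha> \<phi> g = (\<Sum>k\<in>Poly_Mapping.keys g. \<alpha> (Poly_Mapping.lookup g k) * \<phi> (unMon k))"

text \<open>One later instance of \<open>\<alpha>\<close> is \<open>ten 1\<close>, which is additive
  only modulo an ideal.\<close>

locale additive_mod =
  fixes J :: "'b::comm_ring_1 set" and \<alpha> :: "'a::comm_ring_1 \<Rightarrow> 'b"
  assumes J: "submod UNIV J"
    and \<alpha>_add: "\<alpha> (x + y) - \<alpha> x - \<alpha> y \<in> J"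
begin

lemma \<alpha>_0: "\<alpha> 0 \<in> J"
  using idl_uminus[OF J \<alpha>_add[of 0 0]] by simp

lemma eval_ten_superset:
  assumes "finite U" "Poly_Mapping.keys g \<subseteq> U"
  shows "(\<Sum>k\<in>U. \<alpha> (Poly_Mapping.lookup g k) * \<phi> (unMon k)) - eval_ten \<alpha> \<phi> g \<in> J"
proof -
  have "(\<Sum>k\<in>U. \<alpha> (Poly_Mapping.lookup g k) * \<phi> (unMon k)) - eval_ten \<alpha> \<phi> g
      = (\<Sum>k\<in>U - Poly_Mapping.keys g. \<alpha> (Poly_Mapping.lookup g k) * \<phi> (unMon k))"
    unfolding eval_ten_def using sum.subset_diff[OF assms(2,1)] by (simp add: algebra_simps)
  also have "\<dots> \<in> J"
    by (rule submod_sum[OF J]) (auto simp: in_keys_iff intro: idl_mult'[OF J \<alpha>_0])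
  finally show ?thesis .
qed

lemma eval_ten_add: "eval_ten \<alpha> \<phi> (g + h) - eval_ten \<alpha> \<phi> g - eval_ten \<alpha> \<phi> h \<in> J"
proof -
  let ?U = "Poly_Mapping.keys g \<union> Poly_Mapping.keys h"
  let ?s = "\<lambda>g. \<Sum>k\<in>?U. \<alpha> (Poly_Mapping.lookup g k) * \<phi> (unMon k)"
  have U: "finite ?U" "Poly_Mapping.keys g \<subseteq> ?U" "Poly_Mapping.keys h \<subseteq> ?U" "Poly_Mapping.keys (g + h) \<subseteq> ?U"
    using keys_add[of g h] by auto
  have "?s (g + h) - ?s g - ?s h = (\<Sum>k\<in>?U. (\<alpha> (Poly_Mapping.lookup g k + Poly_Mapping.lookup h k)
      - \<alpha> (Poly_Mapping.lookup g k) - \<alpha> (Poly_Mapping.lookup h k)) * \<phi> (unMon k))"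
    by (simp add: lookup_add sum_subtractf left_diff_distrib)
  also have "\<dots> \<in> J" by (intro submod_sum[OF J] idl_mult'[OF J] \<alpha>_add)
  finally have 1: "?s (g + h) - ?s g - ?s h \<in> J" .
  from submod_add[OF J submod_add[OF J idl_diff[OF J 1 eval_ten_superset[OF U(1,4), of \<phi>]]
      eval_ten_superset[OF U(1,2), of \<phi>]] eval_ten_superset[OF U(1,3), of \<phi>]]
  show ?thesis by (simp add: algebra_simps)
qed

lemma eval_ten_ten: "eval_ten \<alpha> \<phi> (ten a b) - \<alpha> a * \<phi> b \<in> J"
proof (cases "a = 0")
  case True
  have "- (\<alpha> 0 * \<phi> b) \<in> J" by (intro idl_uminus[OF J] idl_mult'[OF J] \<alpha>_0)
  then show ?thesis using True by (simp add: eval_ten_def)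
next
  case False
  then show ?thesis using submod_0[OF J] by (simp add: eval_ten_def ten_def)
qed

lemma eval_ten_0: "eval_ten \<alpha> \<phi> 0 = 0"
  by (simp add: eval_ten_def)

lemma eval_ten_diff: "eval_ten \<alpha> \<phi> (g - h) - (eval_ten \<alpha> \<phi> g - eval_ten \<alpha> \<phi> h) \<in> J"
  using idl_uminus[OF J eval_ten_add[of \<phi> "g - h" h]] by (simp add: algebra_simps)

lemma eval_ten_sum: "finite A \<Longrightarrow> eval_ten \<alpha> \<phi> (\<Sum>i\<in>A. g i) - (\<Sum>i\<in>A. eval_ten \<alpha> \<phi> (g i)) \<in> J"
proof (induction A rule: finite_induct)
  case empty show ?case using submod_0[OF J] by (simp add: eval_ten_0)
next
  case (insert i A)
  from submod_add[OF J eval_ten_add[of \<phi> "g i" "\<Sum>i\<in>A. g i"] insert.IH]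
  show ?case using insert.hyps by (simp add: algebra_simps)
qed

lemma eval_ten_gen:
  assumes X: "\<And>a b x. x \<in> X \<Longrightarrow> eval_ten \<alpha> \<phi> (ten a b * x) \<in> J" and g: "g \<in> gen X"
  shows "eval_ten \<alpha> \<phi> g \<in> J"
proof -
  let ?K = "{g. \<forall>h. eval_ten \<alpha> \<phi> (h * g) \<in> J}"
  have add: "eval_ten \<alpha> \<phi> (g + h) \<in> J" if "eval_ten \<alpha> \<phi> g \<in> J" "eval_ten \<alpha> \<phi> h \<in> J" for g h
    using submod_add[OF J submod_add[OF J eval_ten_add[of \<phi> g h] that(1)] that(2)] by simp
  have "submod UNIV ?K"
    unfolding submod_def
    by (auto simp: distrib_left eval_ten_0 submod_0[OF J] add mult.assoc[symmetric])
  moreover have "X \<subseteq> ?K"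
  proof safe
    fix x h assume "x \<in> X"
    then show "eval_ten \<alpha> \<phi> (h * x) \<in> J"
      by (induction h rule: tens_induct) (auto simp: X eval_ten_0 submod_0[OF J] distrib_right add)
  qed
  ultimately have "g \<in> ?K" using gen_least g by blast
  then have "eval_ten \<alpha> \<phi> (1 * g) \<in> J" by blast
  then show ?thesis by simp
qed

end

text \<open>The monoid algebra modulo the ideal generated by these elements is
  \<open>S \<otimes>\<^sub>R S\<close>.\<close>

definition tens_rels :: "'a::comm_ring_1 set \<Rightarrow> 'a tens set" where
  "tens_rels R = {ten 1 (x + y) - ten 1 x - ten 1 y |x y. True} \<union> {ten 1 (r * x) - ten r x |r x. r \<in> R}"

definition dif :: "'a::comm_ring_1 \<Rightarrow> 'a tens" where
  "dif s = ten 1 s - ten s 1"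

text \<open>These conditions let the assignment of \<open>\<alpha> a * \<phi> b\<close> to
  \<open>a \<otimes> b\<close> descend to \<open>S \<otimes>\<^sub>R S\<close>, with values modulo
  \<open>J\<close>.\<close>

locale tensor_map = additive_mod J \<alpha> for J :: "'b::comm_ring_1 set" and \<alpha> :: "'a::comm_ring_1 \<Rightarrow> 'b" +
  fixes R :: "'a set" and \<phi> :: "'a \<Rightarrow> 'b"
  assumes \<alpha>_mult: "\<alpha> (x * y) - \<alpha> x * \<alpha> y \<in> J"
    and \<phi>_add: "\<phi> (x + y) - \<phi> x - \<phi> y \<in> J"
    and \<phi>_mult: "r \<in> R \<Longrightarrow> \<phi> (r * x) - \<alpha> r * \<phi> x \<in> J"
begin

lemma eval_ten_rel:
  assumes "x \<in> tens_rels R" shows "eval_ten \<alpha> \<phi> (ten a b * x) \<in> J"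
proof -
  let ?E = "eval_ten \<alpha> \<phi>"
  from assms consider x' y where "x = ten 1 (x' + y) - ten 1 x' - ten 1 y"
    | r y where "r \<in> R" "x = ten 1 (r * y) - ten r y"
    unfolding tens_rels_def by blast
  then show ?thesis
  proof cases
    case 1
    let ?p = "ten a (b * x' + b * y)" and ?q = "ten a (b * x')" and ?r = "ten a (b * y)"
    have e: "ten a b * x = ?p - ?q - ?r" by (simp add: 1 right_diff_distrib distrib_left)
    have "?E (?p - ?q - ?r) = (?E (?p - ?q - ?r) - (?E (?p - ?q) - ?E ?r))
       + (?E (?p - ?q) - (?E ?p - ?E ?q)) + (?E ?p - \<alpha> a * \<phi> (b * x' + b * y)) - (?E ?q - \<alpha> a * \<phi> (b * x'))
       - (?E ?r - \<alpha> a * \<phi> (b * y)) + \<alpha> a * (\<phi> (b * x' + b * y) - \<phi> (b * x') - \<phi> (b * y))"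
      by (simp add: algebra_simps)
    also have "\<dots> \<in> J"
      by (intro submod_add[OF J] idl_diff[OF J] idl_mult[OF J] \<phi>_add eval_ten_ten eval_ten_diff)
    finally show ?thesis by (simp add: e)
  next
    case 2
    let ?p = "ten a (r * (b * y))" and ?q = "ten (a * r) (b * y)"
    have e: "ten a b * x = ?p - ?q" by (simp add: 2 right_diff_distrib mult_ac)
    have "?E (?p - ?q) = (?E (?p - ?q) - (?E ?p - ?E ?q)) + (?E ?p - \<alpha> a * \<phi> (r * (b * y)))
       - (?E ?q - \<alpha> (a * r) * \<phi> (b * y)) + \<alpha> a * (\<phi> (r * (b * y)) - \<alpha> r * \<phi> (b * y))
       - (\<alpha> (a * r) - \<alpha> a * \<alpha> r) * \<phi> (b * y)"
      by (simp add: algebra_simps)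
    also have "\<dots> \<in> J"
      by (intro submod_add[OF J] idl_diff[OF J] idl_mult[OF J] idl_mult'[OF J] \<alpha>_mult \<phi>_mult 2 eval_ten_ten eval_ten_diff)
    finally show ?thesis by (simp add: e)
  qed
qed

lemma eval_ten_dif: "eval_ten \<alpha> \<phi> (ten a b * dif s) - \<alpha> a * (\<phi> (b * s) - \<alpha> s * \<phi> b) \<in> J"
proof -
  let ?E = "eval_ten \<alpha> \<phi>"
  let ?p = "ten a (b * s)" and ?q = "ten (a * s) b"
  have e: "ten a b * dif s = ?p - ?q" by (simp add: dif_def right_diff_distrib)
  have "?E (?p - ?q) - \<alpha> a * (\<phi> (b * s) - \<alpha> s * \<phi> b) = (?E (?p - ?q) - (?E ?p - ?E ?q)) + (?E ?p - \<alpha> a * \<phi> (b * s))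
     - (?E ?q - \<alpha> (a * s) * \<phi> b) - (\<alpha> (a * s) - \<alpha> a * \<alpha> s) * \<phi> b"
    by (simp add: algebra_simps)
  also have "\<dots> \<in> J"
    by (intro submod_add[OF J] idl_diff[OF J] idl_mult'[OF J] \<alpha>_mult eval_ten_ten eval_ten_diff)
  finally show ?thesis by (simp add: e)
qed

text \<open>If \<open>e\<close> is the sum of \<open>a k \<otimes> b k\<close>, then
  \<open>e * dif s\<close> is the sum of
  \<open>a k \<otimes> (b k * s) - (a k * s) \<otimes> b k\<close>. This vanishes in the tensor
  product, and evaluating it with \<open>\<alpha>\<close> and \<open>\<phi>\<close> gives the
  claim.\<close>

lemma average:
  assumes e: "e * dif s \<in> gen (tens_rels R)"
  shows "(\<Sum>k\<in>Poly_Mapping.keys e. \<alpha> (Poly_Mapping.lookup e k) * \<phi> (unMon k * s))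
     - \<alpha> s * (\<Sum>k\<in>Poly_Mapping.keys e. \<alpha> (Poly_Mapping.lookup e k) * \<phi> (unMon k)) \<in> J"
proof -
  let ?E = "eval_ten \<alpha> \<phi>" and ?K = "Poly_Mapping.keys e"
  let ?t = "\<lambda>k. ten (Poly_Mapping.lookup e k) (unMon k) * dif s"
  let ?v = "\<lambda>k. \<alpha> (Poly_Mapping.lookup e k) * (\<phi> (unMon k * s) - \<alpha> s * \<phi> (unMon k))"
  have "?E (e * dif s) \<in> J" by (rule eval_ten_gen[OF eval_ten_rel e])
  moreover have "e * dif s = (\<Sum>k\<in>?K. ?t k)"
    by (subst tens_expand[of e]) (simp add: sum_distrib_right)
  ultimately have 1: "?E (\<Sum>k\<in>?K. ?t k) \<in> J" by simp
  have 2: "?E (\<Sum>k\<in>?K. ?t k) - (\<Sum>k\<in>?K. ?E (?t k)) \<in> J" by (rule eval_ten_sum) simp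
  have 3: "(\<Sum>k\<in>?K. ?E (?t k) - ?v k) \<in> J" by (intro submod_sum[OF J] eval_ten_dif)
  have "(\<Sum>k\<in>?K. ?v k) \<in> J"
    using idl_diff[OF J idl_diff[OF J 1 2] 3] by (simp add: sum_subtractf)
  then show ?thesis by (simp add: right_diff_distrib sum_subtractf sum_distrib_left mult_ac)
qed

end

abbreviation mult_ten :: "'a::comm_ring_1 tens \<Rightarrow> 'a" where
  "mult_ten \<equiv> eval_ten (\<lambda>x. x) (\<lambda>x. x)"

lemma mult_ten_gen:
  assumes "g \<in> gen (tens_rels R \<union> range dif)" shows "mult_ten g = 0"
proof -
  interpret tensor_map "{0}" "\<lambda>x. x" R "\<lambda>x. x"
    by standard (auto simp: submod_def)
  have "mult_ten g \<in> {0}"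
  proof (rule eval_ten_gen[OF _ assms])
    fix a b x assume "x \<in> tens_rels R \<union> range dif"
    then show "mult_ten (ten a b * x) \<in> {0}"
      using eval_ten_rel eval_ten_dif by (auto simp: algebra_simps)
  qed
  then show ?thesis by simp
qed

lemma dif_add: "dif (x + y) - dif x - dif y = ten 1 (x + y) - ten 1 x - ten 1 y"
  by (simp add: dif_def ten_add)

lemma dif_mult: "dif (x * y) = ten 1 x * dif y + ten y 1 * dif x"
  by (simp add: dif_def algebra_simps)

lemma dif_const: "dif r = ten 1 (r * 1) - ten r 1"
  by (simp add: dif_def)

text \<open>\<open>\<Omega> = I / I\<^sup>2\<close>, where \<open>I\<close> is the kernel of the multiplication \<open>S \<otimes> S \<rightarrow> S\<close> and \<open>ds\<close> corresponds
  to \<open>dif s\<close>.\<close>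

lemma omega_rels_dif:
  fixes w :: "'a::comm_ring_1 \<Rightarrow>\<^sub>0 'a"
  assumes "w \<in> omega_rels R"
  shows "(\<Sum>s\<in>Poly_Mapping.keys w. ten (Poly_Mapping.lookup w s) 1 * dif s)
     \<in> gen (gen (tens_rels R) \<union> {dif x * dif y |x y. True})" (is "?G w \<in> ?I")
proof -
  have I: "submod UNIV ?I" by (rule submod_gen)
  have rel: "x \<in> ?I" if "x \<in> tens_rels R" for x using that by (auto intro: gen_incl)
  have add: "?G (u + v) = ?G u + ?G v" for u v :: "'a \<Rightarrow>\<^sub>0 'a"
    by (rule setsum_keys_plus_distrib) (simp_all add: ten_add distrib_right)
  have zero: "?G 0 = 0" by simp
  have diff: "?G (u - v) = ?G u - ?G v" for u v :: "'a \<Rightarrow>\<^sub>0 'a"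
    using add[of "u - v" v] by (simp add: algebra_simps)
  have sing: "?G (Poly_Mapping.single s c) = ten c 1 * dif s" for s c
    by (cases "c = 0") simp_all
  from assms show ?thesis
  proof (induction rule: omega_rels.induct)
    case zero then show ?case using submod_0[OF I] by simp
  next
    case (add a b) then show ?case unfolding \<open>\<And>v u. ?G (u + v) = ?G u + ?G v\<close> by (intro submod_add[OF I])
  next
    case (rel_add x y c)
    have "dif (x + y) - dif x - dif y \<in> ?I"
      by (rule rel) (auto simp: dif_add tens_rels_def)
    then have "ten c 1 * (dif (x + y) - dif x - dif y) \<in> ?I" by (rule idl_mult[OF I])
    then show ?case unfolding diff sing by (simp add: algebra_simps)
  next
    case (rel_mult x y c)
    have "dif x * dif y \<in> ?I" by (rule gen_incl) blast
    then have "ten c 1 * (dif x * dif y) \<in> ?I" by (rule idl_mult[OF I])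
    also have "ten c 1 * (dif x * dif y) = ten c 1 * dif (x * y) - ten (c * x) 1 * dif y - ten (c * y) 1 * dif x"
      by (simp add: dif_def algebra_simps)
    finally show ?case unfolding diff sing .
  next
    case (rel_const r c)
    have "dif r \<in> ?I" by (rule rel) (use rel_const in \<open>unfold dif_const tens_rels_def, blast\<close>)
    then show ?case unfolding sing by (rule idl_mult[OF I])
  qed
qed

section \<open>The separability element of an unramified extension of finite type\<close>

definition fin_type :: "'a::comm_ring_1 set \<Rightarrow> nat \<Rightarrow> (nat \<Rightarrow> 'a) \<Rightarrow> bool" where
  "fin_type R n x \<longleftrightarrow> (\<forall>s. \<exists>p. mpoly_over R n p \<and> mpoly_eval x p = s)"

lemma fin_type_induct:
  assumes "fin_type R n x" and V: "subr V" "R \<subseteq> V" "\<And>i. i < n \<Longrightarrow> x i \<in> V"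
  shows "s \<in> V"
proof -
  obtain p where p: "mpoly_over R n p" "mpoly_eval x p = s" using assms(1) unfolding fin_type_def by blast
  have "mpoly_eval x p \<in> V"
    unfolding mpoly_eval_def
  proof (intro subr_sum[OF V(1)] subr_mult[OF V(1)] subr_prod[OF V(1)] subr_power[OF V(1)])
    fix m assume m: "m \<in> Poly_Mapping.keys p"
    then show "Poly_Mapping.lookup p m \<in> V" using p(1) V(2) by (auto simp: mpoly_over_def)
    fix i assume "i \<in> Poly_Mapping.keys m"
    then show "x i \<in> V" using p(1) m V(3) by (auto simp: mpoly_over_def)
  qed
  then show ?thesis using p by simp
qed

text \<open>\<open>I\<close> is generated by \<open>K\<close> and the finitely many
  \<open>dif (x i)\<close>. It contains every \<open>dif s\<close>, because the \<open>s\<close> for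
  which this holds form a subring that contains \<open>R\<close> and all \<open>x i\<close>.
  Unramifiedness puts each \<open>dif (x i)\<close> into \<open>K\<close> plus the square of
  \<open>I\<close>, so Nakayama gives \<open>z\<close> congruent to \<open>1\<close> modulo
  \<open>I\<close> with \<open>z I\<close> inside \<open>K\<close>. As \<open>mult_ten\<close>
  vanishes on \<open>I\<close>, its value at \<open>z\<close> is \<open>1\<close>.\<close>

lemma separability_element:
  assumes R: "subr R" and ft: "fin_type R n x" and un: "unramified R"
  obtains e where "mult_ten e = 1" "\<And>s. e * dif s \<in> gen (tens_rels R)"
proof -
  define K where "K = gen (tens_rels R)"
  have K: "submod UNIV K" unfolding K_def by (rule submod_gen)
  define d where "d i = dif (x i)" for i
  define I where "I = gen (K \<union> d ` {..<n})"
  have Is: "submod UNIV I" unfolding I_def by (rule submod_gen)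
  have KI: "K \<subseteq> I" unfolding I_def by (auto intro: gen_incl)
  define V where "V = {s. dif s \<in> I}"
  have addI: "dif (s + t) - dif s - dif t \<in> I" for s t
    using KI unfolding K_def dif_add by (rule subsetD) (auto simp: tens_rels_def intro!: gen_incl)
  have RV: "R \<subseteq> V"
  proof
    fix r assume "r \<in> R"
    then have "dif r \<in> tens_rels R" unfolding dif_const tens_rels_def by blast
    then show "r \<in> V" using KI unfolding V_def K_def by (auto intro: gen_incl)
  qed
  have "subr V"
    unfolding subr_def
  proof (intro conjI ballI)
    show "1 \<in> V" using RV subr_1[OF R] by blast
    fix s t assume st: "s \<in> V" "t \<in> V"
    have "dif (s - t) = dif s - dif t - (dif ((s - t) + t) - dif (s - t) - dif t)" by simp
    also have "\<dots> \<in> I" using st by (intro idl_diff[OF Is] addI) (auto simp: V_def)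
    finally show "s - t \<in> V" by (simp add: V_def)
    have "dif (s * t) \<in> I" unfolding dif_mult
      using st by (intro submod_add[OF Is] idl_mult[OF Is]) (auto simp: V_def)
    then show "s * t \<in> V" by (simp add: V_def)
  qed
  moreover have "x i \<in> V" if "i < n" for i
    using that unfolding V_def I_def d_def by (auto intro: gen_incl)
  ultimately have difI: "dif s \<in> I" for s
    using fin_type_induct[OF ft _ RV, of s] by (auto simp: V_def)
  have "d i \<in> gen (K \<union> {y * y' |y y'. y \<in> I \<and> y' \<in> I})" for i
  proof -
    have "Poly_Mapping.single (x i) 1 \<in> omega_rels R" using un by (simp add: unramified_def)
    from omega_rels_dif[OF this] have "d i \<in> gen (K \<union> {dif x * dif y |x y. True})"
      by (simp add: K_def d_def ten_1)
    moreover have "gen (K \<union> {dif x * dif y |x y. True}) \<subseteq> gen (K \<union> {y * y' |y y'. y \<in> I \<and> y' \<in> I})"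
      using difI by (intro gen_mono) blast
    ultimately show ?thesis by blast
  qed
  then obtain z where z: "z - 1 \<in> I" "\<And>y. y \<in> I \<Longrightarrow> z * y \<in> K"
    using nakayama_idempotent[OF K I_def] by blast
  have "K \<subseteq> gen (tens_rels R \<union> range dif)" unfolding K_def by (rule gen_mono) blast
  then have "I \<subseteq> gen (tens_rels R \<union> range dif)"
    unfolding I_def by (intro gen_least[OF submod_gen]) (auto simp: d_def intro: gen_incl)
  then have m0: "mult_ten (z - 1) = 0" using mult_ten_gen z(1) by blast
  interpret additive_mod "{0}" "\<lambda>x::'a. x"
    by standard (auto simp: submod_def)
  have "mult_ten z = mult_ten ((z - 1) + ten 1 1)" by (simp add: ten_1)
  also have "\<dots> = 1" using eval_ten_add[of "\<lambda>x. x" "z - 1" "ten 1 1"] eval_ten_ten[of "\<lambda>x. x" 1 1] m0 by simp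
  finally show thesis using that[of z] z(2)[OF difI] by (simp add: K_def)
qed

lemma separable_mod_of_element:
  assumes J: "submod UNIV J" and e: "mult_ten e = 1" "\<And>s. e * dif s \<in> gen (tens_rels R)"
  shows "separable_mod R J (Poly_Mapping.keys e) (Poly_Mapping.lookup e) unMon"
  unfolding separable_mod_def
proof (intro conjI allI impI)
  show "(\<Sum>i\<in>Poly_Mapping.keys e. Poly_Mapping.lookup e i * unMon i) - 1 \<in> J"
    using e(1) submod_0[OF J] by (simp add: eval_ten_def)
  fix \<phi> s assume phi: "linear_mod R J \<phi>"
  interpret tensor_map J "\<lambda>x. x" R \<phi>
    by standard (use J phi submod_0[OF J] in \<open>auto simp: linear_mod_def\<close>)
  show "(\<Sum>i\<in>Poly_Mapping.keys e. Poly_Mapping.lookup e i * \<phi> (unMon i * s)) -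
      s * (\<Sum>i\<in>Poly_Mapping.keys e. Poly_Mapping.lookup e i * \<phi> (unMon i)) \<in> J"
    by (rule average[OF e(2)])
qed simp

section \<open>Intermediate rings of separable algebras\<close>

lemma linear_mod_cong:
  assumes J: "submod UNIV J" and phi: "linear_mod R J \<phi>" and uv: "u - v \<in> J"
  shows "\<phi> u - \<phi> v \<in> J"
proof -
  have "\<phi> ((u - v) + v) - \<phi> (u - v) - \<phi> v \<in> J" "\<phi> (u - v) \<in> J"
    using phi uv unfolding linear_mod_def by blast+
  from submod_add[OF J this] show ?thesis by (simp add: algebra_simps)
qed

text \<open>The quotient by this ideal is \<open>(S / J) \<otimes>\<^sub>R S\<close>.\<close>

definition tens_ideal :: "'a::comm_ring_1 set \<Rightarrow> 'a set \<Rightarrow> 'a tens set" where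
  "tens_ideal R J = gen (tens_rels R \<union> (\<lambda>j. ten j 1) ` J)"

lemma submod_tens_ideal: "submod UNIV (tens_ideal R J)"
  unfolding tens_ideal_def by (rule submod_gen)

lemma tens_ideal_add: "ten a (x + y) - ten a x - ten a y \<in> tens_ideal R J"
proof -
  have "ten 1 (x + y) - ten 1 x - ten 1 y \<in> tens_ideal R J"
    unfolding tens_ideal_def by (rule gen_incl) (auto simp: tens_rels_def)
  from idl_mult[OF submod_tens_ideal this, of "ten a 1"] show ?thesis by (simp add: right_diff_distrib)
qed

lemma tens_ideal_const: "r \<in> R \<Longrightarrow> ten a (r * x) - ten (r * a) x \<in> tens_ideal R J"
proof -
  assume "r \<in> R"
  then have "ten 1 (r * x) - ten r x \<in> tens_ideal R J"
    unfolding tens_ideal_def by (intro gen_incl) (auto simp: tens_rels_def)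
  from idl_mult[OF submod_tens_ideal this, of "ten a 1"] show ?thesis
    by (simp add: right_diff_distrib mult.commute)
qed

text \<open>The separability element of \<open>S \<otimes> S\<close> is the square of that of \<open>S\<close>.\<close>

lemma separable_mod_tens:
  fixes R J :: "'a::comm_ring_1 set"
  assumes e: "mult_ten e = 1" "\<And>s. e * dif s \<in> gen (tens_rels R)"
  shows "separable_mod ((\<lambda>r. ten r 1) ` R) (tens_ideal R J) (Poly_Mapping.keys e \<times> Poly_Mapping.keys e)
     (\<lambda>(i, j). ten (Poly_Mapping.lookup e i) (Poly_Mapping.lookup e j)) (\<lambda>(i, j). ten (unMon i) (unMon j))"
proof -
  let ?K = "Poly_Mapping.keys e"
  define a b where "a = Poly_Mapping.lookup e" and "b = (unMon :: 'a mon \<Rightarrow> 'a)"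
  define TJ where "TJ = tens_ideal R J"
  have TJ: "submod UNIV TJ" unfolding TJ_def by (rule submod_tens_ideal)
  have ab: "(\<Sum>k\<in>?K. a k * b k) = 1" using e(1) by (simp add: eval_ten_def a_def b_def)
  have one: "(\<Sum>(i, j)\<in>?K \<times> ?K. ten (a i) (a j) * ten (b i) (b j)) - 1 \<in> TJ"
  proof -
    \<comment> \<open>Sums pass through the right factor only modulo \<open>TJ\<close>; through the
      left factor they pass exactly, see \<open>t\<close>.\<close>
    have "(\<Sum>i\<in>A. ten 1 (f i)) - ten 1 (\<Sum>i\<in>A. f i) \<in> TJ" if "finite A" for A :: "'a mon set" and f
      using that
    proof (induction A rule: finite_induct)
      case empty
      show ?case using tens_ideal_add[of 1 0 0 R J, folded TJ_def] by simp
    next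
      case (insert i A)
      from idl_diff[OF TJ insert.IH tens_ideal_add[of 1 "f i" "sum f A" R J, folded TJ_def]]
      show ?case using insert.hyps by (simp add: algebra_simps)
    qed
    from this[of ?K "\<lambda>k. a k * b k"] have s: "(\<Sum>k\<in>?K. ten 1 (a k * b k)) - 1 \<in> TJ" by (simp add: ab ten_1)
    have t: "(\<Sum>k\<in>A. ten (f k) 1) = ten (\<Sum>k\<in>A. f k) 1" for A :: "'a mon set" and f
      by (induction A rule: infinite_finite_induct) (auto simp: ten_add)
    have "(\<Sum>(i, j)\<in>?K \<times> ?K. ten (a i) (a j) * ten (b i) (b j)) = (\<Sum>i\<in>?K. ten (a i * b i) 1) * (\<Sum>j\<in>?K. ten 1 (a j * b j))"
      by (simp add: sum_product sum.cartesian_product)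
    also have "\<dots> = (\<Sum>j\<in>?K. ten 1 (a j * b j))" by (simp add: t ab ten_1)
    finally show ?thesis using s by simp
  qed
  have av: "(\<Sum>(i, j)\<in>?K \<times> ?K. ten (a i) (a j) * \<Psi> (ten (b i) (b j) * s))
      - s * (\<Sum>(i, j)\<in>?K \<times> ?K. ten (a i) (a j) * \<Psi> (ten (b i) (b j))) \<in> TJ"
    if Psi: "linear_mod ((\<lambda>r. ten r 1) ` R) TJ \<Psi>" for \<Psi> s
  proof -
    have Psi_add: "\<Psi> (u + v) - \<Psi> u - \<Psi> v \<in> TJ" and Psi_mult: "r \<in> R \<Longrightarrow> \<Psi> (ten r 1 * u) - ten r 1 * \<Psi> u \<in> TJ"
      and Psi_TJ: "w \<in> TJ \<Longrightarrow> \<Psi> w \<in> TJ" for u v r w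
      using Psi by (auto simp: linear_mod_def)
    \<comment> \<open>The goal is that \<open>N s\<close> is congruent to \<open>s * N 1\<close>.
      Summing over one index at a time reduces this to \<open>average\<close> for a single factor:
      in \<open>left\<close> scalars act through \<open>ten c 1\<close>, in \<open>right\<close>
      through \<open>ten 1 d\<close>. The elements \<open>ten c d\<close> and their sums follow by
      induction.\<close>
    define N where "N s = (\<Sum>(i, j)\<in>?K \<times> ?K. ten (a i) (a j) * \<Psi> (ten (b i) (b j) * s))" for s
    have N1: "N s = (\<Sum>j\<in>?K. ten 1 (a j) * (\<Sum>i\<in>?K. ten (a i) 1 * \<Psi> (ten (b i) (b j) * s)))" for s
      unfolding N_def sum.cartesian_product[symmetric]
      by (subst sum.swap) (simp add: sum_distrib_left mult.assoc[symmetric])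
    have N2: "N s = (\<Sum>i\<in>?K. ten (a i) 1 * (\<Sum>j\<in>?K. ten 1 (a j) * \<Psi> (ten (b i) (b j) * s)))" for s
      unfolding N_def sum.cartesian_product[symmetric]
      by (simp add: sum_distrib_left mult.assoc[symmetric])
    have Nadd: "N (u + v) - N u - N v \<in> TJ" for u v
    proof -
      have "N (u + v) - N u - N v = (\<Sum>(i, j)\<in>?K \<times> ?K. ten (a i) (a j) *
          (\<Psi> (ten (b i) (b j) * u + ten (b i) (b j) * v) - \<Psi> (ten (b i) (b j) * u) - \<Psi> (ten (b i) (b j) * v)))"
        unfolding N_def sum_subtractf[symmetric] by (rule sum.cong) (auto simp: distrib_left right_diff_distrib)
      also have "\<dots> \<in> TJ" by (rule submod_sum[OF TJ]) (auto intro: idl_mult[OF TJ] Psi_add)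
      finally show ?thesis .
    qed
    have left: "N (ten c 1 * s) - ten c 1 * N s \<in> TJ" for c s
    proof -
      have "(\<Sum>i\<in>?K. ten (a i) 1 * \<Psi> (ten (b i * c) (b j) * s))
          - ten c 1 * (\<Sum>i\<in>?K. ten (a i) 1 * \<Psi> (ten (b i) (b j) * s)) \<in> TJ" for j
      proof -
        interpret tensor_map TJ "\<lambda>x. ten x 1" R "\<lambda>x. \<Psi> (ten x (b j) * s)"
        proof
          show "submod UNIV TJ" by (rule TJ)
          fix x y r
          show "ten (x + y) 1 - ten x 1 - ten y 1 \<in> TJ" using submod_0[OF TJ] by (simp add: ten_add)
          show "ten (x * y) 1 - ten x 1 * ten y 1 \<in> TJ" using submod_0[OF TJ] by simp
          show "\<Psi> (ten (x + y) (b j) * s) - \<Psi> (ten x (b j) * s) - \<Psi> (ten y (b j) * s) \<in> TJ"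
            unfolding ten_add distrib_right by (rule Psi_add)
          show "\<Psi> (ten (r * x) (b j) * s) - ten r 1 * \<Psi> (ten x (b j) * s) \<in> TJ" if "r \<in> R"
            using Psi_mult[OF that, of "ten x (b j) * s"] by (simp add: mult.assoc[symmetric])
        qed
        show ?thesis using average[OF e(2)] by (simp add: a_def b_def)
      qed
      then have "(\<Sum>j\<in>?K. ten 1 (a j) * ((\<Sum>i\<in>?K. ten (a i) 1 * \<Psi> (ten (b i * c) (b j) * s))
          - ten c 1 * (\<Sum>i\<in>?K. ten (a i) 1 * \<Psi> (ten (b i) (b j) * s)))) \<in> TJ"
        by (intro submod_sum[OF TJ] idl_mult[OF TJ])
      also have "(\<Sum>j\<in>?K. ten 1 (a j) * ((\<Sum>i\<in>?K. ten (a i) 1 * \<Psi> (ten (b i * c) (b j) * s))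
          - ten c 1 * (\<Sum>i\<in>?K. ten (a i) 1 * \<Psi> (ten (b i) (b j) * s)))) = N (ten c 1 * s) - ten c 1 * N s"
        unfolding N1 right_diff_distrib sum_subtractf
        by (simp add: sum_distrib_left mult.assoc[symmetric])
      finally show ?thesis .
    qed
    have right: "N (ten 1 d * s) - ten 1 d * N s \<in> TJ" for d s
    proof -
      have "(\<Sum>j\<in>?K. ten 1 (a j) * \<Psi> (ten (b i) (b j * d) * s))
          - ten 1 d * (\<Sum>j\<in>?K. ten 1 (a j) * \<Psi> (ten (b i) (b j) * s)) \<in> TJ" for i
      proof -
        interpret tensor_map TJ "ten 1" R "\<lambda>x. \<Psi> (ten (b i) x * s)"
        proof
          show "submod UNIV TJ" by (rule TJ)
          fix x y r
          show "ten 1 (x + y) - ten 1 x - ten 1 y \<in> TJ" unfolding TJ_def by (rule tens_ideal_add)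
          show "ten 1 (x * y) - ten 1 x * ten 1 y \<in> TJ" using submod_0[OF TJ] by simp
          have "ten (b i) (x + y) * s - (ten (b i) x * s + ten (b i) y * s) \<in> TJ"
            using idl_mult'[OF TJ tens_ideal_add[of "b i" x y R J, folded TJ_def], of s] by (simp add: algebra_simps)
          from submod_add[OF TJ linear_mod_cong[OF TJ Psi this] Psi_add[of "ten (b i) x * s" "ten (b i) y * s"]]
          show "\<Psi> (ten (b i) (x + y) * s) - \<Psi> (ten (b i) x * s) - \<Psi> (ten (b i) y * s) \<in> TJ"
            by (simp add: algebra_simps)
          show "\<Psi> (ten (b i) (r * x) * s) - ten 1 r * \<Psi> (ten (b i) x * s) \<in> TJ" if r: "r \<in> R"
          proof -
            have "ten (b i) (r * x) * s - ten r 1 * (ten (b i) x * s) \<in> TJ"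
              using idl_mult'[OF TJ tens_ideal_const[OF r, of "b i" x J, folded TJ_def], of s]
              by (simp add: algebra_simps mult.assoc[symmetric])
            note 1 = linear_mod_cong[OF TJ Psi this]
            have "ten 1 r - ten r 1 \<in> TJ"
              using tens_ideal_const[OF r, of 1 1 J, folded TJ_def] by simp
            note 2 = idl_mult'[OF TJ this, of "\<Psi> (ten (b i) x * s)"]
            from idl_diff[OF TJ submod_add[OF TJ 1 Psi_mult[OF r, of "ten (b i) x * s"]] 2]
            show ?thesis by (simp add: algebra_simps)
          qed
        qed
        show ?thesis using average[OF e(2)] by (simp add: a_def b_def)
      qed
      then have "(\<Sum>i\<in>?K. ten (a i) 1 * ((\<Sum>j\<in>?K. ten 1 (a j) * \<Psi> (ten (b i) (b j * d) * s))
          - ten 1 d * (\<Sum>j\<in>?K. ten 1 (a j) * \<Psi> (ten (b i) (b j) * s)))) \<in> TJ"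
        by (intro submod_sum[OF TJ] idl_mult[OF TJ])
      also have "(\<Sum>i\<in>?K. ten (a i) 1 * ((\<Sum>j\<in>?K. ten 1 (a j) * \<Psi> (ten (b i) (b j * d) * s))
          - ten 1 d * (\<Sum>j\<in>?K. ten 1 (a j) * \<Psi> (ten (b i) (b j) * s)))) = N (ten 1 d * s) - ten 1 d * N s"
        unfolding N2 right_diff_distrib sum_subtractf
        by (simp add: sum_distrib_left mult.assoc[symmetric])
      finally show ?thesis .
    qed
    have "\<forall>s'. N (s * s') - s * N s' \<in> TJ"
    proof (induction s rule: tens_induct)
      case (ten c d)
      show ?case
      proof
        fix s'
        have "N (ten c 1 * (ten 1 d * s')) - ten c 1 * N (ten 1 d * s') + ten c 1 * (N (ten 1 d * s') - ten 1 d * N s') \<in> TJ"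
          by (intro submod_add[OF TJ] idl_mult[OF TJ] left right)
        then show "N (ten c d * s') - ten c d * N s' \<in> TJ"
          by (simp add: right_diff_distrib mult.assoc[symmetric])
      qed
    next
      case zero
      show ?case using idl_uminus[OF TJ Nadd[of 0 0]] by simp
    next
      case (add g h)
      show ?case
      proof
        fix s'
        have "(N (g * s' + h * s') - N (g * s') - N (h * s')) + (N (g * s') - g * N s') + (N (h * s') - h * N s') \<in> TJ"
          using add by (intro submod_add[OF TJ] Nadd) blast+
        then show "N ((g + h) * s') - (g + h) * N s' \<in> TJ" by (simp add: algebra_simps)
      qed
    qed
    from this[rule_format, of 1] show ?thesis by (simp add: N_def)
  qed
  show ?thesis
    unfolding separable_mod_def a_def[symmetric] b_def[symmetric] TJ_def[symmetric]
    using one av by (auto simp: case_prod_unfold)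
qed

lemma finite_ideals_above_tens:
  fixes R J :: "'a::comm_ring_1 set"
  assumes R: "subr R" and F: "field_mod R J"
    and e: "mult_ten e = 1" "\<And>s. e * dif s \<in> gen (tens_rels R)"
  shows "finite (ideals_above (tens_ideal R J))"
proof (rule separable_finite_ideals_above[OF _ submod_tens_ideal _ separable_mod_tens[OF e]])
  show "subr ((\<lambda>r. ten r (1::'a)) ` R)"
    unfolding subr_def
  proof (intro conjI ballI)
    show "1 \<in> (\<lambda>r. ten r (1::'a)) ` R" using subr_1[OF R] ten_1[where ?'a='a] by (metis imageI)
    fix x y assume "x \<in> (\<lambda>r. ten r (1::'a)) ` R" "y \<in> (\<lambda>r. ten r (1::'a)) ` R"
    then obtain r s where rs: "r \<in> R" "s \<in> R" "x = ten r 1" "y = ten s 1" by blast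
    then have "x - y = ten (r - s) 1" "x * y = ten (r * s) 1" by (simp_all add: ten_diff)
    then show "x - y \<in> (\<lambda>r. ten r (1::'a)) ` R" "x * y \<in> (\<lambda>r. ten r (1::'a)) ` R"
      using rs by (simp_all add: subr_rules R)
  qed
  have tJ: "ten j 1 \<in> tens_ideal R J" if "j \<in> J" for j
    unfolding tens_ideal_def using that by (auto intro: gen_incl)
  show "field_mod ((\<lambda>r. ten r (1::'a)) ` R) (tens_ideal R J)"
    unfolding field_mod_def
  proof
    fix x assume "x \<in> (\<lambda>r. ten r (1::'a)) ` R"
    then obtain r where r: "r \<in> R" "x = ten r 1" by blast
    show "x \<in> tens_ideal R J \<or> (\<exists>t\<in>(\<lambda>r. ten r 1) ` R. 1 - t * x \<in> tens_ideal R J)"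
    proof (cases "r \<in> J")
      case False
      then obtain t where t: "t \<in> R" "1 - t * r \<in> J" using F r(1) by (auto simp: field_mod_def)
      have "1 - ten t 1 * x = ten (1 - t * r) 1" by (simp add: r ten_diff ten_1)
      then have "1 - ten t 1 * x \<in> tens_ideal R J" using tJ[OF t(2)] by simp
      then show ?thesis using t(1) by blast
    qed (use tJ r in blast)
  qed
qed

text \<open>For \<open>u\<close> in \<open>T\<close> the chain of the modules
  \<open>u ^ m T + J\<close> stops because leading indices run out, so
  \<open>u * (1 - u * w)\<close> is nilpotent modulo \<open>J\<close> for some \<open>w\<close> in
  \<open>T\<close>. It then lies in \<open>J\<close>, since \<open>S / J\<close> is reduced. Thus
  \<open>T / J\<close> is von Neumann regular, and an idempotent of \<open>A\<close> that is as
  large as possible generates \<open>A\<close> modulo \<open>J\<close>.\<close>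

lemma semisimple_intermediate:
  assumes R: "subr R" and J: "submod UNIV J" and F: "field_mod R J" and sp: "span_mod R J n x"
    and ss: "semisimple_mod UNIV J" and fin: "finite (ideals_above J)"
    and T: "subr T" "R \<subseteq> T" "J \<subseteq> T"
  shows "semisimple_mod T J"
proof -
  have JT: "submod T J" by (rule submod_mono[OF J]) simp
  have red: "u \<in> J" if u: "u ^ Suc k \<in> J" for u k
  proof -
    have "prin UNIV u \<in> ideals_of UNIV" by (rule prin_in_ideals_of[OF subr_UNIV]) simp
    then obtain h where h: "h \<in> prin UNIV u" "\<And>t. t \<in> prin UNIV u \<Longrightarrow> t - t * h \<in> J"
      using ss unfolding semisimple_mod_def by blast
    then obtain v where v: "h = u * v" by (auto elim: prinE)
    have uv: "u - u * (u * v) \<in> J" using h(2)[OF prin_self[OF subr_UNIV]] v by simp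
    have "u - u ^ Suc m * v ^ m \<in> J" for m
    proof (induction m)
      case (Suc m)
      have "u - u ^ Suc (Suc m) * v ^ Suc m = (u - u * (u * v)) + (u * v) * (u - u ^ Suc m * v ^ m)"
        by (simp add: algebra_simps)
      also have "\<dots> \<in> J" by (intro submod_add[OF J] idl_mult[OF J] uv Suc.IH)
      finally show ?case .
    qed (simp add: submod_0[OF J])
    from submod_add[OF J this[of k] idl_mult'[OF J u, of "v ^ k"]] show ?thesis by simp
  qed
  have reg: "\<exists>v\<in>T. u - u * u * v \<in> J" if u: "u \<in> T" for u
  proof -
    define M where "M m = msum (prin T (u ^ m)) J" for m
    have Ms: "submod R (M m)" "J \<subseteq> M m" for m
      unfolding M_def using submod_msum[OF submod_prin[OF T(1)] JT] msum_right[OF submod_prin[OF T(1)]]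
      by (auto intro: submod_mono[OF _ T(2)])
    have "M (Suc m) \<subseteq> M m" for m
    proof
      fix z assume "z \<in> M (Suc m)"
      then obtain r j where rj: "r \<in> T" "j \<in> J" "z = u ^ Suc m * r + j" unfolding M_def by (auto elim!: msumE prinE)
      have "z = u ^ m * (u * r) + j" by (simp add: rj mult_ac)
      then show "z \<in> M m" unfolding M_def using msumI[OF prinI[OF subr_mult[OF T(1) u rj(1)]] rj(2)] by simp
    qed
    then have dec: "M (Suc m) \<subset> M m" if "M (Suc m) \<noteq> M m" for m using that by blast
    have "\<exists>m. M (Suc m) = M m"
    proof (rule ccontr)
      assume "\<nexists>m. M (Suc m) = M m"
      then have lt: "card (lead R J n x (M (Suc m))) < card (lead R J n x (M m))" for m
        using card_lead_less[OF R J F sp Ms Ms(1) dec] by blast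
      have "card (lead R J n x (M m)) + m \<le> card (lead R J n x (M 0))" for m
      proof (induction m)
        case (Suc m) then show ?case using lt[of m] by simp
      qed simp
      from this[of "Suc (card (lead R J n x (M 0)))"] show False by simp
    qed
    then obtain m where m: "M (Suc m) = M m" by blast
    have "u ^ m \<in> M m" unfolding M_def using msum_left[OF JT] prin_self[OF T(1)] by blast
    then obtain w j where w: "w \<in> T" "j \<in> J" "u ^ m = u ^ Suc m * w + j"
      unfolding m[symmetric] unfolding M_def by (auto elim!: msumE prinE)
    have "(u * (1 - u * w)) ^ Suc m = u * (1 - u * w) ^ m * (u ^ m * (1 - u * w))"
      by (simp add: power_mult_distrib mult_ac)
    also have "u ^ m * (1 - u * w) = j" using w(3) by (simp add: algebra_simps)
    finally have "(u * (1 - u * w)) ^ Suc m \<in> J" using idl_mult[OF J w(2)] by simp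
    then have "u * (1 - u * w) \<in> J" by (rule red)
    then show ?thesis using w(1) by (intro bexI[of _ w]) (simp_all add: algebra_simps)
  qed
  show ?thesis
    unfolding semisimple_mod_def
  proof
    fix A assume "A \<in> ideals_of T"
    then have A: "A \<subseteq> T" "submod T A" by (auto simp: ideals_of_def)
    \<comment> \<open>The ideals that measure the size of an idempotent are taken in all of
      \<open>S\<close>, where \<open>fin\<close> bounds their number. If \<open>t - t * h\<close>
      were not in \<open>J\<close>, regularity would supply an idempotent \<open>f\<close> of
      \<open>A\<close> orthogonal to \<open>h\<close> modulo \<open>J\<close>, and
      \<open>h + f\<close> would generate a larger ideal.\<close>
    define I where "I h = msum (prin UNIV h) J" for h
    have Ia: "I h \<in> ideals_above J" for h
      unfolding I_def ideals_above_def
      using submod_msum[OF submod_prin[OF subr_UNIV] J] msum_right[OF submod_prin[OF subr_UNIV]] by auto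
    define X where "X = {h\<in>A. h - h * h \<in> J}"
    have "finite (I ` X)" by (rule finite_subset[OF _ fin]) (use Ia in blast)
    moreover have "0 \<in> X" using submod_0[OF A(2)] submod_0[OF J] by (simp add: X_def)
    ultimately have "\<exists>N\<in>I ` X. \<forall>L\<in>I ` X. N \<subseteq> L \<longrightarrow> N = L" by (intro finite_has_maximal) auto
    then obtain h where h: "h \<in> X" "\<And>h'. h' \<in> X \<Longrightarrow> I h \<subseteq> I h' \<Longrightarrow> I h' = I h" by auto
    have hA: "h \<in> A" "h - h * h \<in> J" using h(1) by (auto simp: X_def)
    have "t - t * h \<in> J" if t: "t \<in> A" for t
    proof -
      define u where "u = t - t * h"
      have uA: "u \<in> A" unfolding u_def using t hA A by (intro submod_diff[OF T(1) A(2)] submod_mult[OF A(2)]) auto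
      obtain v where v: "v \<in> T" "u - u * u * v \<in> J" using reg uA A by blast
      define f where "f = u * v"
      have fA: "f \<in> A" unfolding f_def using uA v A by (intro submod_mult'[OF A(2)])
      have "h * u = t * (h - h * h)" by (simp add: u_def algebra_simps)
      then have hu: "h * u \<in> J" using idl_mult[OF J hA(2)] by simp
      then have hf: "h * f \<in> J" unfolding f_def mult.assoc[symmetric] by (rule idl_mult'[OF J])
      have ff: "f - f * f \<in> J"
        using idl_mult'[OF J v(2), of v] by (simp add: f_def algebra_simps)
      have "(h + f) - (h + f) * (h + f) = (h - h * h) + (f - f * f) - h * f - h * f" by (simp add: algebra_simps)
      also have "\<dots> \<in> J" by (intro idl_diff[OF J] submod_add[OF J] hA ff hf)
      finally have h'X: "h + f \<in> X" using submod_add[OF A(2) hA(1) fA] by (simp add: X_def)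
      have Is: "submod UNIV (I (h + f))" "J \<subseteq> I (h + f)" using Ia by (auto simp: ideals_above_def)
      have "h = (h + f) * h + ((h - h * h) - h * f)" by (simp add: algebra_simps)
      also have "\<dots> \<in> I (h + f)" unfolding I_def by (intro msumI prinI idl_diff[OF J] hA hf) simp
      finally have hI: "h \<in> I (h + f)" .
      have "I h \<subseteq> I (h + f)"
      proof
        fix z assume "z \<in> I h"
        then obtain r j where "j \<in> J" "z = h * r + j" unfolding I_def by (auto elim!: msumE prinE)
        then show "z \<in> I (h + f)" using Is hI by (auto intro: submod_add idl_mult')
      qed
      then have "I (h + f) = I h" using h(2) h'X by blast
      moreover have "h + f \<in> I (h + f)" unfolding I_def using msum_left[OF J] prin_self[OF subr_UNIV] by blast
      ultimately obtain r j where j: "j \<in> J" "h + f = h * r + j" unfolding I_def by (auto elim!: msumE prinE)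
      have "f = (1 - h) * (h + f) - (h - h * h) + h * f" by (simp add: algebra_simps)
      also have "\<dots> = (h - h * h) * r + (1 - h) * j - (h - h * h) + h * f" unfolding j(2) by (simp add: algebra_simps)
      also have "\<dots> \<in> J" by (intro submod_add[OF J] idl_diff[OF J] idl_mult[OF J] idl_mult'[OF J] hA j hf)
      finally have fJ: "f \<in> J" .
      have "u = (u - u * u * v) + u * f" by (simp add: f_def algebra_simps)
      also have "\<dots> \<in> J" by (intro submod_add[OF J] idl_mult[OF J] v fJ)
      finally show ?thesis by (simp add: u_def)
    qed
    then show "\<exists>h\<in>A. \<forall>t\<in>A. t - t * h \<in> J" using hA by blast
  qed
qed

text \<open>An intermediate ring \<open>T\<close> is recovered from the kernel of \<open>S \<otimes>\<^sub>R S \<rightarrow> S \<otimes>\<^sub>T S\<close>, by means of a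
  \<open>T\<close>-linear retraction of \<open>S\<close> onto \<open>T\<close>.\<close>

lemma intermediate_recover:
  assumes J: "submod UNIV J" and T: "subr T" "R \<subseteq> T" "J \<subseteq> T" and ss: "semisimple_mod T J"
    and s: "dif s \<in> gen (tens_rels R \<union> (\<lambda>j. ten j 1) ` J \<union> dif ` T)"
  shows "s \<in> T"
proof -
  obtain \<phi> where phi: "linear_mod T J \<phi>" "\<And>s. \<phi> s - s \<in> T" "\<And>w. w \<in> T \<Longrightarrow> \<phi> w \<in> J"
    using complement_projection[OF T(1) J ss submod_self[OF T(1)] T(3)] by blast
  \<comment> \<open>Modulo \<open>J\<close>, \<open>\<tau>\<close> is a \<open>T\<close>-linear
    retraction onto \<open>T\<close>. Sending \<open>a \<otimes> b\<close> to
    \<open>a * \<tau> b\<close> kills the generators of the kernel, so \<open>\<tau> s\<close> is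
    congruent to \<open>s * \<tau> 1\<close>, that is, to \<open>s\<close>.\<close>
  define \<tau> where "\<tau> s = s - \<phi> s" for s
  have tT: "\<tau> s \<in> T" for s unfolding \<tau>_def using subr_uminus[OF T(1) phi(2)[of s]] by simp
  have tadd: "\<tau> (u + v) - \<tau> u - \<tau> v \<in> J" for u v
  proof -
    have "\<phi> (u + v) - \<phi> u - \<phi> v \<in> J" using phi(1) by (simp add: linear_mod_def)
    from idl_uminus[OF J this] show ?thesis by (simp add: \<tau>_def algebra_simps)
  qed
  have tmult: "\<tau> (t * u) - t * \<tau> u \<in> J" if "t \<in> T" for t u
  proof -
    have "\<phi> (t * u) - t * \<phi> u \<in> J" using phi(1) that by (simp add: linear_mod_def)
    from idl_uminus[OF J this] show ?thesis by (simp add: \<tau>_def algebra_simps)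
  qed
  interpret tensor_map J "\<lambda>x. x" R \<tau>
    by standard (use J submod_0[OF J] tadd tmult T(2) in auto)
  have "eval_ten (\<lambda>x. x) \<tau> (dif s) \<in> J"
  proof (rule eval_ten_gen[OF _ s])
    fix a b x assume "x \<in> tens_rels R \<union> (\<lambda>j. ten j 1) ` J \<union> dif ` T"
    then consider "x \<in> tens_rels R" | j where "j \<in> J" "x = ten j 1" | t where "t \<in> T" "x = dif t" by blast
    then show "eval_ten (\<lambda>x. x) \<tau> (ten a b * x) \<in> J"
    proof cases
      case 1 then show ?thesis by (rule eval_ten_rel)
    next
      case 2
      have "a * j * \<tau> b \<in> J" by (intro idl_mult'[OF J] idl_mult[OF J] 2)
      from submod_add[OF J eval_ten_ten[of \<tau> "a * j" b] this] show ?thesis by (simp add: 2)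
    next
      case 3
      have "a * (\<tau> (b * t) - t * \<tau> b) \<in> J" using tmult[OF 3(1), of b] by (intro idl_mult[OF J]) (simp add: mult.commute)
      from submod_add[OF J eval_ten_dif[of a b t] this] show ?thesis by (simp add: 3)
    qed
  qed
  from idl_diff[OF J this eval_ten_dif[of 1 1 s]] have 1: "\<tau> s - s * \<tau> 1 \<in> J" by (simp add: ten_1)
  have "\<phi> 1 \<in> J" using phi(3) subr_1[OF T(1)] by blast
  then have "s * \<phi> 1 \<in> J" by (rule idl_mult[OF J])
  then have sT: "s * \<phi> 1 \<in> T" and uT: "\<tau> s - s * \<tau> 1 \<in> T" using 1 T(3) by auto
  from subr_add[OF T(1) subr_diff[OF T(1) tT[of s] uT] sT] show ?thesis by (simp add: \<tau>_def algebra_simps)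
qed

theorem finite_intermediate_rings:
  fixes R J :: "'a::comm_ring_1 set"
  assumes R: "subr R" and J: "submod UNIV J" and F: "field_mod R J"
    and e: "mult_ten e = 1" "\<And>s. e * dif s \<in> gen (tens_rels R)"
  shows "finite {T. subr T \<and> R \<subseteq> T \<and> J \<subseteq> T}"
proof -
  let ?X = "{T. subr T \<and> R \<subseteq> T \<and> J \<subseteq> T}"
  note sep = separable_mod_of_element[OF J e]
  obtain n x where sp: "span_mod R J n x" using separable_finite_span[OF R J F sep] by blast
  define f where "f T = gen (tens_rels R \<union> (\<lambda>j. ten j 1) ` J \<union> dif ` T)" for T
  have "f T \<in> ideals_above (tens_ideal R J)" for T
    unfolding f_def ideals_above_def tens_ideal_def mem_Collect_eq by (intro conjI submod_gen gen_mono) simp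
  then have "f ` ?X \<subseteq> ideals_above (tens_ideal R J)" by (intro image_subsetI)
  then have "finite (f ` ?X)" using finite_ideals_above_tens[OF R F e] by (rule finite_subset)
  moreover have "inj_on f ?X"
  proof -
    have sub: "T \<subseteq> T'" if T: "T' \<in> ?X" "f T = f T'" for T T'
    proof
      fix s assume "s \<in> T"
      then have "dif s \<in> f T" unfolding f_def by (auto intro: gen_incl)
      then have s: "dif s \<in> f T'" using T(2) by simp
      have T': "subr T'" "R \<subseteq> T'" "J \<subseteq> T'" using T(1) by auto
      have "semisimple_mod T' J"
        by (rule semisimple_intermediate[OF R J F sp separable_semisimple[OF R J F sep]
            separable_finite_ideals_above[OF R J F sep] T'])
      from intermediate_recover[OF J T' this s[unfolded f_def]] show "s \<in> T'" .
    qed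
    show ?thesis by (rule inj_onI) (rule equalityI[OF sub sub[OF _ sym]])
  qed
  ultimately show ?thesis by (rule finite_imageD)
qed

section \<open>Finiteness over a ring with finitely many ideals\<close>

text \<open>By \<open>mem_if_mem_local\<close> a submodule is determined by its images under the
  local idempotents, one for each of the finitely many primes. The family \<open>X\<close> will be
  the ideals of \<open>S\<close> or the intermediate rings.\<close>

lemma finite_if_locally_finite:
  assumes R: "subr R" and fin: "finite (ideals_of R)" and X: "\<And>M. M \<in> X \<Longrightarrow> submod R M"
    and loc: "\<And>P. prime_in R P \<Longrightarrow> \<exists>e. local_idem R P e \<and> finite ((\<lambda>M. (*) e ` M) ` X)"
  shows "finite X"
proof -
  define Pr where "Pr = {P. prime_in R P}"
  have finPr: "finite Pr" by (rule finite_subset[OF _ fin]) (auto simp: Pr_def prime_in_def)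
  obtain \<epsilon> where eps: "\<And>P. P \<in> Pr \<Longrightarrow> local_idem R P (\<epsilon> P)" "\<And>P. P \<in> Pr \<Longrightarrow> finite ((\<lambda>M. (*) (\<epsilon> P) ` M) ` X)"
    using loc unfolding Pr_def mem_Collect_eq by metis
  \<comment> \<open>The default \<open>{}\<close> outside \<open>Pr\<close> leaves only finitely
    many possible functions.\<close>
  define g where "g M = (\<lambda>P. if P \<in> Pr then (*) (\<epsilon> P) ` M else {})" for M
  define B where "B = (\<Union>P\<in>Pr. (\<lambda>M. (*) (\<epsilon> P) ` M) ` X)"
  have "finite B" unfolding B_def using finPr eps(2) by (intro finite_UN_I)
  then have "finite {f. \<forall>P. (P \<in> Pr \<longrightarrow> f P \<in> B) \<and> (P \<notin> Pr \<longrightarrow> f P = {})}"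
    by (rule finite_set_of_finite_funs[OF finPr])
  moreover have "g ` X \<subseteq> {f. \<forall>P. (P \<in> Pr \<longrightarrow> f P \<in> B) \<and> (P \<notin> Pr \<longrightarrow> f P = {})}"
    unfolding g_def B_def by (intro image_subsetI CollectI allI conjI impI) auto
  ultimately have "finite (g ` X)" by (rule finite_subset[rotated])
  moreover have sub: "M \<subseteq> M'" if M: "M' \<in> X" "g M = g M'" for M M'
  proof
    fix x assume x: "x \<in> M"
    show "x \<in> M'"
    proof (rule mem_if_mem_local[OF R fin X[OF M(1)]])
      fix P assume "prime_in R P"
      then have P: "P \<in> Pr" by (simp add: Pr_def)
      have "(*) (\<epsilon> P) ` M = (*) (\<epsilon> P) ` M'" using fun_cong[OF M(2), of P] P by (simp add: g_def)
      then have "\<epsilon> P * x \<in> (*) (\<epsilon> P) ` M'" using x by blast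
      then have "\<epsilon> P * x \<in> M'" using eps(1)[OF P] submod_mult[OF X[OF M(1)]] by (auto simp: local_idem_def)
      then show "\<exists>e. local_idem R P e \<and> e * x \<in> M'" using eps(1)[OF P] by blast
    qed
  qed
  have "inj_on g X" by (rule inj_onI) (rule equalityI[OF sub sub[OF _ sym]])
  with calculation show ?thesis by (rule finite_imageD)
qed

section \<open>Extensions of a single local factor\<close>

lemma local_idem_notin:
  assumes "prime_in R P" "local_idem R P e" shows "e \<notin> P"
proof
  assume "e \<in> P"
  then have "(1 - e) + e \<in> P"
    using assms unfolding local_idem_def prime_in_def ideals_of_def by (blast intro: submod_add)
  then show False using assms by (simp add: prime_in_def)
qed

lemma field_mod_prime:
  assumes P: "prime_in R P" and e: "local_idem R P e"
  shows "field_mod R (gen P)"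
  unfolding field_mod_def
proof
  fix r assume r: "r \<in> R"
  show "r \<in> gen P \<or> (\<exists>t\<in>R. 1 - t * r \<in> gen P)"
  proof (cases "r \<in> P")
    case False
    then obtain t where t: "t \<in> R" "r * t = e" using e r by (auto simp: local_idem_def)
    then have "1 - t * r \<in> P" using e by (simp add: local_idem_def mult.commute)
    then show ?thesis using t(1) gen_incl by blast
  qed (auto intro: gen_incl)
qed

lemma gen_prime_ann:
  assumes z: "\<And>p. p \<in> P \<Longrightarrow> e * p = 0" and j: "j \<in> gen P"
  shows "e * j = 0"
proof -
  have "submod UNIV {j. e * j = 0}" by (auto simp: submod_def distrib_left mult.left_commute[of e])
  then have "gen P \<subseteq> {j. e * j = 0}" by (rule gen_least) (use z in blast)
  then show ?thesis using j by blast
qed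

lemma gen_prime_principal:
  assumes q: "\<And>p. p \<in> P \<Longrightarrow> \<exists>r. e * p = q * r" and j: "j \<in> gen P"
  obtains s where "e * j = q * s"
proof -
  have "submod UNIV {j. \<exists>s. e * j = q * s}"
    unfolding submod_def
  proof (intro conjI ballI)
    show "0 \<in> {j. \<exists>s. e * j = q * s}" by (auto intro!: exI[of _ 0])
    fix x y assume "x \<in> {j. \<exists>s. e * j = q * s}" "y \<in> {j. \<exists>s. e * j = q * s}"
    then obtain s t where "e * x = q * s" "e * y = q * t" by blast
    then have "e * (x + y) = q * (s + t)" by (simp add: distrib_left)
    then show "x + y \<in> {j. \<exists>s. e * j = q * s}" by blast
  next
    fix r x assume "x \<in> {j. \<exists>s. e * j = q * s}"
    then obtain s where "e * x = q * s" by blast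
    then have "e * (r * x) = q * (r * s)" by (simp add: mult.left_commute[of _ r])
    then show "r * x \<in> {j. \<exists>s. e * j = q * s}" by blast
  qed
  then have "gen P \<subseteq> {j. \<exists>s. e * j = q * s}" by (rule gen_least) (use q in blast)
  then show thesis using j that by blast
qed

text \<open>Nakayama's lemma for an ideal generated by finitely many nilpotents, removed one at a
  time. Applying the approximation to the coefficient \<open>c\<close> of an error
  \<open>c * p ^ Suc k\<close> raises the exponent, and a high power of \<open>p\<close>
  vanishes.\<close>

lemma nilpotent_nakayama:
  assumes R: "subr R" and N: "submod R N" and ee: "e * e = e" and F: "finite F" "F \<subseteq> R" "\<And>p. p \<in> F \<Longrightarrow> \<exists>k. p ^ k = 0"
    and gen: "\<And>s. \<exists>m\<in>N. e * s - e * m \<in> gen F"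
  shows "\<exists>m\<in>N. e * s = e * m"
  using F gen
proof (induction F arbitrary: s rule: finite_induct)
  case empty
  have "gen {} \<subseteq> {0}" by (rule gen_least) (auto simp: submod_def)
  then show ?case using empty.prems(3)[of s] by force
next
  case (insert p F)
  have p: "p \<in> R" using insert.prems by blast
  have Gs: "submod UNIV (gen F)" by (rule submod_gen)
  have base: "\<exists>m\<in>N. \<exists>c. e * s - e * m - c * p \<in> gen F" for s
  proof -
    obtain m where m: "m \<in> N" "e * s - e * m \<in> gen (insert p F)" using insert.prems(3) by blast
    then obtain u c where "u \<in> gen F" "e * s - e * m = u + c * p" by (metis gen_insert_decomp)
    then show ?thesis using m(1) by (intro bexI[of _ m] exI[of _ c]) simp_all
  qed
  have pw: "\<exists>m\<in>N. \<exists>c. e * s - e * m - c * p ^ Suc k \<in> gen F" for s k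
  proof (induction k arbitrary: s)
    case 0 then show ?case using base by simp
  next
    case (Suc k)
    obtain m c where 1: "m \<in> N" "e * s - e * m - c * p ^ Suc k \<in> gen F" using Suc by blast
    obtain m' c' where 2: "m' \<in> N" "e * c - e * m' - c' * p \<in> gen F" using base by blast
    have "e * s - e * (m + p ^ Suc k * m') - c' * p ^ Suc (Suc k)
        = e * (e * s - e * m - c * p ^ Suc k) + (e * c - e * m' - c' * p) * p ^ Suc k"
    proof -
      have "e * (e * s - e * m - c * p ^ Suc k) = e * e * s - e * e * m - e * c * p ^ Suc k"
        by (simp only: right_diff_distrib mult.assoc)
      then show ?thesis unfolding ee by (simp add: algebra_simps)
    qed
    also have "\<dots> \<in> gen F" by (intro submod_add[OF Gs] idl_mult[OF Gs] idl_mult'[OF Gs] 1 2)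
    finally have "e * s - e * (m + p ^ Suc k * m') - c' * p ^ Suc (Suc k) \<in> gen F" .
    moreover have "m + p ^ Suc k * m' \<in> N"
      by (intro submod_add[OF N] submod_mult[OF N] subr_power[OF R p] 1 2)
    ultimately show ?case by blast
  qed
  obtain k where k: "p ^ k = 0" using insert.prems by blast
  then have k': "p ^ Suc k = 0" by simp
  have "\<exists>m\<in>N. e * s - e * m \<in> gen F" for s
    using pw[of s k] unfolding k' by simp
  then show ?case using insert.IH insert.prems by blast
qed

text \<open>As \<open>e R\<close> is finite, \<open>e P\<close> is a finite set of nilpotents, so
  generators of \<open>S / P S\<close> lift to generators of \<open>e S\<close> over the finite ring
  \<open>e R\<close>.\<close>

lemma finite_local_extension:
  assumes R: "subr R" and P: "prime_in R P" and e: "local_idem R P e" and fin: "finite ((*) e ` R)"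
    and sp: "span_mod R (gen P) n x"
  shows "finite (range ((*) e))"
proof -
  have PR: "P \<subseteq> R" using P by (auto simp: prime_in_def ideals_of_def)
  have eR: "e \<in> R" and ee: "e * e = e" using e by (auto simp: local_idem_def)
  define N where "N = {m. \<exists>c. (\<forall>i. c i \<in> R) \<and> m = (\<Sum>i<n. c i * x i)}"
  have N: "submod R N"
    using submod_span[OF R, of "{0}" x "{..<n}"] by (simp add: N_def submod_def)
  have "\<exists>m\<in>N. e * s = e * m" for s
  proof (rule nilpotent_nakayama[OF R N ee, of "(*) e ` P"])
    show "finite ((*) e ` P)" using fin PR by (meson finite_subset image_mono)
    show "(*) e ` P \<subseteq> R" using PR eR by (auto intro: subr_mult[OF R])
    show "\<exists>k. p ^ k = 0" if "p \<in> (*) e ` P" for p using that e by (auto simp: local_idem_def)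
    have "submod UNIV {j. e * j \<in> gen ((*) e ` P)}"
      using submod_gen[of "(*) e ` P"] by (auto simp: submod_def distrib_left mult.left_commute[of e])
    then have "gen P \<subseteq> {j. e * j \<in> gen ((*) e ` P)}" by (rule gen_least) (auto intro: gen_incl)
    moreover have "\<exists>m\<in>N. s - m \<in> gen P" for s using sp unfolding span_mod_def N_def by blast
    ultimately show "\<exists>m\<in>N. e * s - e * m \<in> gen ((*) e ` P)" for s
      unfolding right_diff_distrib[symmetric] by blast
  qed
  then have "range ((*) e) \<subseteq> (\<lambda>c. \<Sum>i<n. c i * x i) ` (PiE {..<n} (\<lambda>_. (*) e ` R))"
  proof -
    assume a: "\<And>s. \<exists>m\<in>N. e * s = e * m"
    show ?thesis
    proof
      fix y assume "y \<in> range ((*) e)"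
      then obtain s where "y = e * s" by blast
      then obtain m where "m \<in> N" "y = e * m" using a by blast
      then obtain c where c: "\<forall>i. c i \<in> R" "y = e * (\<Sum>i<n. c i * x i)" unfolding N_def by blast
      have "y = (\<Sum>i<n. restrict (\<lambda>i. e * c i) {..<n} i * x i)"
        unfolding c(2) by (simp add: sum_distrib_left mult.assoc)
      moreover have "restrict (\<lambda>i. e * c i) {..<n} \<in> PiE {..<n} (\<lambda>_. (*) e ` R)" using c(1) by auto
      ultimately show "y \<in> (\<lambda>c. \<Sum>i<n. c i * x i) ` (PiE {..<n} (\<lambda>_. (*) e ` R))" by (rule image_eqI)
    qed
  qed
  moreover have "finite (PiE {..<n} (\<lambda>_. (*) e ` R))" by (rule finite_PiE) (use fin in auto)
  ultimately show ?thesis by (meson finite_imageI finite_subset)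
qed

text \<open>If the maximal ideal of the local factor is \<open>q e R\<close>, an ideal \<open>I\<close> is determined on that factor
  by the ideals \<open>(I : q\<^sup>a) + P S\<close>, of which there are finitely many.\<close>

lemma finite_local_ideals_principal:
  assumes P: "prime_in R P" and e: "local_idem R P e"
    and q: "e * q = q" "q ^ n = 0" "\<And>p. p \<in> P \<Longrightarrow> \<exists>r\<in>R. e * p = q * r"
    and fin: "finite (ideals_above (gen P))" and ss: "semisimple_mod UNIV (gen P)"
  shows "finite ((\<lambda>I. (*) e ` I) ` ideals_of UNIV)"
proof -
  define J where "J = gen P"
  have J: "submod UNIV J" unfolding J_def by (rule submod_gen)
  have ee: "e * e = e" using e by (auto simp: local_idem_def)
  have eJ: "\<exists>s. e * j = q * s" if "j \<in> J" for j
    using gen_prime_principal[of P e q j] q(3) that unfolding J_def by metis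
  define C where "C a I = {s. q ^ a * (e * s) \<in> I}" for a :: nat and I
  \<comment> \<open>Because \<open>q ^ n = 0\<close>, only exponents below \<open>n\<close> matter;
    the default \<open>{}\<close> beyond them keeps the set of possible functions finite.\<close>
  define K where "K I = (\<lambda>a. if a < n then msum (C a I) J else {})" for I
  have Cs: "submod UNIV (C a I)" if "submod UNIV I" for a I
    using that unfolding C_def submod_def by (auto simp: distrib_left mult.left_commute)
  have sub: "e * x \<in> I'" if I: "submod UNIV I" "submod UNIV I'" "K I = K I'" "x \<in> I" for I I' x
  proof -
    \<comment> \<open>Descending induction on \<open>a\<close>, from the trivial case
      \<open>a = n\<close> to \<open>a = 0\<close>: an element of \<open>I\<close> that is divisible
      by \<open>q ^ a\<close> on the factor lies in \<open>I'\<close>.\<close>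
    have claim: "\<forall>x\<in>I. (\<exists>s. x = q ^ a * (e * s)) \<longrightarrow> x \<in> I'" if "a \<le> n" for a
      using that
    proof (induction rule: inc_induct)
      case base
      then show ?case using q(2) submod_0[OF I(2)] by auto
    next
      case (step a)
      have KK: "msum (C a I) J = msum (C a I') J"
        using fun_cong[OF I(3), of a] step.hyps by (simp add: K_def)
      define L where "L = msum (C a I) J"
      have "L \<in> ideals_of UNIV" unfolding L_def ideals_of_def using submod_msum[OF Cs[OF I(1)] J] by simp
      then obtain g where g: "g \<in> L" "\<And>t. t \<in> L \<Longrightarrow> t - t * g \<in> J"
        using ss unfolding semisimple_mod_def J_def by blast
      \<comment> \<open>Write \<open>g = u + j\<close> with \<open>u\<close> in the colon ideal and
        \<open>e * j = q * s\<close>. Modulo \<open>u\<close>, the element \<open>e * g ^ n\<close>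
        equals \<open>(q * s) ^ n * e = 0\<close>. So the power of \<open>g\<close>, unlike
        \<open>g\<close> itself, lies on the factor in the colon ideals of both \<open>I\<close> and
        \<open>I'\<close>.\<close>
      have power_mem: "q ^ a * (e * g ^ n) \<in> I''" if I'': "submod UNIV I''" "L = msum (C a I'') J" for I''
      proof -
        obtain u j where u: "u \<in> C a I''" "j \<in> J" "g = u + j" using g(1) unfolding I''(2) by (auto elim!: msumE)
        obtain s where s: "e * j = q * s" using eJ u by blast
        have epow: "e * (u + j) ^ m - (q * s) ^ m * e \<in> {u * y |y. True}" for m
        proof (induction m)
          case 0 show ?case by (auto intro!: exI[of _ 0])
        next
          case (Suc m)
          then obtain y where y: "e * (u + j) ^ m - (q * s) ^ m * e = u * y" by blast
          then have y': "e * (u + j) ^ m = (q * s) ^ m * e + u * y" by (simp add: algebra_simps)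
          have "e * (u + j) ^ Suc m = (u + j) * (e * (u + j) ^ m)" by (simp add: mult_ac)
          also have "\<dots> = (u + j) * ((q * s) ^ m * e + u * y)" by (simp only: y')
          also have "\<dots> = u * ((q * s) ^ m * e + u * y + j * y) + (q * s) ^ m * (e * j)"
            by (simp add: algebra_simps)
          also have "(q * s) ^ m * (e * j) = (q * s) ^ Suc m * e"
          proof -
            have "e * j = e * e * j" by (simp add: ee)
            then have "e * j = e * (q * s)" by (simp add: s mult.assoc)
            then show ?thesis by (simp add: mult_ac)
          qed
          finally show ?case by auto
        qed
        have "(q * s) ^ n * e = 0" by (simp add: power_mult_distrib q)
        then obtain y where y: "e * g ^ n = u * y" using epow[of n] u(3) by auto
        have "q ^ a * (e * g ^ n) = q ^ a * (e * (e * g ^ n))" by (simp add: mult.assoc[symmetric] ee)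
        also have "\<dots> = (q ^ a * (e * u)) * y" by (simp add: y mult_ac)
        also have "\<dots> \<in> I''" using u(1) unfolding C_def by (auto intro: idl_mult'[OF I''(1)])
        finally show ?thesis .
      qed
      have g1: "q ^ a * (e * g ^ n) \<in> I" and g2: "q ^ a * (e * g ^ n) \<in> I'"
        using power_mem[OF I(1)] power_mem[OF I(2)] KK unfolding L_def by blast+
      show ?case
      proof (intro ballI impI)
        fix x assume x: "x \<in> I" "\<exists>s. x = q ^ a * (e * s)"
        then obtain s where s: "x = q ^ a * (e * s)" by blast
        have sL: "s \<in> L" unfolding L_def using x(1) s msum_left[OF J, of "C a I"] by (auto simp: C_def)
        have "s - s * g ^ m \<in> J" for m
        proof (induction m)
          case (Suc m)
          have "s - s * g ^ Suc m = (s - s * g) + g * (s - s * g ^ m)" by (simp add: algebra_simps)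
          also have "\<dots> \<in> J" by (intro submod_add[OF J] idl_mult[OF J] Suc.IH g(2) sL)
          finally show ?case .
        qed (simp add: submod_0[OF J])
        then obtain y where y: "e * (s - s * g ^ n) = q * y" using eJ by blast
        \<comment> \<open>\<open>z\<close> lies in both ideals, and \<open>s\<close> is congruent to
          \<open>s * g ^ n\<close> modulo \<open>J\<close>; hence \<open>x - z\<close> gains a
          factor \<open>q\<close> and the induction hypothesis applies to it.\<close>
        define z where "z = s * (q ^ a * (e * g ^ n))"
        have zI: "z \<in> I" "z \<in> I'" unfolding z_def by (intro idl_mult[OF I(1)] idl_mult[OF I(2)] g1 g2)+
        have "x - z = q ^ a * (e * (s - s * g ^ n))" by (simp add: s z_def algebra_simps)
        also have "\<dots> = q ^ a * (e * (e * (s - s * g ^ n)))" by (simp add: mult.assoc[symmetric] ee)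
        also have "\<dots> = q ^ Suc a * (e * y)" by (simp add: y mult_ac)
        finally have "x - z = q ^ Suc a * (e * y)" .
        moreover have "x - z \<in> I" by (rule idl_diff[OF I(1) x(1) zI(1)])
        ultimately have "x - z \<in> I'" using step.IH by blast
        from submod_add[OF I(2) this zI(2)] show "x \<in> I'" by simp
      qed
    qed
    have "e * x \<in> I" by (rule idl_mult[OF I(1) I(4)])
    then show ?thesis using claim[of 0] by auto
  qed
  define X where "X = (ideals_of UNIV :: 'a set set)"
  have Xs: "submod UNIV I" if "I \<in> X" for I using that by (simp add: X_def ideals_of_def)
  have "msum (C a I) J \<in> ideals_above J" if "I \<in> X" for a I
    unfolding ideals_above_def using submod_msum[OF Cs[OF Xs[OF that]] J] msum_right[OF Cs[OF Xs[OF that]]] by simp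
  then have "K ` X \<subseteq> {f. \<forall>a. (a \<in> {..<n} \<longrightarrow> f a \<in> ideals_above J) \<and> (a \<notin> {..<n} \<longrightarrow> f a = {})}"
    by (auto simp: K_def)
  moreover have "finite {f. \<forall>a. (a \<in> {..<n} \<longrightarrow> f a \<in> ideals_above J) \<and> (a \<notin> {..<n} \<longrightarrow> f a = {})}"
    using fin by (intro finite_set_of_finite_funs) (auto simp: J_def)
  ultimately have finK: "finite (K ` X)" by (rule finite_subset)
  have dep: "(*) e ` I \<subseteq> (*) e ` I'" if "I \<in> X" "I' \<in> X" "K I = K I'" for I I'
  proof
    fix z assume "z \<in> (*) e ` I"
    then obtain x where x: "x \<in> I" "z = e * x" by blast
    have "e * x \<in> I'" using sub[OF Xs[OF that(1)] Xs[OF that(2)] that(3) x(1)] .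
    moreover have "z = e * (e * x)" by (simp add: x mult.assoc[symmetric] ee)
    ultimately show "z \<in> (*) e ` I'" by blast
  qed
  define h where "h k = (*) e ` (SOME I. I \<in> X \<and> K I = k)" for k
  have "(*) e ` I = h (K I)" if "I \<in> X" for I
  proof -
    have s: "(SOME I'. I' \<in> X \<and> K I' = K I) \<in> X \<and> K (SOME I'. I' \<in> X \<and> K I' = K I) = K I"
      by (rule someI[of _ I]) (use that in simp)
    show ?thesis unfolding h_def using dep s that by (metis subset_antisym)
  qed
  then have "(\<lambda>I. (*) e ` I) ` X = h ` (K ` X)" by (auto simp: image_image)
  then show ?thesis using finK by (simp add: X_def)
qed

section \<open>Assembling the local factors\<close>

locale separable_fmir =
  fixes R :: "'a::comm_ring_1 set" and \<sigma> :: "'a tens"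
  assumes R: "subr R" and fin: "finite (ideals_of R)"
    and \<sigma>: "mult_ten \<sigma> = 1" "\<And>s. \<sigma> * dif s \<in> gen (tens_rels R)"
begin

lemma prime_props:
  assumes P: "prime_in R P" and e: "local_idem R P e"
  shows "semisimple_mod UNIV (gen P)" "finite (ideals_above (gen P))" "\<exists>n x. span_mod R (gen P) n x"
  using separable_semisimple[OF R submod_gen field_mod_prime[OF P e] separable_mod_of_element[OF submod_gen \<sigma>]]
    separable_finite_ideals_above[OF R submod_gen field_mod_prime[OF P e] separable_mod_of_element[OF submod_gen \<sigma>]]
    separable_finite_span[OF R submod_gen field_mod_prime[OF P e] separable_mod_of_element[OF submod_gen \<sigma>]]
  by blast+

lemma finite_local:
  assumes P: "prime_in R P" and e: "local_idem R P e" and "finite ((*) e ` R)"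
  shows "finite (range ((*) e))"
  using finite_local_extension[OF R P e assms(3)] prime_props(3)[OF P e] by blast

lemma prin_image: "prin R e = (*) e ` R"
  by (auto simp: prin_def)

lemma finite_images_if_finite:
  assumes "finite (range ((*) e))" shows "finite ((\<lambda>M. (*) e ` M) ` X)"
proof (rule finite_subset)
  show "(\<lambda>M. (*) e ` M) ` X \<subseteq> Pow (range ((*) e))" by blast
qed (use assms in simp)

theorem finite_ideals: "finite (ideals_of (UNIV :: 'a set))"
proof (rule finite_if_locally_finite[OF R fin])
  show "submod R M" if "M \<in> ideals_of UNIV" for M
    using that by (auto simp: ideals_of_def intro: submod_mono)
  fix P assume P: "prime_in R P"
  then obtain e where e: "local_idem R P e" using local_idem_exists[OF R fin] by blast
  have "finite ((\<lambda>M. (*) e ` M) ` ideals_of UNIV)"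
  proof (cases "finite ((*) e ` R)")
    case True then show ?thesis by (intro finite_images_if_finite finite_local[OF P e])
  next
    case False
    then obtain q n where "e * q = q" "q ^ n = 0" "\<And>p. p \<in> P \<Longrightarrow> \<exists>r\<in>R. e * p = q * r"
      using local_finite_or_principal[OF R fin P e] unfolding prin_image by blast
    then show ?thesis using finite_local_ideals_principal[OF P e] prime_props[OF P e] by blast
  qed
  then show "\<exists>e. local_idem R P e \<and> finite ((\<lambda>M. (*) e ` M) ` ideals_of UNIV)" using e by blast
qed

text \<open>The condition \<open>rk\<close> concerns only the factors that are neither finite nor a
  field. It says that \<open>e S\<close> is spanned over \<open>e R\<close> by \<open>e\<close> and
  \<open>e * b\<close>.\<close>

theorem finite_intermediate:
  assumes rk: "\<And>P e. prime_in R P \<Longrightarrow> local_idem R P e \<Longrightarrow> infinite ((*) e ` R) \<Longrightarrow> \<exists>p\<in>P. e * p \<noteq> 0 \<Longrightarrow>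
      \<exists>b. \<forall>s. \<exists>c\<in>R. \<exists>d\<in>R. e * s = e * (c + d * b)"
  shows "finite {T. subr T \<and> R \<subseteq> T}"
proof (rule finite_if_locally_finite[OF R fin])
  let ?X = "{T. subr T \<and> R \<subseteq> T}"
  show "submod R T" if "T \<in> ?X" for T
    using that by (auto intro: submod_mono[OF submod_self])
  fix P assume P: "prime_in R P"
  then obtain e where e: "local_idem R P e" using local_idem_exists[OF R fin] by blast
  have eR: "e \<in> R" and ee: "e * e = e" using e by (auto simp: local_idem_def)
  consider "finite ((*) e ` R)" | "\<And>p. p \<in> P \<Longrightarrow> e * p = 0" | "infinite ((*) e ` R)" "\<exists>p\<in>P. e * p \<noteq> 0" by blast
  then have "finite ((\<lambda>M. (*) e ` M) ` ?X)"
  proof cases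
    case 1 then show ?thesis by (intro finite_images_if_finite finite_local[OF P e])
  next
    case 2
    \<comment> \<open>Here \<open>e P = 0\<close>, hence \<open>e J = 0\<close>, and replacing
      \<open>T\<close> by \<open>T + J\<close> does not change \<open>e T\<close>. The enlarged ring
      contains \<open>J\<close>, as \<open>finite_intermediate_rings\<close> demands.\<close>
    define J where "J = gen P"
    have J: "submod UNIV J" unfolding J_def by (rule submod_gen)
    have "finite ((\<lambda>T. (*) e ` T) ` {T. subr T \<and> R \<subseteq> T \<and> J \<subseteq> T})"
      unfolding J_def using finite_intermediate_rings[OF R submod_gen field_mod_prime[OF P e] \<sigma>] by (rule finite_imageI)
    moreover have "(\<lambda>M. (*) e ` M) ` ?X \<subseteq> (\<lambda>T. (*) e ` T) ` {T. subr T \<and> R \<subseteq> T \<and> J \<subseteq> T}"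
    proof (rule image_subsetI)
      fix T assume "T \<in> ?X"
      then have T: "subr T" "R \<subseteq> T" by auto
      have "subr (msum T J)"
        unfolding subr_def
      proof (intro conjI ballI)
        show "1 \<in> msum T J" using msum_left[OF J] subr_1[OF T(1)] by blast
        fix x y assume "x \<in> msum T J" "y \<in> msum T J"
        then obtain t i t' j where h: "t \<in> T" "i \<in> J" "x = t + i" "t' \<in> T" "j \<in> J" "y = t' + j" by (auto elim!: msumE)
        have "x - y = (t - t') + (i - j)" by (simp add: h algebra_simps)
        then show "x - y \<in> msum T J" using h by (simp only:) (intro msumI subr_diff[OF T(1)] idl_diff[OF J])
        have "x * y = t * t' + (t * j + i * y)" by (simp add: h algebra_simps)
        then show "x * y \<in> msum T J"
          using h by (simp only:) (intro msumI subr_mult[OF T(1)] submod_add[OF J] idl_mult[OF J] idl_mult'[OF J])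
      qed
      moreover have "R \<subseteq> msum T J" "J \<subseteq> msum T J"
        using msum_left[OF J, of T] msum_right[OF submod_self[OF T(1)], of J] T(2) by auto
      moreover have "(*) e ` T = (*) e ` msum T J"
      proof
        show "(*) e ` T \<subseteq> (*) e ` msum T J" using msum_left[OF J, of T] by (rule image_mono)
        show "(*) e ` msum T J \<subseteq> (*) e ` T"
        proof (rule image_subsetI)
          fix x assume "x \<in> msum T J"
          then obtain t j where tj: "t \<in> T" "j \<in> J" "x = t + j" by (auto elim!: msumE)
          have "e * j = 0" using gen_prime_ann[OF 2] tj(2) unfolding J_def by blast
          then show "e * x \<in> (*) e ` T" using tj by (auto simp: distrib_left)
        qed
      qed
      ultimately show "(*) e ` T \<in> (\<lambda>T. (*) e ` T) ` {T. subr T \<and> R \<subseteq> T \<and> J \<subseteq> T}" by blast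
    qed
    ultimately show ?thesis by (rule finite_subset[rotated])
  next
    case 3
    then obtain b where b: "\<And>s. \<exists>c\<in>R. \<exists>d\<in>R. e * s = e * (c + d * b)" using rk[OF P e] by blast
    \<comment> \<open>\<open>A T\<close> is an ideal of \<open>R\<close> that determines
      \<open>e T\<close>: if \<open>e * (c + d * b)\<close> lies in \<open>T\<close>, then so does
      \<open>e * (d * b)\<close>, because \<open>e * c\<close> is in \<open>R\<close>.\<close>
    define A where "A T = {r\<in>R. e * (r * b) \<in> T}" for T
    define h where "h B = {e * (c + d * b) |c d. c \<in> R \<and> d \<in> B}" for B
    have "(*) e ` T = h (A T)" if "T \<in> ?X" for T
    proof -
      have T: "subr T" "R \<subseteq> T" using that by auto
      have eT: "e \<in> T" using eR T by blast
      show ?thesis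
      proof
        show "(*) e ` T \<subseteq> h (A T)"
        proof (rule image_subsetI)
          fix t assume t: "t \<in> T"
          obtain c d where cd: "c \<in> R" "d \<in> R" "e * t = e * (c + d * b)" using b by blast
          have "e * (d * b) = e * t - e * c" unfolding cd(3) by (simp add: algebra_simps)
          also have "\<dots> \<in> T" using T(2) cd t eT by (intro subr_diff[OF T(1)] subr_mult[OF T(1)]) auto
          finally have "d \<in> A T" using cd by (simp add: A_def)
          then show "e * t \<in> h (A T)" using cd unfolding h_def by blast
        qed
        show "h (A T) \<subseteq> (*) e ` T"
        proof
          fix z assume "z \<in> h (A T)"
          then obtain c d where cd: "c \<in> R" "d \<in> A T" "z = e * (c + d * b)" unfolding h_def by blast
          have "z = e * (e * c + e * (d * b))" using ee by (simp add: cd(3) distrib_left mult.assoc[symmetric])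
          moreover have "e * c + e * (d * b) \<in> T"
            using cd T(2) by (intro subr_add[OF T(1) subr_mult[OF T(1) eT]]) (auto simp: A_def)
          ultimately show "z \<in> (*) e ` T" by blast
        qed
      qed
    qed
    then have "(\<lambda>M. (*) e ` M) ` ?X = h ` (A ` ?X)" by (auto simp: image_image)
    moreover have "A ` ?X \<subseteq> ideals_of R"
    proof (rule image_subsetI)
      fix T assume "T \<in> ?X"
      then have T: "subr T" "R \<subseteq> T" by auto
      show "A T \<in> ideals_of R"
        unfolding ideals_of_def submod_def A_def
      proof (intro CollectI conjI ballI subsetI)
        show "0 \<in> R" "e * (0 * b) \<in> T" using subr_0[OF R] subr_0[OF T(1)] by auto
        fix r s assume r: "r \<in> {r \<in> R. e * (r * b) \<in> T}"
        then show "r \<in> R" by blast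
        {
          assume s: "s \<in> {r \<in> R. e * (r * b) \<in> T}"
          show "r + s \<in> R" using r s by (auto intro: subr_add[OF R])
          have "e * ((r + s) * b) = e * (r * b) + e * (s * b)" by (simp add: algebra_simps)
          then show "e * ((r + s) * b) \<in> T" using r s by (auto intro: subr_add[OF T(1)])
        }
        {
          assume s: "s \<in> R"
          show "s * r \<in> R" using r s by (auto intro: subr_mult[OF R])
          have "e * (s * r * b) = s * (e * (r * b))" by (simp add: mult_ac)
          moreover have "s \<in> T" "e * (r * b) \<in> T" using r s T(2) by auto
          ultimately show "e * (s * r * b) \<in> T" using subr_mult[OF T(1)] by metis
        }
      qed
    qed
    ultimately show ?thesis using fin by (metis finite_imageI finite_subset)
  qed
  then show "\<exists>e. local_idem R P e \<and> finite ((\<lambda>M. (*) e ` M) ` ?X)" using e by blast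
qed

end

section \<open>Localizations at primes\<close>

lemma ring_of_simps [simp]:
  "carrier (ring_of A) = A" "mult (ring_of A) = (*)" "one (ring_of A) = 1"
  "zero (ring_of A) = 0" "add (ring_of A) = (+)"
  by (simp_all add: ring_of_def)

lemma cring_ring_of:
  assumes R: "subr R" shows "cring (ring_of R)"
proof (rule cringI)
  show "abelian_group (ring_of R)"
  proof (rule abelian_groupI)
    fix x assume "x \<in> carrier (ring_of R)"
    then show "\<exists>y\<in>carrier (ring_of R). y \<oplus>\<^bsub>ring_of R\<^esub> x = \<zero>\<^bsub>ring_of R\<^esub>"
      using subr_uminus[OF R] by (intro bexI[of _ "- x"]) simp_all
  qed (auto simp: subr_rules R add_ac)
  show "Group.comm_monoid (ring_of R)"
    by (rule comm_monoidI) (auto simp: subr_rules R mult_ac)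
qed (auto simp: distrib_right)

lemma cring_idealI:
  fixes L (structure)
  assumes L: "cring L" and I: "I \<subseteq> carrier L" "\<zero> \<in> I" "\<And>x y. x \<in> I \<Longrightarrow> y \<in> I \<Longrightarrow> x \<oplus> y \<in> I"
    "\<And>r x. r \<in> carrier L \<Longrightarrow> x \<in> I \<Longrightarrow> r \<otimes> x \<in> I"
  shows "ideal I L"
proof (rule idealI)
  interpret cring L by fact
  show "ring L" by unfold_locales
  show "subgroup I (add_monoid L)"
  proof (rule subgroup.intro)
    fix x assume x: "x \<in> I"
    have "\<ominus> x = (\<ominus> \<one>) \<otimes> x" using x I(1) by (auto simp: l_minus)
    then have "\<ominus> x \<in> I" using I(4)[OF _ x] by simp
    then show "inv\<^bsub>add_monoid L\<^esub> x \<in> I" by (simp add: a_inv_def)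
  qed (use I in auto)
  show "a \<otimes> x \<in> I" if "a \<in> I" "x \<in> carrier L" for a x
    using I(4)[OF that(2,1)] that I(1) by (auto simp: m_comm)
qed (use I in auto)

lemma ideal_ring_of_iff:
  assumes R: "subr R" shows "ideal I (ring_of R) \<longleftrightarrow> I \<in> ideals_of R"
proof
  assume "ideal I (ring_of R)"
  then interpret ideal I "ring_of R" .
  show "I \<in> ideals_of R"
    using a_subset additive_subgroup.zero_closed[OF additive_subgroup_axioms]
      additive_subgroup.a_closed[OF additive_subgroup_axioms] I_l_closed
    by (auto simp: ideals_of_def submod_def)
next
  assume "I \<in> ideals_of R"
  then show "ideal I (ring_of R)"
    by (intro cring_idealI cring_ring_of R) (auto simp: ideals_of_def submod_def)
qed

lemma primeideal_ring_of_iff: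
  assumes R: "subr R" shows "primeideal P (ring_of R) \<longleftrightarrow> prime_in R P"
proof
  assume "primeideal P (ring_of R)"
  then interpret primeideal P "ring_of R" .
  have P: "P \<in> ideals_of R" using ideal_axioms ideal_ring_of_iff[OF R] by blast
  moreover have "1 \<notin> P" using one_imp_carrier I_notcarr by auto
  ultimately show "prime_in R P" using I_prime by (auto simp: prime_in_def)
next
  assume P: "prime_in R P"
  then have "P \<in> ideals_of R" by (simp add: prime_in_def)
  then show "primeideal P (ring_of R)"
    using P subr_1[OF R] ideal_ring_of_iff[OF R]
    by (intro primeidealI cring_ring_of R) (auto simp: prime_in_def)
qed

lemma FMIR_ring_of_iff:
  assumes R: "subr R" shows "FMIR (ring_of R) \<longleftrightarrow> finite (ideals_of R)"
  using ideal_ring_of_iff[OF R] cring_ring_of[OF R] by (simp add: FMIR_def ideals_of_def)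

lemma subring_ring_of_iff: "subring T (ring_of (UNIV :: 'a::comm_ring_1 set)) \<longleftrightarrow> subr T"
proof -
  interpret cring "ring_of (UNIV :: 'a set)" by (rule cring_ring_of[OF subr_UNIV])
  have neg: "\<ominus>\<^bsub>ring_of UNIV\<^esub> x = - x" for x :: 'a by (rule minus_equality) simp_all
  show ?thesis
  proof
    assume "subring T (ring_of (UNIV :: 'a set))"
    note T = subringE[OF this, unfolded neg ring_of_simps]
    show "subr T"
      unfolding subr_def
    proof (intro conjI ballI)
      fix x y assume "x \<in> T" "y \<in> T"
      then show "x - y \<in> T" "x * y \<in> T" using T(7)[of x "- y"] T(5,6) by auto
    qed (rule T(3))
  next
    assume "subr T"
    then show "subring T (ring_of (UNIV :: 'a set))"
      by (intro subringI) (auto simp: neg subr_rules)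
  qed
qed

text \<open>The operations of a localization are unions over all representatives; this collapses
  them once the result is known to be independent of the choice.\<close>

lemma UN_const: "X \<noteq> {} \<Longrightarrow> (\<And>p. p \<in> X \<Longrightarrow> f p = C) \<Longrightarrow> (\<Union>p\<in>X. f p) = C"
  by auto

definition loc_class :: "'a::comm_ring_1 set \<Rightarrow> 'a set \<Rightarrow> 'a \<Rightarrow> ('a \<times> 'a) set" where
  "loc_class A T a = loc_rel A T `` {(a, 1)}"

text \<open>\<open>A\<^sub>P\<close> is the factor \<open>e A\<close>; \<open>A\<close> is \<open>R\<close> or an extension of it.\<close>

locale localized =
  fixes R P :: "'a::comm_ring_1 set" and e :: 'a and A :: "'a set"
  assumes R: "subr R" and P: "prime_in R P" and e: "local_idem R P e" and A: "subr A" "R \<subseteq> A"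
begin

abbreviation "T \<equiv> R - P"
abbreviation "c \<equiv> loc_class A T"
abbreviation "L \<equiv> localization A T"

lemma ee: "e * e = e" and eR: "e \<in> R" and eA: "e \<in> A"
  using e A by (auto simp: local_idem_def)

lemma eT: "e \<in> T"
  using local_idem_notin[OF P e] eR by blast

lemma inv_T: "t \<in> T \<Longrightarrow> \<exists>w\<in>R. t * w = e"
  using e by (auto simp: local_idem_def)

lemma one_T: "1 \<in> T"
  using P subr_1[OF R] by (auto simp: prime_in_def)

lemma mult_T: "t \<in> T \<Longrightarrow> u \<in> T \<Longrightarrow> t * u \<in> T"
  using P subr_mult[OF R] by (auto simp: prime_in_def)

text \<open>The multiplier \<open>v\<close> can always be \<open>e\<close>: it lies in
  \<open>T\<close> itself, and every element of \<open>T\<close> divides it.\<close>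

lemma rel_iff: "((a, t), (b, u)) \<in> loc_rel A T \<longleftrightarrow> a \<in> A \<and> t \<in> T \<and> b \<in> A \<and> u \<in> T \<and> e * (a * u) = e * (b * t)"
proof -
  have "(\<exists>v\<in>T. v * (a * u - b * t) = 0) \<longleftrightarrow> e * (a * u) = e * (b * t)"
  proof
    assume "\<exists>v\<in>T. v * (a * u - b * t) = 0"
    then obtain v where v: "v \<in> T" "v * (a * u - b * t) = 0" by blast
    then obtain w where w: "v * w = e" using inv_T by blast
    have "e * (a * u) - e * (b * t) = w * (v * (a * u - b * t))" unfolding w[symmetric] by (simp add: algebra_simps)
    then show "e * (a * u) = e * (b * t)" using v by simp
  next
    assume "e * (a * u) = e * (b * t)"
    then have "e * (a * u - b * t) = 0" by (simp add: algebra_simps)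
    then show "\<exists>v\<in>T. v * (a * u - b * t) = 0" using eT by blast
  qed
  then show ?thesis by (auto simp: loc_rel_def)
qed

lemma equiv_rel: "equiv (A \<times> T) (loc_rel A T)"
proof (rule equivI)
  show "loc_rel A T \<subseteq> (A \<times> T) \<times> (A \<times> T)" by (auto simp: loc_rel_def)
  show "refl_on (A \<times> T) (loc_rel A T)"
    by (auto simp: refl_on_def rel_iff)
  show "sym (loc_rel A T)"
    by (auto simp: sym_def rel_iff)
  show "trans (loc_rel A T)"
  proof (rule transI)
    fix x y z assume xy: "(x, y) \<in> loc_rel A T" and yz: "(y, z) \<in> loc_rel A T"
    obtain a t b u d v where eq: "x = (a, t)" "y = (b, u)" "z = (d, v)" by (metis surj_pair)
    have 1: "e * (a * u) = e * (b * t)" and 2: "e * (b * v) = e * (d * u)"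
      and m: "a \<in> A" "t \<in> T" "d \<in> A" "v \<in> T" "u \<in> T"
      using xy yz by (auto simp: eq rel_iff)
    obtain w where w: "u * w = e" using inv_T m by blast
    have "e * (a * v) = (e * e) * (a * v)" by (simp add: ee)
    also have "\<dots> = w * v * (e * (a * u))" unfolding w[symmetric] by (simp add: mult_ac)
    also have "\<dots> = w * t * (e * (b * v))" unfolding 1 by (simp add: mult_ac)
    also have "\<dots> = (u * w) * e * (d * t)" unfolding 2 by (simp add: mult_ac)
    finally have "e * (a * v) = e * (d * t)" unfolding w by (simp add: ee)
    then show "(x, z) \<in> loc_rel A T" using m by (simp add: eq rel_iff)
  qed
qed

lemma class_eq_iff:
  assumes "a \<in> A" "t \<in> T" "b \<in> A" "u \<in> T"
  shows "loc_rel A T `` {(a, t)} = loc_rel A T `` {(b, u)} \<longleftrightarrow> e * (a * u) = e * (b * t)"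
  using eq_equiv_class_iff[OF equiv_rel, of "(a, t)" "(b, u)"] assms rel_iff[of a t b u] by auto

lemma c_eq_iff: "a \<in> A \<Longrightarrow> b \<in> A \<Longrightarrow> c a = c b \<longleftrightarrow> e * a = e * b"
  unfolding loc_class_def using class_eq_iff[of a 1 b 1] one_T by simp

lemma mem_c_iff: "a \<in> A \<Longrightarrow> p \<in> c a \<longleftrightarrow> fst p \<in> A \<and> snd p \<in> T \<and> e * fst p = e * (a * snd p)"
  unfolding loc_class_def using one_T by (cases p) (auto simp: rel_iff)

lemma c_nonempty: "a \<in> A \<Longrightarrow> c a \<noteq> {}"
  using mem_c_iff[of a "(a, 1)"] one_T by auto

text \<open>Denominators can be cleared: if \<open>t * w = e\<close>, then \<open>a / t\<close> is
  the class of \<open>a * w\<close>, since \<open>e\<close> becomes \<open>1\<close>.\<close>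

lemma carrier_L: "carrier L = c ` A"
proof -
  have "(A \<times> T) // loc_rel A T = c ` A"
  proof
    show "(A \<times> T) // loc_rel A T \<subseteq> c ` A"
    proof
      fix X assume "X \<in> (A \<times> T) // loc_rel A T"
      then obtain a t where X: "a \<in> A" "t \<in> T" "X = loc_rel A T `` {(a, t)}" by (auto elim!: quotientE)
      obtain w where w: "w \<in> R" "t * w = e" using inv_T X by blast
      have aw: "a * w \<in> A" using X w A by (auto intro: subr_mult)
      have "e * (a * w * t) = e * (a * e)" unfolding w(2)[symmetric] by (simp add: mult_ac)
      then have "e * (a * 1) = e * (a * w * t)" by (simp add: mult.left_commute ee)
      then have "X = c (a * w)"
        unfolding X(3) loc_class_def using class_eq_iff[OF X(1,2) aw one_T] by simp
      then show "X \<in> c ` A" using aw by blast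
    qed
    show "c ` A \<subseteq> (A \<times> T) // loc_rel A T"
      using one_T unfolding loc_class_def by (auto intro!: quotientI)
  qed
  then show ?thesis by (simp add: localization_def)
qed

lemma c_eqI: "a \<in> A \<Longrightarrow> t \<in> T \<Longrightarrow> b \<in> A \<Longrightarrow> e * a = e * (b * t) \<Longrightarrow> loc_rel A T `` {(a, t)} = c b"
  unfolding loc_class_def using class_eq_iff[of a t b 1] one_T by simp

text \<open>Shared by the product of a localization and by the scalar action between two of
  them.\<close>

lemma mult_rep:
  assumes "e * p = e * (a * s)" "e * q = e * (b * t)"
  shows "e * (p * q) = e * (a * b * (s * t))"
proof -
  have "e * (p * q) = (e * p) * q" by (simp add: mult_ac)
  also have "\<dots> = a * s * (e * q)" unfolding assms(1) by (simp add: mult_ac)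
  also have "\<dots> = e * (a * b * (s * t))" unfolding assms(2) by (simp add: mult_ac)
  finally show ?thesis .
qed

lemma loc_mult_c:
  assumes "a \<in> A" "b \<in> A" shows "loc_mult A T (c a) (c b) = c (a * b)"
  unfolding loc_mult_def
proof (intro UN_const c_nonempty assms c_eqI)
  fix p q assume "p \<in> c a" "q \<in> c b"
  then have p: "fst p \<in> A" "snd p \<in> T" "e * fst p = e * (a * snd p)"
    and q: "fst q \<in> A" "snd q \<in> T" "e * fst q = e * (b * snd q)" using mem_c_iff assms by auto
  show "fst p * fst q \<in> A" "snd p * snd q \<in> T" "a * b \<in> A" using p q assms mult_T subr_mult[OF A(1)] by blast+
  show "e * (fst p * fst q) = e * (a * b * (snd p * snd q))" by (rule mult_rep[OF p(3) q(3)])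
qed

lemma loc_add_c:
  assumes "a \<in> A" "b \<in> A" shows "loc_add A T (c a) (c b) = c (a + b)"
  unfolding loc_add_def
proof (intro UN_const c_nonempty assms c_eqI)
  fix p q assume "p \<in> c a" "q \<in> c b"
  then have p: "fst p \<in> A" "snd p \<in> T" "e * fst p = e * (a * snd p)"
    and q: "fst q \<in> A" "snd q \<in> T" "e * fst q = e * (b * snd q)" using mem_c_iff assms by auto
  have "snd p \<in> A" "snd q \<in> A" using p q A(2) by auto
  then show "fst p * snd q + fst q * snd p \<in> A" using p q by (auto intro!: subr_add[OF A(1)] subr_mult[OF A(1)])
  show "snd p * snd q \<in> T" "a + b \<in> A" using p q assms mult_T subr_add[OF A(1)] by blast+
  have "e * (fst p * snd q + fst q * snd p) = (e * fst p) * snd q + (e * fst q) * snd p" by (simp add: algebra_simps)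
  also have "\<dots> = e * ((a + b) * (snd p * snd q))" unfolding p(3) q(3) by (simp add: algebra_simps)
  finally show "e * (fst p * snd q + fst q * snd p) = e * ((a + b) * (snd p * snd q))" .
qed

lemma L_mult: "a \<in> A \<Longrightarrow> b \<in> A \<Longrightarrow> c a \<otimes>\<^bsub>L\<^esub> c b = c (a * b)"
  and L_add: "a \<in> A \<Longrightarrow> b \<in> A \<Longrightarrow> c a \<oplus>\<^bsub>L\<^esub> c b = c (a + b)"
  by (simp_all add: localization_def loc_mult_c loc_add_c)

lemma L_one: "\<one>\<^bsub>L\<^esub> = c 1"
  and L_zero: "\<zero>\<^bsub>L\<^esub> = c 0"
  by (simp_all add: localization_def loc_class_def)

lemma L_cases: "x \<in> carrier L \<Longrightarrow> (\<And>a. a \<in> A \<Longrightarrow> x = c a \<Longrightarrow> thesis) \<Longrightarrow> thesis"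
  using carrier_L by auto

lemma c_carrier: "a \<in> A \<Longrightarrow> c a \<in> carrier L"
  using carrier_L by auto

lemma cring_L: "cring L"
proof (rule cringI)
  note s = L_mult L_add L_one L_zero c_carrier subr_rules[OF A(1)]
  show "abelian_group L"
  proof (rule abelian_groupI)
    fix x assume "x \<in> carrier L"
    then obtain a where a: "a \<in> A" "x = c a" by (rule L_cases)
    show "\<exists>y\<in>carrier L. y \<oplus>\<^bsub>L\<^esub> x = \<zero>\<^bsub>L\<^esub>"
      using a by (intro bexI[of _ "c (- a)"]) (simp_all add: s)
  qed (auto elim!: L_cases simp: s add_ac)
  show "Group.comm_monoid L"
    by (rule comm_monoidI) (auto elim!: L_cases simp: s mult_ac)
  show "(x \<oplus>\<^bsub>L\<^esub> y) \<otimes>\<^bsub>L\<^esub> z = x \<otimes>\<^bsub>L\<^esub> z \<oplus>\<^bsub>L\<^esub> y \<otimes>\<^bsub>L\<^esub> z"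
    if "x \<in> carrier L" "y \<in> carrier L" "z \<in> carrier L" for x y z
    using that by (auto elim!: L_cases simp: s distrib_right)
qed

text \<open>On the factor \<open>e A\<close> the map \<open>c\<close> is a bijection onto the
  localization.\<close>

lemma finite_carrier_iff: "finite (carrier L) \<longleftrightarrow> finite ((*) e ` A)"
proof -
  have "carrier L = c ` ((*) e ` A)"
  proof -
    have "c a = c (e * a)" if "a \<in> A" for a
      using that c_eq_iff[of a "e * a"] eA A(1) ee by (simp add: subr_mult mult.assoc[symmetric])
    then show ?thesis unfolding carrier_L by (auto simp: image_image)
  qed
  moreover have "inj_on c ((*) e ` A)"
  proof (rule inj_onI)
    fix x y assume "x \<in> (*) e ` A" "y \<in> (*) e ` A" "c x = c y"
    then obtain a b where ab: "a \<in> A" "x = e * a" "b \<in> A" "y = e * b" "c x = c y" by blast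
    then have "e * x = e * y" using c_eq_iff[of x y] eA A(1) by (simp add: subr_mult)
    then show "x = y" using ab ee by (simp add: mult.assoc[symmetric])
  qed
  ultimately show ?thesis by (simp add: finite_image_iff)
qed

end

lemma loc_scal_class:
  assumes R: "subr R" and P: "prime_in R P" and e: "local_idem R P e" and r: "r \<in> R"
  shows "loc_scal (R - P) (loc_class R (R - P) r) (loc_class UNIV (R - P) s) = loc_class UNIV (R - P) (r * s)"
proof -
  interpret L: localized R P e R by unfold_locales (use R P e in auto)
  interpret U: localized R P e UNIV by unfold_locales (use R P e subr_UNIV in auto)
  show ?thesis
    unfolding loc_scal_def
  proof (intro UN_const L.c_nonempty U.c_nonempty r U.c_eqI UNIV_I)
    fix p q assume "p \<in> loc_class R (R - P) r" "q \<in> loc_class UNIV (R - P) s"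
    then have p: "snd p \<in> R - P" "e * fst p = e * (r * snd p)"
      and q: "snd q \<in> R - P" "e * fst q = e * (s * snd q)"
      using L.mem_c_iff[OF r] U.mem_c_iff[of s] by auto
    show "snd p * snd q \<in> R - P" using p q L.mult_T by blast
    show "e * (fst p * fst q) = e * (r * s * (snd p * snd q))" by (rule U.mult_rep[OF p(2) q(2)])
  qed
qed

section \<open>The local ring structure of a localization\<close>

locale localized_fmir =
  fixes R P :: "'a::comm_ring_1 set" and e :: 'a
  assumes R': "subr R" and fin: "finite (ideals_of R)" and P': "prime_in R P" and e': "local_idem R P e"

sublocale localized_fmir \<subseteq> localized R P e R
  by unfold_locales (use R' P' e' in auto)

context localized_fmir
begin

lemma unit_iff: "a \<in> R \<Longrightarrow> (\<exists>y\<in>carrier L. y \<otimes>\<^bsub>L\<^esub> c a = \<one>\<^bsub>L\<^esub>) \<longleftrightarrow> a \<notin> P"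
proof
  assume a: "a \<in> R" and "\<exists>y\<in>carrier L. y \<otimes>\<^bsub>L\<^esub> c a = \<one>\<^bsub>L\<^esub>"
  then obtain b where b: "b \<in> R" "c b \<otimes>\<^bsub>L\<^esub> c a = \<one>\<^bsub>L\<^esub>" by (auto elim!: L_cases)
  then have "e * (b * a) = e * 1" using a c_eq_iff[of "b * a" 1] subr_rules[OF R] by (simp add: L_mult L_one)
  then have "e * b * a = e" by (simp add: mult.assoc)
  show "a \<notin> P"
  proof
    assume "a \<in> P"
    then have "e * b * a \<in> P" using P eR b subr_mult[OF R] by (auto simp: prime_in_def ideals_of_def intro: submod_mult)
    then show False using \<open>e * b * a = e\<close> eT by simp
  qed
next
  assume a: "a \<in> R" "a \<notin> P"
  then obtain w where w: "w \<in> R" "a * w = e" using inv_T by blast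
  have "c w \<otimes>\<^bsub>L\<^esub> c a = \<one>\<^bsub>L\<^esub>"
    using w a c_eq_iff[of "w * a" 1] subr_rules[OF R] ee eR by (simp add: L_mult L_one mult.commute[of w])
  then show "\<exists>y\<in>carrier L. y \<otimes>\<^bsub>L\<^esub> c a = \<one>\<^bsub>L\<^esub>" using w c_carrier by blast
qed

lemma Units_L: "a \<in> R \<Longrightarrow> c a \<in> Units L \<longleftrightarrow> a \<notin> P"
proof -
  assume a: "a \<in> R"
  interpret cring L by (rule cring_L)
  show ?thesis using unit_iff[OF a] c_carrier[OF a] m_comm by (auto simp: Units_def)
qed

text \<open>The nonunits are the classes of elements of \<open>P\<close>, and such a class is zero
  exactly when \<open>e\<close> kills its representative.\<close>

lemma field_iff: "field L \<longleftrightarrow> (\<forall>p\<in>P. e * p = 0)"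
proof
  assume "field L"
  then interpret field L .
  have PR: "P \<subseteq> R" using P by (auto simp: prime_in_def ideals_of_def)
  show "\<forall>p\<in>P. e * p = 0"
  proof
    fix p assume p: "p \<in> P"
    then have "c p \<notin> Units L" using Units_L PR by blast
    then have "c p = \<zero>\<^bsub>L\<^esub>" using field_Units c_carrier p PR by blast
    then show "e * p = 0" using c_eq_iff[of p 0] p PR subr_0[OF R] by (auto simp: L_zero)
  qed
next
  assume z: "\<forall>p\<in>P. e * p = 0"
  interpret cring L by (rule cring_L)
  have "e \<noteq> 0" using eT P by (auto simp: prime_in_def ideals_of_def submod_0)
  show "field L"
  proof (rule cring_fieldI)
    show "Units L = carrier L - {\<zero>\<^bsub>L\<^esub>}"
    proof (intro equalityI subsetI)
      fix x assume x: "x \<in> Units L"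
      then have xc: "x \<in> carrier L" by (rule Units_closed)
      then obtain a where a: "a \<in> R" "x = c a" by (rule L_cases)
      then have "a \<notin> P" using x Units_L by blast
      then obtain w where "a * w = e" using inv_T a by blast
      then have "e * a \<noteq> 0" using \<open>e \<noteq> 0\<close> ee by (metis mult.assoc mult_zero_left)
      then have "x \<noteq> \<zero>\<^bsub>L\<^esub>" using a c_eq_iff[of a 0] subr_0[OF R] by (simp add: L_zero)
      then show "x \<in> carrier L - {\<zero>\<^bsub>L\<^esub>}" using xc by blast
    next
      fix x assume "x \<in> carrier L - {\<zero>\<^bsub>L\<^esub>}"
      then have x: "x \<in> carrier L" "x \<noteq> \<zero>\<^bsub>L\<^esub>" by simp_all
      from x(1) obtain a where a: "a \<in> R" "x = c a" by (rule L_cases)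
      then have "e * a \<noteq> 0" using x(2) c_eq_iff[of a 0] subr_0[OF R] by (simp add: L_zero)
      then have "a \<notin> P" using z by blast
      then show "x \<in> Units L" using Units_L a by blast
    qed
  qed
qed

lemma ideal_M: "ideal (c ` P) L"
proof (rule cring_idealI[OF cring_L])
  have PR: "P \<subseteq> R" and Ps: "submod R P" using P by (auto simp: prime_in_def ideals_of_def)
  show "c ` P \<subseteq> carrier L" unfolding carrier_L using PR by blast
  show "\<zero>\<^bsub>L\<^esub> \<in> c ` P" using submod_0[OF Ps] by (simp add: L_zero)
  show "x \<oplus>\<^bsub>L\<^esub> y \<in> c ` P" if "x \<in> c ` P" "y \<in> c ` P" for x y
    using that PR submod_add[OF Ps] by (auto simp: L_add subset_eq)
  show "r \<otimes>\<^bsub>L\<^esub> x \<in> c ` P" if "r \<in> carrier L" "x \<in> c ` P" for r x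
    using that PR submod_mult[OF Ps] by (auto simp: L_mult subset_eq elim!: L_cases)
qed

lemma proper_ideal_le:
  assumes I: "ideal I L" "I \<noteq> carrier L" shows "I \<subseteq> c ` P"
proof
  interpret ideal I L by fact
  fix x assume x: "x \<in> I"
  then obtain a where a: "a \<in> R" "x = c a" using a_subset by (auto elim: L_cases)
  have "a \<in> P"
  proof (rule ccontr)
    assume "a \<notin> P"
    then obtain y where "y \<in> carrier L" "y \<otimes>\<^bsub>L\<^esub> x = \<one>\<^bsub>L\<^esub>" using unit_iff a by blast
    then have "\<one>\<^bsub>L\<^esub> \<in> I" using I_l_closed[OF x] by metis
    then show False using one_imp_carrier I(2) by blast
  qed
  then show "x \<in> c ` P" using a by blast
qed

lemma M_proper: "c ` P \<noteq> carrier L"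
proof
  assume "c ` P = carrier L"
  then have "c 1 \<in> c ` P" using c_carrier subr_1[OF R] by blast
  then obtain p where p: "p \<in> P" "c 1 = c p" by blast
  have "p \<in> R" using P p by (auto simp: prime_in_def ideals_of_def)
  then have "c p \<in> Units L" using p(2) Units_L[of 1] subr_1[OF R] one_T by simp
  then show False using Units_L \<open>p \<in> R\<close> p(1) by blast
qed

lemma maximal_iff: "maximalideal M L \<longleftrightarrow> M = c ` P"
proof
  assume "maximalideal M L"
  then interpret maximalideal M L .
  have "M \<subseteq> c ` P" using proper_ideal_le[OF ideal_axioms] I_notcarr by blast
  then show "M = c ` P" using I_maximal[OF ideal_M] ideal.Icarr[OF ideal_M] M_proper by blast
next
  assume "M = c ` P"
  moreover have "maximalideal (c ` P) L"
    by (rule maximalidealI[OF ideal_M]) (use M_proper proper_ideal_le in blast)+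
  ultimately show "maximalideal M L" by simp
qed

text \<open>By \<open>local_finite_or_principal\<close> an infinite local factor automatically has a
  principal nilpotent maximal ideal. This reduces the transfer of infinite SPIRs to that of
  finiteness and of being a field.\<close>

theorem inf_SPIR_iff: "inf_SPIR L \<longleftrightarrow> infinite (carrier L) \<and> \<not> field L"
proof
  assume "inf_SPIR L" then show "infinite (carrier L) \<and> \<not> field L" by (simp add: inf_SPIR_def SPIR_def)
next
  assume h: "infinite (carrier L) \<and> \<not> field L"
  have PR: "P \<subseteq> R" and Ps: "submod R P" using P by (auto simp: prime_in_def ideals_of_def)
  have "infinite (prin R e)"
  proof -
    have "prin R e = (*) e ` R" by (auto simp: prin_def)
    then show ?thesis using h finite_carrier_iff by simp
  qed
  then obtain q n where q: "q \<in> P" "q ^ n = 0" "\<And>p. p \<in> P \<Longrightarrow> \<exists>r\<in>R. e * p = q * r"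
    using local_finite_or_principal[OF R fin P e] by blast
  have qR: "q \<in> R" using q PR by blast
  have rep: "\<exists>r\<in>R. x = c (q * r)" if x: "x \<in> c ` P" for x
  proof -
    obtain p where p: "p \<in> P" "x = c p" using x by blast
    then obtain r where r: "r \<in> R" "e * p = q * r" using q by blast
    have "e * p = e * (q * r)" using r(2) ee by (metis mult.assoc)
    then have "c p = c (q * r)" using c_eq_iff[of p "q * r"] p PR qR r subr_mult[OF R] by auto
    then show ?thesis using p r by blast
  qed
  interpret cring L by (rule cring_L)
  have "c ` P = PIdl\<^bsub>L\<^esub> (c q)"
  proof
    show "c ` P \<subseteq> PIdl\<^bsub>L\<^esub> (c q)"
    proof
      fix x assume "x \<in> c ` P"
      then obtain r where r: "r \<in> R" "x = c (q * r)" using rep by blast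
      then have "x = c r \<otimes>\<^bsub>L\<^esub> c q" using qR by (simp add: L_mult mult.commute)
      then show "x \<in> PIdl\<^bsub>L\<^esub> (c q)" using c_carrier r unfolding cgenideal_def by blast
    qed
    show "PIdl\<^bsub>L\<^esub> (c q) \<subseteq> c ` P"
      using cgenideal_minimal[OF ideal_M] q(1) by blast
  qed
  then have prin: "principalideal (c ` P) L"
    using cgenideal_is_principalideal[OF c_carrier[OF qR]] by simp
  \<comment> \<open>Each factor from the maximal ideal contributes one \<open>q\<close>, so any
    product of \<open>n\<close> factors is a multiple of \<open>q ^ n = 0\<close>.\<close>
  have "\<exists>r\<in>R. foldr (\<otimes>\<^bsub>L\<^esub>) xs \<one>\<^bsub>L\<^esub> = c (q ^ length xs * r)" if "set xs \<subseteq> c ` P" for xs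
    using that
  proof (induction xs)
    case Nil
    show ?case using subr_1[OF R] by (intro bexI[of _ 1]) (simp_all add: L_one)
  next
    case (Cons x xs)
    then obtain r where r: "r \<in> R" "foldr (\<otimes>\<^bsub>L\<^esub>) xs \<one>\<^bsub>L\<^esub> = c (q ^ length xs * r)" by auto
    have "x \<in> c ` P" using Cons.prems by simp
    then obtain r' where r': "r' \<in> R" "x = c (q * r')" using rep by blast
    have "foldr (\<otimes>\<^bsub>L\<^esub>) (x # xs) \<one>\<^bsub>L\<^esub> = c (q * r' * (q ^ length xs * r))"
      using r r' qR by (simp add: L_mult subr_rules R)
    also have "\<dots> = c (q ^ length (x # xs) * (r * r'))" by (simp add: mult_ac)
    finally show ?case by (rule bexI) (rule subr_mult[OF R r(1) r'(1)])
  qed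
  note prod = this
  have "nilpotent_ideal L (c ` P)"
    unfolding nilpotent_ideal_def
  proof (intro exI allI impI)
    fix xs assume xs: "length xs = n \<and> set xs \<subseteq> c ` P"
    from prod[OF conjunct2[OF xs]]
    obtain r where "foldr (\<otimes>\<^bsub>L\<^esub>) xs \<one>\<^bsub>L\<^esub> = c (q ^ length xs * r)" by (elim bexE)
    then show "foldr (\<otimes>\<^bsub>L\<^esub>) xs \<one>\<^bsub>L\<^esub> = \<zero>\<^bsub>L\<^esub>" using xs q(2) by (simp add: L_zero)
  qed
  then show "inf_SPIR L"
    using h prin cring_axioms by (simp add: inf_SPIR_def SPIR_def local_ring_def maximal_iff)
qed

end

section \<open>Rank two and flatness\<close>

lemma two_generators:
  assumes R: "subr R" and P: "prime_in R P" and e: "local_idem R P e" and fr: "free_rank_le R P 2"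
  obtains b b' where "\<And>s. \<exists>d\<in>R. \<exists>d'\<in>R. e * s = e * (d * b + d' * b')"
proof -
  interpret L: localized R P e R by unfold_locales (use R P e in auto)
  interpret U: localized R P e UNIV by unfold_locales (use R P e subr_UNIV in auto)
  obtain bs where bs: "length bs \<le> 2" "set bs \<subseteq> carrier (localization UNIV (R - P))"
    "\<And>y. y \<in> carrier (localization UNIV (R - P)) \<Longrightarrow>
       \<exists>cs. length cs = length bs \<and> set cs \<subseteq> carrier (localization R (R - P)) \<and> y = loc_lincomb (R - P) cs bs"
    using fr unfolding free_rank_le_def by metis
  have zero: "loc_rel UNIV (R - P) `` {(0, 1)} = loc_class UNIV (R - P) 0" by (simp add: loc_class_def)
  note lin = loc_lincomb_def zero loc_scal_class[OF R P e] U.loc_add_c[OF UNIV_I UNIV_I]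
  have R0: "0 \<in> R" by (rule subr_0[OF R])
  have rep: "\<exists>cs. length cs = length bs \<and> set cs \<subseteq> loc_class R (R - P) ` R \<and>
      loc_class UNIV (R - P) s = loc_lincomb (R - P) cs bs" for s
    using bs(3)[OF U.c_carrier[OF UNIV_I, of s]] unfolding L.carrier_L .
  have eqI: "e * s = e * t" if "loc_class UNIV (R - P) s = loc_class UNIV (R - P) t" for s t
    using that U.c_eq_iff by simp
  \<comment> \<open>A basis with fewer than two elements is padded with zeros.\<close>
  consider "bs = []" | b where "bs = [b]" | b b' where "bs = [b, b']"
    using bs(1) by (cases bs; cases "tl bs") auto
  then show thesis
  proof cases
    case 1
    have "e * s = e * (0 * 0 + 0 * 0)" for s using rep[of s] eqI[of s 0] by (simp add: 1 lin)
    then show thesis using that[of 0 0] R0 by blast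
  next
    case 2
    then obtain b' where b': "b = loc_class UNIV (R - P) b'" using bs(2) unfolding U.carrier_L by auto
    have "\<exists>d\<in>R. \<exists>d'\<in>R. e * s = e * (d * b' + d' * 0)" for s
    proof -
      obtain cs where cs: "length cs = length bs" "set cs \<subseteq> loc_class R (R - P) ` R"
        "loc_class UNIV (R - P) s = loc_lincomb (R - P) cs bs" using rep[of s] by blast
      obtain x where "cs = [x]" using cs(1) 2 by (auto simp: length_Suc_conv)
      then obtain d where d: "d \<in> R" "cs = [loc_class R (R - P) d]" using cs(2) by auto
      have "e * s = e * (d * b' + 0 * 0)" using cs(3) d by (intro eqI) (simp add: lin 2 b')
      then show ?thesis using d R0 by blast
    qed
    then show thesis using that by blast
  next
    case 3
    then obtain a a' where a: "b = loc_class UNIV (R - P) a" "b' = loc_class UNIV (R - P) a'"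
      using bs(2) unfolding U.carrier_L by auto
    have "\<exists>d\<in>R. \<exists>d'\<in>R. e * s = e * (d * a + d' * a')" for s
    proof -
      obtain cs where cs: "length cs = length bs" "set cs \<subseteq> loc_class R (R - P) ` R"
        "loc_class UNIV (R - P) s = loc_lincomb (R - P) cs bs" using rep[of s] by blast
      obtain x y where "cs = [x, y]" using cs(1) 3 by (auto simp: length_Suc_conv numeral_2_eq_2)
      then obtain d d' where d: "d \<in> R" "d' \<in> R" "cs = [loc_class R (R - P) d, loc_class R (R - P) d']"
        using cs(2) by auto
      have "e * s = e * (d * a + d' * a')" using cs(3) d by (intro eqI) (simp add: lin 3 a)
      then show ?thesis using d by blast
    qed
    then show thesis using that by blast
  qed
qed

text \<open>If \<open>b\<close> has an invertible coefficient \<open>k\<close> in the expansion of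
  \<open>e\<close>, then \<open>b\<close> can be exchanged for \<open>1\<close> in the generating
  pair.\<close>

lemma cyclic_quotient_aux:
  assumes R: "subr R" and ee: "e * e = e"
    and g: "\<And>s. \<exists>d\<in>R. \<exists>d'\<in>R. e * s = e * (d * b + d' * b')"
    and k: "k \<in> R" "k' \<in> R" "e = e * (k * b + k' * b')" and w: "w \<in> R" "k * w = e"
  shows "\<exists>b. \<forall>s. \<exists>c\<in>R. \<exists>d\<in>R. e * s = e * (c + d * b)"
proof (intro exI[of _ b'] allI)
  fix s
  obtain d d' where d: "d \<in> R" "d' \<in> R" "e * s = e * (d * b + d' * b')" using g by blast
  have "e * w = w * (e * (k * b + k' * b'))" using k(3) by (simp add: mult.commute)
  also have "\<dots> = (k * w) * e * b + e * (w * k' * b')" by (simp add: algebra_simps)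
  finally have eb: "e * b = e * w - e * (w * k' * b')" by (simp add: w ee algebra_simps)
  have "e * s = d * (e * b) + e * (d' * b')" unfolding d(3) by (simp add: algebra_simps)
  also have "\<dots> = e * (d * w + (d' - d * w * k') * b')" unfolding eb by (simp add: algebra_simps)
  finally have "e * s = e * (d * w + (d' - d * w * k') * b')" .
  moreover have "d * w \<in> R" "d' - d * w * k' \<in> R" using d k w by (simp_all add: subr_rules R)
  ultimately show "\<exists>c\<in>R. \<exists>d\<in>R. e * s = e * (c + d * b')" by blast
qed

text \<open>One of the two coefficients in the expansion of \<open>e\<close> is outside
  \<open>P\<close>, hence invertible on the factor. Otherwise \<open>e\<close> would be a sum of two
  nilpotents and therefore zero, although it is not in \<open>P\<close>.\<close>

lemma cyclic_quotient:
  assumes R: "subr R" and P: "prime_in R P" and e: "local_idem R P e"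
    and g: "\<And>s. \<exists>d\<in>R. \<exists>d'\<in>R. e * s = e * (d * b + d' * b')"
  shows "\<exists>b. \<forall>s. \<exists>c\<in>R. \<exists>d\<in>R. e * s = e * (c + d * b)"
proof -
  have ee: "e * e = e" and inv: "\<And>r. r \<in> R \<Longrightarrow> r \<notin> P \<Longrightarrow> \<exists>t\<in>R. r * t = e"
    and nil: "\<And>p. p \<in> P \<Longrightarrow> \<exists>n. (e * p) ^ n = 0"
    using e by (auto simp: local_idem_def)
  obtain k k' where k: "k \<in> R" "k' \<in> R" "e * 1 = e * (k * b + k' * b')" using g by blast
  then have k1: "e = e * (k * b + k' * b')" by simp
  consider "k \<notin> P" | "k' \<notin> P" | "k \<in> P" "k' \<in> P" by blast
  then show ?thesis
  proof cases
    case 1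
    then obtain w where "w \<in> R" "k * w = e" using inv k by blast
    then show ?thesis using cyclic_quotient_aux[OF R ee g k(1,2) k1] by blast
  next
    case 2
    then obtain w where w: "w \<in> R" "k' * w = e" using inv k by blast
    have g': "\<exists>d\<in>R. \<exists>d'\<in>R. e * s = e * (d * b' + d' * b)" for s using g[of s] by (metis add.commute)
    have "e = e * (k' * b' + k * b)" using k1 by (simp add: add.commute)
    from cyclic_quotient_aux[OF R ee g' k(2,1) this w] show ?thesis .
  next
    case 3
    obtain n m where nm: "(e * k) ^ n = 0" "(e * k') ^ m = 0" using nil 3 by blast
    define u v where "u = e * k * b" and "v = e * k' * b'"
    have un: "u ^ n = 0" and vm: "v ^ m = 0" unfolding u_def v_def power_mult_distrib[of _ b] power_mult_distrib[of _ b'] nm by simp_all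
    have uv: "e = u + v" using k1 by (simp add: u_def v_def algebra_simps)
    obtain w where w: "(1 - u) * w = 1" using one_minus_nilpotent_unit[OF subr_UNIV UNIV_I un] by blast
    have "e * u = u" unfolding u_def by (simp add: mult.assoc[symmetric] ee)
    \<comment> \<open>\<open>1 - u\<close> is a unit, so \<open>e\<close> is a multiple of the
      nilpotent \<open>v\<close>; being idempotent, it vanishes.\<close>
    then have "v = e * (1 - u)" using uv by (simp add: algebra_simps)
    then have "e = v * w" using w by (metis mult.assoc mult.right_neutral)
    then have "e ^ m = 0" using vm by (simp add: power_mult_distrib)
    then have "e = 0" by (rule idem_nilpotent_eq_0[OF ee])
    then show ?thesis using local_idem_notin[OF P e] P by (auto simp: prime_in_def ideals_of_def submod_0)
  qed
qed

text \<open>Outside the support \<open>R\<close> and \<open>S\<close> have the same localization, so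
  \<open>b = 0\<close> works. This covers the primes to which the rank condition does not
  apply.\<close>

lemma cyclic_quotient_outside_Supp:
  assumes R: "subr R" and P: "prime_in R P" and e: "local_idem R P e" and S: "P \<notin> Supp R"
  shows "\<exists>b. \<forall>s. \<exists>c\<in>R. \<exists>d\<in>R. e * s = e * (c + d * b)"
proof (intro exI[of _ 0] allI)
  fix s
  obtain t where t: "t \<in> R - P" "t * s \<in> R"
    using S P primeideal_ring_of_iff[OF R] by (auto simp: Supp_def)
  then obtain w where w: "w \<in> R" "t * w = e" using e by (auto simp: local_idem_def)
  have "e * (w * (t * s)) = e * (t * w) * s" by (simp add: mult_ac)
  also have "\<dots> = e * s" unfolding w using e by (simp add: local_idem_def)
  finally have "e * s = e * (w * (t * s) + 0 * 0)" by simp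
  moreover have "w * (t * s) \<in> R" "0 \<in> R" using w t by (simp_all add: subr_rules R)
  ultimately show "\<exists>c\<in>R. \<exists>d\<in>R. e * s = e * (c + d * 0)" by blast
qed

text \<open>Flatness writes \<open>\<epsilon>\<close> as a combination whose coefficients lie in \<open>R\<close> and annihilate \<open>r\<close>; since \<open>\<epsilon> \<notin> Q\<close>,
  one of them is a unit of \<open>R\<^sub>P\<close>.\<close>

lemma flat_local_injective:
  fixes R :: "'a::comm_ring_1 set"
  assumes fl: "flat_ext R" and Q: "prime_in UNIV Q" and \<epsilon>: "\<epsilon> \<notin> Q"
    and e: "local_idem R (Q \<inter> R) e" and r: "r \<in> R" "r * \<epsilon> = 0"
  shows "e * r = 0"
proof -
  have Qs: "submod UNIV Q" using Q by (auto simp: prime_in_def ideals_of_def)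
  have "(\<forall>i<1. r \<in> R) \<and> (\<Sum>i<(1::nat). r * \<epsilon>) = 0" using r by simp
  from fl[unfolded flat_ext_def, rule_format, of 1 "\<lambda>_. r" "\<lambda>_. \<epsilon>", OF this]
  obtain m :: nat and a :: "nat \<Rightarrow> nat \<Rightarrow> 'a" and y :: "nat \<Rightarrow> 'a"
    where "\<forall>i<1. \<forall>j<m. a i j \<in> R" "\<forall>i<1. \<epsilon> = (\<Sum>j<m. a i j * y j)"
    "\<forall>j<m. (\<Sum>i<(1::nat). r * a i j) = 0" by (elim exE conjE)
  then have may: "\<forall>j<m. a 0 j \<in> R" "\<epsilon> = (\<Sum>j<m. a 0 j * y j)" "\<forall>j<m. r * a 0 j = 0" by simp_all
  have "\<exists>j<m. a 0 j \<notin> Q"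
  proof (rule ccontr)
    assume "\<not> (\<exists>j<m. a 0 j \<notin> Q)"
    then have "\<epsilon> \<in> Q" unfolding may(2) by (intro submod_sum[OF Qs] idl_mult'[OF Qs]) auto
    then show False using \<epsilon> by blast
  qed
  then obtain j where j: "j < m" "a 0 j \<notin> Q" by blast
  then obtain w where w: "a 0 j * w = e" using may(1) e unfolding local_idem_def by blast
  have "e * r = (r * a 0 j) * w" unfolding w[symmetric] by (simp add: mult_ac)
  then show ?thesis using may(3) j by simp
qed

theorem theorem3p10:
  fixes R :: "'a::comm_ring_1 set"
  assumes ext: "subring R (ring_of (UNIV :: 'a set))"
    and et: "etale R"
    and fmir: "FMIR (ring_of R)"
  shows "FMIR (ring_of (UNIV :: 'a set)) \<and>
         (\<forall>Q. primeideal Q (ring_of (UNIV :: 'a set)) \<longrightarrow>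
            (field (localization UNIV (UNIV - Q)) \<longleftrightarrow> field (localization R (R - (Q \<inter> R)))) \<and>
            (finite (carrier (localization UNIV (UNIV - Q))) \<longleftrightarrow>
               finite (carrier (localization R (R - (Q \<inter> R))))) \<and>
            (inf_SPIR (localization UNIV (UNIV - Q)) \<longleftrightarrow>
               inf_SPIR (localization R (R - (Q \<inter> R))))) \<and>
         ((\<forall>P\<in>Supp R. inf_SPIR (localization R (R - P)) \<longrightarrow> free_rank_le R P 2) \<longrightarrow> FIP R)"
proof -
  have R: "subr R" using ext subring_ring_of_iff by blast
  have fin: "finite (ideals_of R)" using fmir FMIR_ring_of_iff[OF R] by blast
  have fl: "flat_ext R" and un: "unramified R" using et by (auto simp: etale_def)
  obtain n x where ft: "fin_type R n x"
    using et unfolding etale_def fin_pres_def fin_type_def by blast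
  obtain \<sigma> where sig: "mult_ten \<sigma> = 1" "\<And>s. \<sigma> * dif s \<in> gen (tens_rels R)"
    using separability_element[OF R ft un] by blast
  interpret separable_fmir R \<sigma> by unfold_locales (use R fin sig in auto)
  have finS: "finite (ideals_of (UNIV :: 'a set))" by (rule finite_ideals)
  have local: "(field (localization UNIV (UNIV - Q)) \<longleftrightarrow> field (localization R (R - (Q \<inter> R)))) \<and>
      (finite (carrier (localization UNIV (UNIV - Q))) \<longleftrightarrow> finite (carrier (localization R (R - (Q \<inter> R))))) \<and>
      (inf_SPIR (localization UNIV (UNIV - Q)) \<longleftrightarrow> inf_SPIR (localization R (R - (Q \<inter> R))))"
    if "primeideal Q (ring_of (UNIV :: 'a set))" for Q
  proof -
    have Q: "prime_in UNIV Q" using that primeideal_ring_of_iff[OF subr_UNIV] by blast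
    then have Qi: "Q \<in> ideals_of UNIV" and Qs: "submod UNIV Q" by (auto simp: prime_in_def ideals_of_def)
    define P where "P = Q \<inter> R"
    have P: "prime_in R P"
      unfolding prime_in_def ideals_of_def P_def using Q subr_rules[OF R]
      by (auto simp: prime_in_def ideals_of_def intro: submod_inter[OF submod_mono[OF Qs] submod_self[OF R]])
    obtain e where e: "local_idem R P e" using local_idem_exists[OF R fin P] by blast
    obtain \<epsilon> where eps: "local_idem UNIV Q \<epsilon>" using local_idem_exists[OF subr_UNIV finS Q] by blast
    interpret LR: localized_fmir R P e by unfold_locales (use R fin P e in auto)
    interpret LS: localized_fmir UNIV Q \<epsilon> by unfold_locales (use subr_UNIV finS Q eps in auto)
    \<comment> \<open>\<open>e\<close> is invertible at \<open>Q\<close>, so it divides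
      \<open>\<epsilon>\<close> and \<open>e * \<epsilon> = \<epsilon>\<close>: the factor of
      \<open>S\<close> at \<open>Q\<close> lies inside \<open>e S\<close>.\<close>
    have "e \<in> UNIV - Q" using LR.eT by (auto simp: P_def)
    then obtain t where "e * t = \<epsilon>" using LS.inv_T by blast
    then have e\<epsilon>: "e * \<epsilon> = \<epsilon>" using LR.ee by (metis mult.assoc)
    have inj: "e * r = 0" if "r \<in> R" "r * \<epsilon> = 0" for r
      using flat_local_injective[OF fl Q _ e[unfolded P_def] that] LS.eT by blast
    have f: "field (localization UNIV (UNIV - Q)) \<longleftrightarrow> field (localization R (R - P))"
      unfolding LS.field_iff LR.field_iff
    proof
      assume z: "\<forall>q\<in>Q. \<epsilon> * q = 0"
      show "\<forall>p\<in>P. e * p = 0"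
      proof
        fix p assume "p \<in> P"
        then show "e * p = 0" using z by (intro inj) (auto simp: P_def mult.commute)
      qed
    next
      assume z: "\<forall>p\<in>P. e * p = 0"
      have zJ: "e * j = 0" if "j \<in> gen P" for j by (rule gen_prime_ann[OF _ that]) (use z in blast)
      \<comment> \<open>\<open>Q\<close> is generated modulo \<open>P S\<close> by \<open>h\<close>.
        As \<open>e\<close> kills \<open>P S\<close>, so does \<open>\<epsilon>\<close>, and
        \<open>\<epsilon> * h\<close> is idempotent on the nose. It is also nilpotent because
        \<open>h\<close> is in \<open>Q\<close>, so it is zero and \<open>\<epsilon>\<close> kills
        \<open>Q\<close>.\<close>
      obtain h where h: "h \<in> Q" "\<And>t. t \<in> Q \<Longrightarrow> t - t * h \<in> gen P"
        using prime_props(1)[OF P e] Qi unfolding semisimple_mod_def by blast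
      have th: "\<epsilon> * t = \<epsilon> * (t * h)" if "t \<in> Q" for t
      proof -
        have "\<epsilon> * t - \<epsilon> * (t * h) = \<epsilon> * (e * (t - t * h))"
          by (simp add: right_diff_distrib mult.assoc[symmetric]) (simp add: mult.commute[of \<epsilon> e] e\<epsilon>)
        then show ?thesis using zJ[OF h(2)[OF that]] by simp
      qed
      have "(\<epsilon> * h) * (\<epsilon> * h) = (\<epsilon> * \<epsilon>) * (h * h)" by (simp add: mult_ac)
      also have "\<dots> = \<epsilon> * h" unfolding LS.ee th[OF h(1), symmetric] ..
      finally have idem: "(\<epsilon> * h) * (\<epsilon> * h) = \<epsilon> * h" .
      obtain k where "(\<epsilon> * h) ^ k = 0" using eps h(1) by (auto simp: local_idem_def)
      then have "\<epsilon> * h = 0" by (rule idem_nilpotent_eq_0[OF idem])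
      then show "\<forall>q\<in>Q. \<epsilon> * q = 0" using th by (metis mult.left_commute mult_zero_right)
    qed
    have c: "finite (carrier (localization UNIV (UNIV - Q))) \<longleftrightarrow> finite (carrier (localization R (R - P)))"
      unfolding LS.finite_carrier_iff LR.finite_carrier_iff
    proof
      assume fS: "finite (range ((*) \<epsilon>))"
      have "(*) \<epsilon> ` ((*) e ` R) \<subseteq> range ((*) \<epsilon>)" by blast
      then have "finite ((*) \<epsilon> ` ((*) e ` R))" using fS by (rule finite_subset)
      \<comment> \<open>Flatness, through \<open>inj\<close>, embeds \<open>e R\<close> into
        \<open>\<epsilon> S\<close>, so finiteness descends.\<close>
      moreover have "inj_on ((*) \<epsilon>) ((*) e ` R)"
      proof (rule inj_onI)
        fix y z assume "y \<in> (*) e ` R" "z \<in> (*) e ` R" and eq: "\<epsilon> * y = \<epsilon> * z"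
        then obtain r s where rs: "r \<in> R" "s \<in> R" "y = e * r" "z = e * s" by blast
        have "(y - z) * \<epsilon> = 0" using eq by (simp add: algebra_simps)
        moreover have "y - z \<in> R" using rs LR.eR by (simp add: subr_rules R)
        ultimately have "e * (y - z) = 0" by (intro inj)
        then show "y = z" using rs LR.ee by (simp add: right_diff_distrib mult.assoc[symmetric])
      qed
      ultimately show "finite ((*) e ` R)" by (rule finite_imageD)
    next
      assume "finite ((*) e ` R)"
      then have "finite (range ((*) e))" by (rule finite_local[OF P e])
      moreover have "range ((*) \<epsilon>) \<subseteq> range ((*) e)"
      proof (rule image_subsetI)
        fix s
        have "\<epsilon> * s = e * (\<epsilon> * s)" by (simp add: mult.assoc[symmetric] e\<epsilon>)
        then show "\<epsilon> * s \<in> range ((*) e)" by (rule range_eqI)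
      qed
      ultimately show "finite (range ((*) \<epsilon>))" by (rule finite_subset[rotated])
    qed
    show ?thesis using f c LR.inf_SPIR_iff LS.inf_SPIR_iff by (simp add: P_def)
  qed
  have "FIP R" if rk: "\<forall>P\<in>Supp R. inf_SPIR (localization R (R - P)) \<longrightarrow> free_rank_le R P 2"
  proof -
    have "finite {T. subr T \<and> R \<subseteq> T}"
    proof (rule finite_intermediate)
      fix P e assume P: "prime_in R P" and e: "local_idem R P e" and inf: "infinite ((*) e ` R)" and nf: "\<exists>p\<in>P. e * p \<noteq> 0"
      interpret LR: localized_fmir R P e by unfold_locales (use R fin P e in auto)
      \<comment> \<open>The factors left over by \<open>finite_intermediate\<close> are exactly the
        infinite SPIRs, where the rank hypothesis is available on the support.\<close>
      have sp: "inf_SPIR (localization R (R - P))"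
        unfolding LR.inf_SPIR_iff LR.finite_carrier_iff LR.field_iff using inf nf by blast
      show "\<exists>b. \<forall>s. \<exists>c\<in>R. \<exists>d\<in>R. e * s = e * (c + d * b)"
      proof (cases "P \<in> Supp R")
        case True
        then have "free_rank_le R P 2" using rk sp by blast
        then obtain b b' where "\<And>s. \<exists>d\<in>R. \<exists>d'\<in>R. e * s = e * (d * b + d' * b')"
          using two_generators[OF R P e] by blast
        then show ?thesis by (rule cyclic_quotient[OF R P e])
      qed (rule cyclic_quotient_outside_Supp[OF R P e])
    qed
    then show ?thesis by (simp add: FIP_def subring_ring_of_iff)
  qed
  then show ?thesis using finS local FMIR_ring_of_iff[OF subr_UNIV] by blast
qed

end
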